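(* Let $A$ and $X$ be perfect weak Hopf algebras over a field $k$ with weak antipodes $S_A$ and $S_X$ respectively. Suppose that $S_A$ is invertible and that $(X,A)$ is a weak Hopf skew-pair with respect to a bilinear form $\langle\ ,\ \rangle : X\otimes A\to k$. For $a\in A$, $x\in X$ put $$a\triangleright x=\sum_{(x)}\langle x'S_X(x'''),a\rangle\, x'',\qquad a\triangleleft x=\sum_{(a)}\langle x,S_A^{-1}(a''')a'\rangle\, a''.$$ Then, with these maps $\triangleright: A\otimes X\to X$ and $\triangleleft: A\otimes X\to A$, $(X,A)$ is a quasi-matched pair of bialgebras; hence one obtains a quasi-bicrossed product $X\infty A$ (denoted $D(X,A)$).
   Context: $k$ is a field. Sweedler notation: $\Delta(x)=\sum_{(x)}x'\otimes x''$, and iterated $\sum_{(x)} x'\otimes x''\otimes x'''$, etc. $\ast$ is the convolution product on $\mathrm{Hom}_k(H,H)$. A (bialgebra) weak Hopf algebra is a bialgebra $H$ over $k$ together with $T\in \mathrm{Hom}_k(H,H)$ (the weak antipode) such that $id\ast T\ast id=id$ and $T\ast id\ast T=T$. It is perfect if $T$ is an anti-bialgebra morphism (anti-algebra and anti-coalgebra morphism) and $(id\ast T)(H)\subseteq C(H)$, the center of $H$. Let $A$, $X$ be weak Hopf algebras with weak antipodes $S_A$, $S_X$, with $S_A$ invertible. $(X,A)$ is a weak Hopf skew-pair if there is a non-singular (non-degenerate in both arguments) bilinear form $\langle\ ,\ \rangle: X\otimes A\to k$ such that for all $x,y\in X$, $a,b\in A$: $\langle x,ab\rangle=\sum_{(x)}\langle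 x'',a\rangle\langle x',b\rangle$; $\langle x,1_A\rangle=\varepsilon(x)$; $\langle xy,a\rangle=\sum_{(a)}\langle x,a'\rangle\langle y,a''\rangle$; $\langle 1_X,a\rangle=\varepsilon(a)$; $\langle S_X(x),a\rangle=\langle x,S_A^{-1}(a)\rangle$. For a bialgebra $H$, a coalgebra $C$ that is a left $H$-module is a left quasi-module-coalgebra over $H$ if $\Delta(hc)=\Delta(h)\Delta(c)$ for all $h\in H,c\in C$, i.e. $\Delta(hc)=\sum h'c'\otimes h''c''$ (no condition on counits). Right quasi-module-coalgebras are defined similarly. A pair $(X,A)$ of bialgebras is quasi-matched if there are linear maps $A\otimes X\to X$, $a\otimes x\mapsto a\triangleright x$, and $A\otimes X\to A$, $a\otimes x\mapsto a\triangleleft x$, making $X$ a left $A$-quasi-module-coalgebra and $A$ a right $X$-quasi-module-coalgebra, such that for all $a,b\in A$, $x,y\in X$: (1) $a\triangleright(xy)=\sum_{(a)(x)}(a'\triangleright x')((a''\triangleleft x'')\triangleright y)$; (2) $a\triangleright 1=\varepsilon(a)1$; (3) $(ab)\triangleleft x=\sum_{(b)(x)}(a\triangleleft(b'\triangleright x'))(b''\triangleleft x'')$; (4) $1\triangleleft x=\varepsilon(x)1$; (5) $\sum_{(a)(x)}(a'\triangleleft x')\otimes(a''\triangleright x'')=\sum_{(a)(x)}(a''\triangleleft x'')\otimes(a'\triangleright x')$. An almost bialgebra is a vector space that is both a unital algebra and a counital coalgebra with $\Delta(xy)=\Delta(x)\Delta(y)$. For a quasi-matched pair $(X,A)$, the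 quasi-bicrossed product $X\infty A$ is the vector space $X\otimes A$ with the almost bialgebra structure having identity $1\otimes 1$, product $(x\otimes a)(y\otimes b)=\sum_{(a)(y)}x(a'\triangleright y')\otimes(a''\triangleleft y'')b$, coproduct $\Delta(x\otimes a)=\sum_{(a)(x)}(x'\otimes a')\otimes(x''\otimes a'')$ and counit $\varepsilon(x\otimes a)=\varepsilon_X(x)\varepsilon_A(a)$. *)

theory Defs
  imports Complex_Main "HOL-Library.Function_Algebras"
begin

section \<open>Vector spaces and linear maps\<close>

text \<open>
  A vector space over the field \<open>'k\<close> is a subspace of a type on which \<open>'k\<close> acts; a carrier
  set is needed because a tensor product of two vector spaces over \<open>'k\<close> does not
  fill a whole type.
\<close>

record ('k, 'v) vec =
  carrier :: "'v set"
  smult :: "'k \<Rightarrow> 'v \<Rightarrow> 'v"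

definition vec_space :: "('k::field, 'v::ab_group_add, 'm) vec_scheme \<Rightarrow> bool" where
  "vec_space V \<longleftrightarrow> vector_space (smult V) \<and> module.subspace (smult V) (carrier V)"

definition scalars :: "('k::field, 'k) vec" where
  "scalars = \<lparr>carrier = UNIV, smult = (*)\<rparr>"

definition linear_on ::
  "('k, 'v::ab_group_add, 'm) vec_scheme \<Rightarrow> ('k, 'w::ab_group_add, 'n) vec_scheme
    \<Rightarrow> ('v \<Rightarrow> 'w) \<Rightarrow> bool" where
  "linear_on V W f \<longleftrightarrow>
     (\<forall>x\<in>carrier V. f x \<in> carrier W) \<and>
     (\<forall>x\<in>carrier V. \<forall>y\<in>carrier V. f (x + y) = f x + f y) \<and>
     (\<forall>c. \<forall>x\<in>carrier V. f (smult V c x) = smult W c (f x))"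

definition bilinear_on ::
  "('k, 'v::ab_group_add, 'm) vec_scheme \<Rightarrow> ('k, 'w::ab_group_add, 'n) vec_scheme
    \<Rightarrow> ('k, 'u::ab_group_add, 'o) vec_scheme \<Rightarrow> ('v \<Rightarrow> 'w \<Rightarrow> 'u) \<Rightarrow> bool" where
  "bilinear_on V W U f \<longleftrightarrow>
     (\<forall>x\<in>carrier V. linear_on W U (\<lambda>y. f x y)) \<and>
     (\<forall>y\<in>carrier W. linear_on V U (\<lambda>x. f x y))"


section \<open>Tensor products\<close>

text \<open>
  Over a field, \<open>V \<otimes> W\<close> embeds into the dual of the space of bilinear forms on \<open>V \<times> W\<close>, with
  \<open>x \<otimes> y\<close> acting by evaluation at \<open>(x, y)\<close>; it is realised here as the span of these
  evaluations. The universal property is lemma \<open>tensor_universal\<close> below.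
\<close>

type_synonym ('k, 'v, 'w) tensor = "('v \<Rightarrow> 'w \<Rightarrow> 'k) \<Rightarrow> 'k"

definition tens ::
  "('k::field, 'v::ab_group_add, 'm) vec_scheme \<Rightarrow> ('k, 'w::ab_group_add, 'n) vec_scheme
    \<Rightarrow> 'v \<Rightarrow> 'w \<Rightarrow> ('k, 'v, 'w) tensor" where
  "tens V W x y = (\<lambda>\<beta>. if bilinear_on V W scalars \<beta> then \<beta> x y else 0)"

definition tsmult :: "'k::field \<Rightarrow> ('k, 'v, 'w) tensor \<Rightarrow> ('k, 'v, 'w) tensor" where
  "tsmult c t = (\<lambda>\<beta>. c * t \<beta>)"

definition tensor ::
  "('k::field, 'v::ab_group_add, 'm) vec_scheme \<Rightarrow> ('k, 'w::ab_group_add, 'n) vec_scheme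
    \<Rightarrow> ('k, ('k, 'v, 'w) tensor) vec" where
  "tensor V W =
     \<lparr>carrier = module.span tsmult {tens V W x y | x y. x \<in> carrier V \<and> y \<in> carrier W},
      smult = tsmult\<rparr>"

text \<open>
  For \<open>t = x\<^sub>1 \<otimes> y\<^sub>1 + \<dots> + x\<^sub>n \<otimes> y\<^sub>n\<close> in \<open>V \<otimes> W\<close> and a bilinear map \<open>f\<close>, \<open>tsum V W f t\<close> is
  \<open>f x\<^sub>1 y\<^sub>1 + \<dots> + f x\<^sub>n y\<^sub>n\<close>. It is independent of the chosen representation of \<open>t\<close>
  (lemma \<open>tsum_sum_list\<close>), and \<open>tsum V W f\<close> is the linear map on \<open>V \<otimes> W\<close> induced by \<open>f\<close>.
\<close>

definition tsum ::
  "('k::field, 'v::ab_group_add, 'm) vec_scheme \<Rightarrow> ('k, 'w::ab_group_add, 'n) vec_scheme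
    \<Rightarrow> ('v \<Rightarrow> 'w \<Rightarrow> 'u::ab_group_add) \<Rightarrow> ('k, 'v, 'w) tensor \<Rightarrow> 'u" where
  "tsum V W f t =
     (\<Sum>(x, y) \<leftarrow> (SOME ps. set ps \<subseteq> carrier V \<times> carrier W \<and> t = (\<Sum>(x, y) \<leftarrow> ps. tens V W x y)).
        f x y)"


section \<open>Coalgebras, algebras and bialgebras\<close>

record ('k, 'v) coalg = "('k, 'v) vec" +
  comult :: "'v \<Rightarrow> ('k, 'v, 'v) tensor"
  counit :: "'v \<Rightarrow> 'k"

record ('k, 'v) bialg = "('k, 'v) coalg" +
  mult :: "'v \<Rightarrow> 'v \<Rightarrow> 'v"
  unit_elt :: "'v"

text \<open>Sweedler notation: \<open>sw C f x\<close> is the sum of \<open>f x' x''\<close>, and \<open>sw3 C f x\<close> the sum of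
  \<open>f x' x'' x'''\<close>.\<close>

definition sw ::
  "('k::field, 'v::ab_group_add, 'm) coalg_scheme \<Rightarrow> ('v \<Rightarrow> 'v \<Rightarrow> 'u::ab_group_add) \<Rightarrow> 'v \<Rightarrow> 'u" where
  "sw C f x = tsum C C f (comult C x)"

definition sw3 ::
  "('k::field, 'v::ab_group_add, 'm) coalg_scheme
    \<Rightarrow> ('v \<Rightarrow> 'v \<Rightarrow> 'v \<Rightarrow> 'u::ab_group_add) \<Rightarrow> 'v \<Rightarrow> 'u" where
  "sw3 C f x = sw C (\<lambda>u z. sw C (\<lambda>x' x''. f x' x'' z) u) x"

definition coalgebra :: "('k::field, 'v::ab_group_add, 'm) coalg_scheme \<Rightarrow> bool" where
  "coalgebra C \<longleftrightarrow>
     vec_space C \<and> linear_on C (tensor C C) (comult C) \<and> linear_on C scalars (counit C) \<and>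
     (\<forall>x\<in>carrier C.
        sw C (\<lambda>u z. sw C (\<lambda>x' x''. tens C (tensor C C) x' (tens C C x'' z)) u) x =
        sw C (\<lambda>y u. sw C (\<lambda>x' x''. tens C (tensor C C) y (tens C C x' x'')) u) x) \<and>
     (\<forall>x\<in>carrier C. sw C (\<lambda>x' x''. smult C (counit C x') x'') x = x) \<and>
     (\<forall>x\<in>carrier C. sw C (\<lambda>x' x''. smult C (counit C x'') x') x = x)"

definition unital_algebra :: "('k::field, 'v::ab_group_add, 'm) bialg_scheme \<Rightarrow> bool" where
  "unital_algebra H \<longleftrightarrow>
     vec_space H \<and> bilinear_on H H H (mult H) \<and> unit_elt H \<in> carrier H \<and>
     (\<forall>x\<in>carrier H. \<forall>y\<in>carrier H. \<forall>z\<in>carrier H.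
        mult H (mult H x y) z = mult H x (mult H y z)) \<and>
     (\<forall>x\<in>carrier H. mult H (unit_elt H) x = x \<and> mult H x (unit_elt H) = x)"

definition almost_bialgebra :: "('k::field, 'v::ab_group_add, 'm) bialg_scheme \<Rightarrow> bool" where
  "almost_bialgebra H \<longleftrightarrow>
     unital_algebra H \<and> coalgebra H \<and>
     (\<forall>x\<in>carrier H. \<forall>y\<in>carrier H. comult H (mult H x y) =
        sw H (\<lambda>x' x''. sw H (\<lambda>y' y''. tens H H (mult H x' y') (mult H x'' y'')) y) x)"

definition bialgebra :: "('k::field, 'v::ab_group_add, 'm) bialg_scheme \<Rightarrow> bool" where
  "bialgebra H \<longleftrightarrow>
     almost_bialgebra H \<and>
     comult H (unit_elt H) = tens H H (unit_elt H) (unit_elt H) \<and>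
     (\<forall>x\<in>carrier H. \<forall>y\<in>carrier H. counit H (mult H x y) = counit H x * counit H y) \<and>
     counit H (unit_elt H) = 1"


section \<open>Weak Hopf algebras\<close>

definition convolution ::
  "('k::field, 'v::ab_group_add, 'm) bialg_scheme \<Rightarrow> ('v \<Rightarrow> 'v) \<Rightarrow> ('v \<Rightarrow> 'v) \<Rightarrow> 'v \<Rightarrow> 'v" where
  "convolution H f g = (\<lambda>x. sw H (\<lambda>x' x''. mult H (f x') (g x'')) x)"

definition weak_hopf_algebra ::
  "('k::field, 'v::ab_group_add, 'm) bialg_scheme \<Rightarrow> ('v \<Rightarrow> 'v) \<Rightarrow> bool" where
  "weak_hopf_algebra H T \<longleftrightarrow>
     bialgebra H \<and> linear_on H H T \<and>
     (\<forall>x\<in>carrier H. convolution H (convolution H id T) id x = x) \<and>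
     (\<forall>x\<in>carrier H. convolution H (convolution H T id) T x = T x)"

definition anti_algebra_morphism ::
  "('k::field, 'v::ab_group_add, 'm) bialg_scheme \<Rightarrow> ('v \<Rightarrow> 'v) \<Rightarrow> bool" where
  "anti_algebra_morphism H T \<longleftrightarrow>
     linear_on H H T \<and>
     (\<forall>x\<in>carrier H. \<forall>y\<in>carrier H. T (mult H x y) = mult H (T y) (T x)) \<and>
     T (unit_elt H) = unit_elt H"

definition anti_coalgebra_morphism ::
  "('k::field, 'v::ab_group_add, 'm) coalg_scheme \<Rightarrow> ('v \<Rightarrow> 'v) \<Rightarrow> bool" where
  "anti_coalgebra_morphism C T \<longleftrightarrow>
     linear_on C C T \<and>
     (\<forall>x\<in>carrier C. comult C (T x) = sw C (\<lambda>x' x''. tens C C (T x'') (T x')) x) \<and>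
     (\<forall>x\<in>carrier C. counit C (T x) = counit C x)"

definition center :: "('k::field, 'v::ab_group_add, 'm) bialg_scheme \<Rightarrow> 'v set" where
  "center H = {z \<in> carrier H. \<forall>x\<in>carrier H. mult H z x = mult H x z}"

definition perfect_weak_hopf_algebra ::
  "('k::field, 'v::ab_group_add, 'm) bialg_scheme \<Rightarrow> ('v \<Rightarrow> 'v) \<Rightarrow> bool" where
  "perfect_weak_hopf_algebra H T \<longleftrightarrow>
     weak_hopf_algebra H T \<and> anti_algebra_morphism H T \<and> anti_coalgebra_morphism H T \<and>
     convolution H id T ` carrier H \<subseteq> center H"

definition nondegenerate_form ::
  "('k::field, 'v::ab_group_add, 'm) vec_scheme \<Rightarrow> ('k, 'w::ab_group_add, 'n) vec_scheme
    \<Rightarrow> ('v \<Rightarrow> 'w \<Rightarrow> 'k) \<Rightarrow> bool" where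
  "nondegenerate_form V W B \<longleftrightarrow>
     bilinear_on V W scalars B \<and>
     (\<forall>x\<in>carrier V. (\<forall>a\<in>carrier W. B x a = 0) \<longrightarrow> x = 0) \<and>
     (\<forall>a\<in>carrier W. (\<forall>x\<in>carrier V. B x a = 0) \<longrightarrow> a = 0)"

abbreviation antipode_inv ::
  "('k::field, 'a::ab_group_add, 'm) bialg_scheme \<Rightarrow> ('a \<Rightarrow> 'a) \<Rightarrow> 'a \<Rightarrow> 'a" where
  "antipode_inv A SA \<equiv> inv_into (carrier A) SA"

definition weak_hopf_skew_pair ::
  "('k::field, 'x::ab_group_add, 'm) bialg_scheme \<Rightarrow> ('x \<Rightarrow> 'x)
    \<Rightarrow> ('k, 'a::ab_group_add, 'n) bialg_scheme \<Rightarrow> ('a \<Rightarrow> 'a) \<Rightarrow> ('x \<Rightarrow> 'a \<Rightarrow> 'k) \<Rightarrow> bool" where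
  "weak_hopf_skew_pair X SX A SA B \<longleftrightarrow>
     weak_hopf_algebra X SX \<and> weak_hopf_algebra A SA \<and>
     bij_betw SA (carrier A) (carrier A) \<and>
     nondegenerate_form X A B \<and>
     (\<forall>x\<in>carrier X. \<forall>a\<in>carrier A. \<forall>b\<in>carrier A.
        B x (mult A a b) = sw X (\<lambda>x' x''. B x'' a * B x' b) x) \<and>
     (\<forall>x\<in>carrier X. B x (unit_elt A) = counit X x) \<and>
     (\<forall>x\<in>carrier X. \<forall>y\<in>carrier X. \<forall>a\<in>carrier A.
        B (mult X x y) a = sw A (\<lambda>a' a''. B x a' * B y a'') a) \<and>
     (\<forall>a\<in>carrier A. B (unit_elt X) a = counit A a) \<and>
     (\<forall>x\<in>carrier X. \<forall>a\<in>carrier A. B (SX x) a = B x (antipode_inv A SA a))"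


section \<open>Quasi-matched pairs and the quasi-bicrossed product\<close>

definition left_module ::
  "('k::field, 'h::ab_group_add, 'm) bialg_scheme \<Rightarrow> ('k, 'c::ab_group_add, 'n) vec_scheme
    \<Rightarrow> ('h \<Rightarrow> 'c \<Rightarrow> 'c) \<Rightarrow> bool" where
  "left_module H M act \<longleftrightarrow>
     vec_space M \<and> bilinear_on H M M act \<and>
     (\<forall>m\<in>carrier M. act (unit_elt H) m = m) \<and>
     (\<forall>g\<in>carrier H. \<forall>h\<in>carrier H. \<forall>m\<in>carrier M. act (mult H g h) m = act g (act h m))"

definition right_module ::
  "('k::field, 'h::ab_group_add, 'm) bialg_scheme \<Rightarrow> ('k, 'c::ab_group_add, 'n) vec_scheme
    \<Rightarrow> ('c \<Rightarrow> 'h \<Rightarrow> 'c) \<Rightarrow> bool" where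
  "right_module H M act \<longleftrightarrow>
     vec_space M \<and> bilinear_on M H M act \<and>
     (\<forall>m\<in>carrier M. act m (unit_elt H) = m) \<and>
     (\<forall>g\<in>carrier H. \<forall>h\<in>carrier H. \<forall>m\<in>carrier M. act m (mult H g h) = act (act m g) h)"

definition left_quasi_module_coalgebra ::
  "('k::field, 'h::ab_group_add, 'm) bialg_scheme \<Rightarrow> ('k, 'c::ab_group_add, 'n) coalg_scheme
    \<Rightarrow> ('h \<Rightarrow> 'c \<Rightarrow> 'c) \<Rightarrow> bool" where
  "left_quasi_module_coalgebra H C act \<longleftrightarrow>
     bialgebra H \<and> coalgebra C \<and> left_module H C act \<and>
     (\<forall>h\<in>carrier H. \<forall>c\<in>carrier C. comult C (act h c) =
        sw H (\<lambda>h' h''. sw C (\<lambda>c' c''. tens C C (act h' c') (act h'' c'')) c) h)"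

definition right_quasi_module_coalgebra ::
  "('k::field, 'h::ab_group_add, 'm) bialg_scheme \<Rightarrow> ('k, 'c::ab_group_add, 'n) coalg_scheme
    \<Rightarrow> ('c \<Rightarrow> 'h \<Rightarrow> 'c) \<Rightarrow> bool" where
  "right_quasi_module_coalgebra H C act \<longleftrightarrow>
     bialgebra H \<and> coalgebra C \<and> right_module H C act \<and>
     (\<forall>h\<in>carrier H. \<forall>c\<in>carrier C. comult C (act c h) =
        sw C (\<lambda>c' c''. sw H (\<lambda>h' h''. tens C C (act c' h') (act c'' h'')) h) c)"

definition quasi_matched_pair ::
  "('k::field, 'x::ab_group_add, 'm) bialg_scheme \<Rightarrow> ('k, 'a::ab_group_add, 'n) bialg_scheme
    \<Rightarrow> ('a \<Rightarrow> 'x \<Rightarrow> 'x) \<Rightarrow> ('a \<Rightarrow> 'x \<Rightarrow> 'a) \<Rightarrow> bool" where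
  "quasi_matched_pair X A l r \<longleftrightarrow>
     bialgebra X \<and> bialgebra A \<and>
     left_quasi_module_coalgebra A X l \<and> right_quasi_module_coalgebra X A r \<and>
     (\<forall>a\<in>carrier A. \<forall>x\<in>carrier X. \<forall>y\<in>carrier X.
        l a (mult X x y) =
        sw A (\<lambda>a' a''. sw X (\<lambda>x' x''. mult X (l a' x') (l (r a'' x'') y)) x) a) \<and>
     (\<forall>a\<in>carrier A. l a (unit_elt X) = smult X (counit A a) (unit_elt X)) \<and>
     (\<forall>a\<in>carrier A. \<forall>b\<in>carrier A. \<forall>x\<in>carrier X.
        r (mult A a b) x =
        sw A (\<lambda>b' b''. sw X (\<lambda>x' x''. mult A (r a (l b' x')) (r b'' x'')) x) b) \<and>
     (\<forall>x\<in>carrier X. r (unit_elt A) x = smult A (counit X x) (unit_elt A)) \<and>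
     (\<forall>a\<in>carrier A. \<forall>x\<in>carrier X.
        sw A (\<lambda>a' a''. sw X (\<lambda>x' x''. tens A X (r a' x') (l a'' x'')) x) a =
        sw A (\<lambda>a' a''. sw X (\<lambda>x' x''. tens A X (r a'' x'') (l a' x')) x) a)"

definition quasi_bicrossed_product ::
  "('k::field, 'x::ab_group_add, 'm) bialg_scheme \<Rightarrow> ('k, 'a::ab_group_add, 'n) bialg_scheme
    \<Rightarrow> ('a \<Rightarrow> 'x \<Rightarrow> 'x) \<Rightarrow> ('a \<Rightarrow> 'x \<Rightarrow> 'a) \<Rightarrow> ('k, ('k, 'x, 'a) tensor) bialg" where
  "quasi_bicrossed_product X A l r =
     \<lparr>carrier = carrier (tensor X A),
      smult = smult (tensor X A),
      comult = tsum X A (\<lambda>x a.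
        sw A (\<lambda>a' a''. sw X (\<lambda>x' x''.
          tens (tensor X A) (tensor X A) (tens X A x' a') (tens X A x'' a'')) x) a),
      counit = tsum X A (\<lambda>x a. counit X x * counit A a),
      mult = (\<lambda>s t. tsum X A (\<lambda>x a. tsum X A (\<lambda>y b.
        sw A (\<lambda>a' a''. sw X (\<lambda>y' y''.
          tens X A (mult X x (l a' y')) (mult A (r a'' y'') b)) y) a) t) s),
      unit_elt = tens X A (unit_elt X) (unit_elt A)\<rparr>"

definition skew_left_action ::
  "('k::field, 'x::ab_group_add, 'm) bialg_scheme \<Rightarrow> ('x \<Rightarrow> 'x) \<Rightarrow> ('x \<Rightarrow> 'a \<Rightarrow> 'k)
    \<Rightarrow> 'a \<Rightarrow> 'x \<Rightarrow> 'x" where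
  "skew_left_action X SX B a x =
     sw3 X (\<lambda>x' x'' x'''. smult X (B (mult X x' (SX x''')) a) x'') x"

definition skew_right_action ::
  "('k::field, 'a::ab_group_add, 'n) bialg_scheme \<Rightarrow> ('a \<Rightarrow> 'a) \<Rightarrow> ('x \<Rightarrow> 'a \<Rightarrow> 'k)
    \<Rightarrow> 'a \<Rightarrow> 'x \<Rightarrow> 'a" where
  "skew_right_action A SA B a x =
     sw3 A (\<lambda>a' a'' a'''. smult A (B x (mult A (antipode_inv A SA a''') a')) a'') a"


section \<open>Well-definedness\<close>

lemma vector_space_tsmult: "vector_space (tsmult :: 'k::field \<Rightarrow> ('k, 'v, 'w) tensor \<Rightarrow> _)"
  by unfold_locales (auto simp: tsmult_def fun_eq_iff algebra_simps)

lemma vec_space_scalars: "vec_space (scalars :: ('k::field, 'k) vec)"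
proof -
  interpret vector_space "(*) :: 'k \<Rightarrow> 'k \<Rightarrow> 'k"
    by unfold_locales (auto simp: algebra_simps)
  show ?thesis
    by (simp add: vec_space_def scalars_def vector_space_axioms subspace_UNIV)
qed

lemma vec_space_tensor:
  fixes V :: "('k::field, 'v::ab_group_add, 'm) vec_scheme"
    and W :: "('k, 'w::ab_group_add, 'n) vec_scheme"
  shows "vec_space (tensor V W)"
proof -
  interpret vector_space "tsmult :: 'k \<Rightarrow> ('k, 'v, 'w) tensor \<Rightarrow> _" by (rule vector_space_tsmult)
  show ?thesis
    by (simp add: vec_space_def tensor_def vector_space_axioms subspace_span)
qed

lemma vec_spaceD:
  assumes "vec_space V"
  shows "0 \<in> carrier V" "x \<in> carrier V \<Longrightarrow> y \<in> carrier V \<Longrightarrow> x + y \<in> carrier V"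
    "x \<in> carrier V \<Longrightarrow> smult V c x \<in> carrier V"
    "x \<in> carrier V \<Longrightarrow> y \<in> carrier V \<Longrightarrow> x - y \<in> carrier V"
    "smult V c (x + y) = smult V c x + smult V c y" "smult V c 0 = 0"
proof -
  interpret vector_space "smult V" using assms by (simp add: vec_space_def)
  have S: "subspace (carrier V)" using assms by (simp add: vec_space_def)
  show "0 \<in> carrier V" "x \<in> carrier V \<Longrightarrow> y \<in> carrier V \<Longrightarrow> x + y \<in> carrier V"
    "x \<in> carrier V \<Longrightarrow> smult V c x \<in> carrier V"
    "x \<in> carrier V \<Longrightarrow> y \<in> carrier V \<Longrightarrow> x - y \<in> carrier V"
    using S by (auto intro: subspace_0 subspace_add subspace_scale subspace_diff)
  show "smult V c (x + y) = smult V c x + smult V c y" "smult V c 0 = 0"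
    by (auto simp: scale_right_distrib)
qed

lemma linear_onI:
  assumes "\<And>x. x \<in> carrier V \<Longrightarrow> f x \<in> carrier W"
    "\<And>x y. x \<in> carrier V \<Longrightarrow> y \<in> carrier V \<Longrightarrow> f (x + y) = f x + f y"
    "\<And>c x. x \<in> carrier V \<Longrightarrow> f (smult V c x) = smult W c (f x)"
  shows "linear_on V W f"
  using assms by (auto simp: linear_on_def)

lemma linear_onD:
  assumes "linear_on V W f"
  shows "x \<in> carrier V \<Longrightarrow> f x \<in> carrier W"
    "x \<in> carrier V \<Longrightarrow> y \<in> carrier V \<Longrightarrow> f (x + y) = f x + f y"
    "x \<in> carrier V \<Longrightarrow> f (smult V c x) = smult W c (f x)"
  using assms by (auto simp: linear_on_def)

lemma linear_on_zero:
  assumes "linear_on V W f" "vec_space V" shows "f 0 = 0"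
  using linear_onD(2)[OF assms(1), of 0 0] vec_spaceD(1)[OF assms(2)] by simp

lemma linear_on_diff:
  assumes f: "linear_on V W f" and V: "vec_space V" and xy: "x \<in> carrier V" "y \<in> carrier V"
  shows "f (x - y) = f x - f y"
  using linear_onD(2)[OF f, of "x - y" y] vec_spaceD(4)[OF V] xy by simp

lemma linear_on_compose: "linear_on U V g \<Longrightarrow> linear_on V W f \<Longrightarrow> linear_on U W (\<lambda>x. f (g x))"
  by (auto simp: linear_on_def)

lemma linear_on_sum_list:
  assumes f: "linear_on U V f" and U: "vec_space U"
    and "set zs \<subseteq> carrier U"
  shows "sum_list zs \<in> carrier U \<and> f (sum_list zs) = sum_list (map f zs)"
  using assms(3)
  by (induction zs) (auto simp: linear_on_zero[OF f U] linear_onD(2)[OF f] vec_spaceD[OF U])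

lemma sum_list_closed:
  assumes "vec_space U" "set zs \<subseteq> carrier U" shows "sum_list zs \<in> carrier U"
  using assms(2) by (induction zs) (auto simp: vec_spaceD[OF assms(1)])

lemma separating_functional:
  fixes U :: "('k::field, 'u::ab_group_add, 'm) vec_scheme"
  assumes U: "vec_space U" and d: "d \<noteq> 0"
  obtains \<phi> where "linear_on U scalars \<phi>" "\<phi> d \<noteq> (0::'k)"
proof -
  have "vector_space_pair (smult U) ((*) :: 'k \<Rightarrow> 'k \<Rightarrow> 'k)"
    using U vec_space_scalars[where 'k = 'k] by (simp add: vector_space_pair_def vec_space_def scalars_def)
  then interpret vector_space_pair "smult U" "(*) :: 'k \<Rightarrow> 'k \<Rightarrow> 'k" .
  have "vs1.independent {d}"
    using d by (simp add: vs1.dependent_single)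
  from linear_independent_extend[OF this, of "\<lambda>_. 1"] obtain g
    where g: "Vector_Spaces.linear (smult U) (*) g" "g d = 1" by auto
  interpret g: Vector_Spaces.linear "smult U" "(*)" g by (fact g)
  have "linear_on U scalars g"
    by (auto simp: linear_on_def scalars_def g.add g.scale)
  with g(2) show ?thesis using that by simp
qed

lemma tens_add_left:
  assumes "x \<in> carrier V" "x' \<in> carrier V" "y \<in> carrier W"
  shows "tens V W (x + x') y = tens V W x y + tens V W x' y"
  using assms by (auto simp: tens_def fun_eq_iff bilinear_on_def linear_on_def scalars_def)

lemma tens_add_right:
  assumes "x \<in> carrier V" "y \<in> carrier W" "y' \<in> carrier W"
  shows "tens V W x (y + y') = tens V W x y + tens V W x y'"
  using assms by (auto simp: tens_def fun_eq_iff bilinear_on_def linear_on_def scalars_def)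

lemma tens_smult:
  assumes "x \<in> carrier V" "y \<in> carrier W"
  shows "tens V W (smult V c x) y = tsmult c (tens V W x y)"
    "tens V W x (smult W c y) = tsmult c (tens V W x y)"
  using assms
  by (auto simp: tens_def fun_eq_iff bilinear_on_def linear_on_def scalars_def tsmult_def)

lemma tens_carrier:
  fixes V :: "('k::field, 'v::ab_group_add, 'm) vec_scheme"
    and W :: "('k, 'w::ab_group_add, 'n) vec_scheme"
  assumes "x \<in> carrier V" "y \<in> carrier W" shows "tens V W x y \<in> carrier (tensor V W)"
proof -
  interpret vector_space "tsmult :: 'k \<Rightarrow> ('k, 'v, 'w) tensor \<Rightarrow> _" by (rule vector_space_tsmult)
  show ?thesis using assms by (auto simp: tensor_def intro!: span_base)
qed

lemma smult_tensor: "smult (tensor V W) = tsmult"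
  by (simp add: tensor_def)

lemma bilinear_tens: "bilinear_on V W (tensor V W) (tens V W)"
  by (auto simp: bilinear_on_def linear_on_def smult_tensor tens_carrier tens_add_left
      tens_add_right tens_smult)

lemma tensor_rep:
  fixes V :: "('k::field, 'v::ab_group_add, 'm) vec_scheme"
    and W :: "('k, 'w::ab_group_add, 'n) vec_scheme"
  assumes V: "vec_space V" and t: "t \<in> carrier (tensor V W)"
  shows "\<exists>ps. set ps \<subseteq> carrier V \<times> carrier W \<and> t = (\<Sum>(x, y)\<leftarrow>ps. tens V W x y)"
proof -
  interpret vector_space "tsmult :: 'k \<Rightarrow> ('k, 'v, 'w) tensor \<Rightarrow> _" by (rule vector_space_tsmult)
  have "t \<in> span {tens V W x y |x y. x \<in> carrier V \<and> y \<in> carrier W}"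
    using t by (simp add: tensor_def)
  then show ?thesis
  proof (induction rule: span_induct_alt)
    case base
    show ?case by (rule exI[of _ "[]"]) simp
  next
    case (step c z s)
    obtain ps where ps: "set ps \<subseteq> carrier V \<times> carrier W" "s = (\<Sum>(x, y)\<leftarrow>ps. tens V W x y)"
      using step by blast
    obtain x y where xy: "z = tens V W x y" "x \<in> carrier V" "y \<in> carrier W"
      using step by blast
    show ?case
      by (rule exI[of _ "(smult V c x, y) # ps"])
        (use ps xy vec_spaceD(3)[OF V] in \<open>auto simp: tens_smult\<close>)
  qed
qed

lemma tens_sum_apply:
  assumes "bilinear_on V W scalars \<beta>"
  shows "(\<Sum>(x, y)\<leftarrow>ps. tens V W x y) \<beta> = (\<Sum>(x, y)\<leftarrow>ps. \<beta> x y)"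
  using assms by (induction ps) (auto simp: tens_def)

lemma tens_sum_eqD:
  assumes U: "vec_space U" and f: "bilinear_on V W U f"
    and ps: "set ps \<subseteq> carrier V \<times> carrier W" and qs: "set qs \<subseteq> carrier V \<times> carrier W"
    and eq: "(\<Sum>(x, y)\<leftarrow>ps. tens V W x y) = (\<Sum>(x, y)\<leftarrow>qs. tens V W x y)"
  shows "(\<Sum>(x, y)\<leftarrow>ps. f x y) = (\<Sum>(x, y)\<leftarrow>qs. f x y)"
proof (rule ccontr)
  assume "\<not> ?thesis"
  then have "(\<Sum>(x, y)\<leftarrow>ps. f x y) - (\<Sum>(x, y)\<leftarrow>qs. f x y) \<noteq> 0" (is "?p - ?q \<noteq> 0") by simp
  from separating_functional[OF U this] obtain \<phi>
    where \<phi>: "linear_on U scalars \<phi>" "\<phi> (?p - ?q) \<noteq> 0" .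
  have b: "bilinear_on V W scalars (\<lambda>x y. \<phi> (f x y))"
  proof -
    have "linear_on W scalars (\<lambda>y. \<phi> (f x y))" if "x \<in> carrier V" for x
      by (rule linear_on_compose[OF _ \<phi>(1)]) (use f that in \<open>auto simp: bilinear_on_def\<close>)
    moreover have "linear_on V scalars (\<lambda>x. \<phi> (f x y))" if "y \<in> carrier W" for y
      by (rule linear_on_compose[OF _ \<phi>(1)]) (use f that in \<open>auto simp: bilinear_on_def\<close>)
    ultimately show ?thesis by (simp add: bilinear_on_def)
  qed
  have f_in: "f x y \<in> carrier U" if "x \<in> carrier V" "y \<in> carrier W" for x y
    using f that by (auto simp: bilinear_on_def linear_on_def)
  have sum: "(\<Sum>(x, y)\<leftarrow>zs. f x y) \<in> carrier U \<and>
      \<phi> (\<Sum>(x, y)\<leftarrow>zs. f x y) = (\<Sum>(x, y)\<leftarrow>zs. \<phi> (f x y))"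
    if "set zs \<subseteq> carrier V \<times> carrier W" for zs
  proof -
    have "set (map (\<lambda>(x, y). f x y) zs) \<subseteq> carrier U" using that f_in by auto
    from linear_on_sum_list[OF \<phi>(1) U this] show ?thesis
      by (simp add: case_prod_unfold o_def)
  qed
  have "\<phi> ?p = \<phi> ?q"
    using sum[OF ps] sum[OF qs] tens_sum_apply[OF b, of ps] tens_sum_apply[OF b, of qs] eq by simp
  then show False
    using \<phi>(2) linear_on_diff[OF \<phi>(1) U] sum[OF ps] sum[OF qs] by simp
qed

lemma tsum_sum_list:
  assumes V: "vec_space V" and U: "vec_space U" and f: "bilinear_on V W U f"
    and ps: "set ps \<subseteq> carrier V \<times> carrier W"
  shows "tsum V W f (\<Sum>(x, y)\<leftarrow>ps. tens V W x y) = (\<Sum>(x, y)\<leftarrow>ps. f x y)"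
proof -
  let ?P = "\<lambda>qs. set qs \<subseteq> carrier V \<times> carrier W \<and>
    (\<Sum>(x, y)\<leftarrow>ps. tens V W x y) = (\<Sum>(x, y)\<leftarrow>qs. tens V W x y)"
  have "?P (SOME qs. ?P qs)" by (rule someI[of ?P ps]) (use ps in simp)
  then show ?thesis
    unfolding tsum_def by (intro tens_sum_eqD[OF U f]) (use ps in auto)
qed

lemma tsum_tens:
  assumes "vec_space V" "vec_space U" "bilinear_on V W U f" "x \<in> carrier V" "y \<in> carrier W"
  shows "tsum V W f (tens V W x y) = f x y"
  using tsum_sum_list[OF assms(1-3), of "[(x, y)]"] assms(4-5) by simp

lemma tsum_rep:
  assumes "vec_space V" "t \<in> carrier (tensor V W)"
  obtains ps where "set ps \<subseteq> carrier V \<times> carrier W" "t = (\<Sum>(x, y)\<leftarrow>ps. tens V W x y)"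
    "\<And>f :: _ \<Rightarrow> _ \<Rightarrow> 'u::ab_group_add. tsum V W f t = (\<Sum>(x, y)\<leftarrow>ps. f x y)"
proof -
  let ?P = "\<lambda>ps. set ps \<subseteq> carrier V \<times> carrier W \<and> t = (\<Sum>(x, y)\<leftarrow>ps. tens V W x y)"
  have "?P (SOME ps. ?P ps)" using tensor_rep[OF assms] by (rule someI_ex)
  then show ?thesis using that[of "SOME ps. ?P ps"] by (simp add: tsum_def)
qed

lemma linear_tsum:
  assumes V: "vec_space V" and U: "vec_space U" and f: "bilinear_on V W U f"
  shows "linear_on (tensor V W) U (tsum V W f)"
proof (rule linear_onI)
  fix s t assume "s \<in> carrier (tensor V W)" "t \<in> carrier (tensor V W)"
  then obtain ps qs where ps: "set ps \<subseteq> carrier V \<times> carrier W" "s = (\<Sum>(x, y)\<leftarrow>ps. tens V W x y)"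
    and qs: "set qs \<subseteq> carrier V \<times> carrier W" "t = (\<Sum>(x, y)\<leftarrow>qs. tens V W x y)"
    using tensor_rep[OF V, of s] tensor_rep[OF V, of t] by blast
  show "tsum V W f (s + t) = tsum V W f s + tsum V W f t"
    using tsum_sum_list[OF V U f, of "ps @ qs"] tsum_sum_list[OF V U f ps(1)]
      tsum_sum_list[OF V U f qs(1)] ps qs by simp
next
  fix t assume "t \<in> carrier (tensor V W)"
  then obtain ps where ps: "set ps \<subseteq> carrier V \<times> carrier W" "t = (\<Sum>(x, y)\<leftarrow>ps. tens V W x y)"
    using tensor_rep[OF V, of t] by blast
  have f_in: "f x y \<in> carrier U" if "x \<in> carrier V" "y \<in> carrier W" for x y
    using f that by (auto simp: bilinear_on_def linear_on_def)
  show "tsum V W f t \<in> carrier U"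
    unfolding ps(2) tsum_sum_list[OF V U f ps(1)]
    by (rule sum_list_closed[OF U]) (use ps(1) f_in in auto)
  fix c
  let ?cs = "map (\<lambda>(x, y). (smult V c x, y)) ps"
  have cs: "set ?cs \<subseteq> carrier V \<times> carrier W" using ps(1) vec_spaceD(3)[OF V] by auto
  have 1: "tsmult c t = (\<Sum>(x, y)\<leftarrow>?cs. tens V W x y)"
    unfolding ps(2) using ps(1)
  proof (induction ps)
    case Nil
    show ?case by (simp add: tsmult_def fun_eq_iff)
  next
    case (Cons p ps)
    then have IH: "tsmult c (\<Sum>(x, y)\<leftarrow>ps. tens V W x y) =
        (\<Sum>(x, y)\<leftarrow>map (\<lambda>(x, y). (smult V c x, y)) ps. tens V W x y)" by simp
    obtain x y where p: "p = (x, y)" "x \<in> carrier V" "y \<in> carrier W"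
      using Cons.prems by auto
    show ?case
      using vec_spaceD(5)[OF vec_space_tensor[of V W], of c "tens V W x y"]
      by (simp only: smult_tensor tens_smult(1)[OF p(2,3)] p(1) IH list.map sum_list.Cons
          prod.case)
  qed
  have 2: "(\<Sum>(x, y)\<leftarrow>?cs. f x y) = smult U c (\<Sum>(x, y)\<leftarrow>ps. f x y)"
    using ps(1)
  proof (induction ps)
    case Nil
    show ?case by (simp add: vec_spaceD[OF U])
  next
    case (Cons p ps)
    then show ?case using f
      by (auto simp: vec_spaceD[OF U] bilinear_on_def linear_on_def)
  qed
  show "tsum V W f (smult (tensor V W) c t) = smult U c (tsum V W f t)"
    unfolding smult_tensor 1 tsum_sum_list[OF V U f cs] 2
    unfolding ps(2) tsum_sum_list[OF V U f ps(1)] ..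
qed

lemma tensor_universal:
  assumes V: "vec_space V" and U: "vec_space U" and f: "bilinear_on V W U f"
  shows "\<exists>g. linear_on (tensor V W) U g \<and>
      (\<forall>x\<in>carrier V. \<forall>y\<in>carrier W. g (tens V W x y) = f x y) \<and>
      (\<forall>h. linear_on (tensor V W) U h \<and>
        (\<forall>x\<in>carrier V. \<forall>y\<in>carrier W. h (tens V W x y) = f x y) \<longrightarrow>
        (\<forall>t\<in>carrier (tensor V W). h t = g t))"
proof (intro exI[of _ "tsum V W f"] conjI allI impI ballI)
  show "linear_on (tensor V W) U (tsum V W f)" by (rule linear_tsum[OF assms])
next
  fix x y assume "x \<in> carrier V" "y \<in> carrier W"
  then show "tsum V W f (tens V W x y) = f x y" by (rule tsum_tens[OF assms])
next
  fix h t
  assume h: "linear_on (tensor V W) U h \<and>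
        (\<forall>x\<in>carrier V. \<forall>y\<in>carrier W. h (tens V W x y) = f x y)"
    and t: "t \<in> carrier (tensor V W)"
  obtain ps where ps: "set ps \<subseteq> carrier V \<times> carrier W" "t = (\<Sum>(x, y)\<leftarrow>ps. tens V W x y)"
    using tensor_rep[OF V t] by blast
  have "set (map (\<lambda>(x, y). tens V W x y) ps) \<subseteq> carrier (tensor V W)"
    using ps(1) by (auto intro: tens_carrier)
  from linear_on_sum_list[OF conjunct1[OF h] vec_space_tensor this]
  have "h t = (\<Sum>p\<leftarrow>ps. h (case p of (x, y) \<Rightarrow> tens V W x y))"
    by (simp add: ps(2) o_def)
  also have "\<dots> = (\<Sum>(x, y)\<leftarrow>ps. f x y)"
    by (rule arg_cong[of _ _ sum_list], rule map_cong) (use h ps(1) in auto)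
  also have "\<dots> = tsum V W f t"
    unfolding ps(2) by (rule tsum_sum_list[OF assms ps(1), symmetric])
  finally show "h t = tsum V W f t" .
qed

lemma linear_tsum_param:
  fixes U :: "('k::field, 'u::ab_group_add, 'o) vec_scheme"
  assumes V: "vec_space V" and U: "vec_space U" and t: "t \<in> carrier (tensor V W)"
    and F: "\<And>x y. x \<in> carrier V \<Longrightarrow> y \<in> carrier W \<Longrightarrow> linear_on P U (\<lambda>p. F p x y)"
  shows "linear_on P U (\<lambda>p. tsum V W (F p) t)"
proof -
  obtain ps where ps: "set ps \<subseteq> carrier V \<times> carrier W"
    "\<And>f :: _ \<Rightarrow> _ \<Rightarrow> 'u. tsum V W f t = (\<Sum>(x, y)\<leftarrow>ps. f x y)"
    using tsum_rep[OF V t] by metis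
  have "linear_on P U (\<lambda>p. \<Sum>(x, y)\<leftarrow>ps. F p x y)" using ps(1)
  proof (induction ps)
    case Nil
    show ?case by (auto simp: linear_on_def vec_spaceD[OF U])
  next
    case (Cons q ps)
    then have "linear_on P U (\<lambda>p. F p (fst q) (snd q))"
      "linear_on P U (\<lambda>p. \<Sum>(x, y)\<leftarrow>ps. F p x y)" using F by auto
    then show ?case
      by (auto simp: linear_on_def vec_spaceD[OF U] case_prod_unfold algebra_simps)
  qed
  then show ?thesis by (simp add: ps(2))
qed

lemma linear_sw_param:
  assumes "coalgebra C" "vec_space U" "x \<in> carrier C"
    and "\<And>x' x''. x' \<in> carrier C \<Longrightarrow> x'' \<in> carrier C \<Longrightarrow> linear_on P U (\<lambda>p. F p x' x'')"
  shows "linear_on P U (\<lambda>p. sw C (F p) x)"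
  unfolding sw_def
  by (rule linear_tsum_param[OF _ assms(2)]) (use assms in \<open>auto simp: coalgebra_def linear_on_def\<close>)

lemma linear_sw:
  assumes "coalgebra C" "vec_space U" "bilinear_on C C U f"
  shows "linear_on C U (sw C f)"
  unfolding sw_def
  by (rule linear_on_compose[OF _ linear_tsum[OF _ assms(2,3)]])
    (use assms(1) in \<open>auto simp: coalgebra_def\<close>)

lemma bilinear_left: "bilinear_on V W U f \<Longrightarrow> y \<in> carrier W \<Longrightarrow> linear_on P V g \<Longrightarrow>
    linear_on P U (\<lambda>p. f (g p) y)"
  by (rule linear_on_compose[of _ V]) (auto simp: bilinear_on_def)

lemma bilinear_right: "bilinear_on V W U f \<Longrightarrow> x \<in> carrier V \<Longrightarrow> linear_on P W g \<Longrightarrow>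
    linear_on P U (\<lambda>p. f x (g p))"
  by (rule linear_on_compose[of _ W]) (auto simp: bilinear_on_def)

lemma bilinear_carrier: "bilinear_on V W U f \<Longrightarrow> x \<in> carrier V \<Longrightarrow> y \<in> carrier W \<Longrightarrow>
    f x y \<in> carrier U"
  by (auto simp: bilinear_on_def linear_on_def)

lemma bilinear_onI:
  assumes "\<And>x. x \<in> carrier V \<Longrightarrow> linear_on W U (\<lambda>y. f x y)"
    "\<And>y. y \<in> carrier W \<Longrightarrow> linear_on V U (\<lambda>x. f x y)"
  shows "bilinear_on V W U f"
  using assms by (auto simp: bilinear_on_def)

lemma linear_on_id: "linear_on V V (\<lambda>x. x)"
  by (simp add: linear_on_def)

text \<open>The defining formulas of the quasi-bicrossed product on elementary tensors.\<close>

lemma quasi_bicrossed_product_tens: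
  fixes X :: "('k::field, 'x::ab_group_add, 'm) bialg_scheme"
    and A :: "('k, 'a::ab_group_add, 'n) bialg_scheme"
  assumes Q: "quasi_matched_pair X A l r"
    and x: "x \<in> carrier X" and y: "y \<in> carrier X" and a: "a \<in> carrier A" and b: "b \<in> carrier A"
  shows "mult (quasi_bicrossed_product X A l r) (tens X A x a) (tens X A y b) =
      sw A (\<lambda>a' a''. sw X (\<lambda>y' y''.
        tens X A (mult X x (l a' y')) (mult A (r a'' y'') b)) y) a" (is ?mult)
    and "comult (quasi_bicrossed_product X A l r) (tens X A x a) =
      sw A (\<lambda>a' a''. sw X (\<lambda>x' x''.
        tens (tensor X A) (tensor X A) (tens X A x' a') (tens X A x'' a'')) x) a" (is ?comult)
    and "counit (quasi_bicrossed_product X A l r) (tens X A x a) = counit X x * counit A a"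
      (is ?counit)
proof -
  have bX: "bialgebra X" and bA: "bialgebra A" using Q by (auto simp: quasi_matched_pair_def)
  have cX: "coalgebra X" and cA: "coalgebra A"
    using bX bA by (auto simp: bialgebra_def almost_bialgebra_def)
  have vX: "vec_space X" and vA: "vec_space A" using cX cA by (auto simp: coalgebra_def)
  have mX: "bilinear_on X X X (mult X)" and mA: "bilinear_on A A A (mult A)"
    using bX bA by (auto simp: bialgebra_def almost_bialgebra_def unital_algebra_def)
  have l: "bilinear_on A X X l" and r: "bilinear_on A X A r"
    using Q by (auto simp: quasi_matched_pair_def left_quasi_module_coalgebra_def left_module_def
        right_quasi_module_coalgebra_def right_module_def)
  note T = bilinear_tens
  note lins = bilinear_onI linear_sw[OF cX vec_space_tensor] linear_sw[OF cA vec_space_tensor]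
    linear_sw_param[OF cX vec_space_tensor] linear_sw_param[OF cA vec_space_tensor]
    linear_on_id bilinear_left[OF T] bilinear_right[OF T] bilinear_left[OF mX] bilinear_right[OF mX]
    bilinear_left[OF mA] bilinear_right[OF mA] bilinear_left[OF l] bilinear_right[OF l]
    bilinear_left[OF r] bilinear_right[OF r]
    bilinear_carrier[OF T] bilinear_carrier[OF mX] bilinear_carrier[OF mA]
    bilinear_carrier[OF l] bilinear_carrier[OF r]
  let ?M = "\<lambda>x a y b. sw A (\<lambda>a' a''. sw X (\<lambda>y' y''.
        tens X A (mult X x (l a' y')) (mult A (r a'' y'') b)) y) a"
  have 1: "bilinear_on X A (tensor X A) (?M x a)" if "x \<in> carrier X" "a \<in> carrier A" for x a
    by (intro lins that) (assumption | intro lins that)+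
  have 2: "bilinear_on X A (tensor X A) (\<lambda>x a. tsum X A (?M x a) t)"
    if "t \<in> carrier (tensor X A)" for t
    by (rule bilinear_onI; rule linear_tsum_param[OF vX vec_space_tensor that])
      (assumption | intro lins)+
  show ?mult
    by (simp add: quasi_bicrossed_product_def tsum_tens[OF vX vec_space_tensor 2] tens_carrier
        tsum_tens[OF vX vec_space_tensor 1] x y a b)
  have 3: "bilinear_on X A (tensor (tensor X A) (tensor X A)) (\<lambda>x a.
      sw A (\<lambda>a' a''. sw X (\<lambda>x' x''.
        tens (tensor X A) (tensor X A) (tens X A x' a') (tens X A x'' a'')) x) a)"
    by (assumption | intro lins)+
  show ?comult
    by (simp add: quasi_bicrossed_product_def tsum_tens[OF vX vec_space_tensor 3] x a)
  have 4: "bilinear_on X A scalars (\<lambda>x a. counit X x * counit A a)"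
    using cX cA by (auto simp: coalgebra_def bilinear_on_def linear_on_def scalars_def algebra_simps)
  show ?counit
    by (simp add: quasi_bicrossed_product_def tsum_tens[OF vX vec_space_scalars 4] x a)
qed

end

theory Submission
  imports Defs
begin

text \<open>
  The pairing turns the two actions into one-variable computations in \<open>A\<close>. With \<open>S = S\<^sub>A\<^sup>-\<^sup>1\<close>, the
  action \<open>a \<rhd> _\<close> is the transpose of \<open>b \<mapsto> ad b a = \<Sum>S(a'') b a'\<close>, and
  \<open>a \<lhd> x = \<Sum>\<langle>x, S(a''')a'\<rangle> a''\<close>. Testing an identity against elements of \<open>A\<close> merges all
  Sweedler components of \<open>x\<close> into a single product in \<open>A\<close> by \<open>\<langle>x'', a\<rangle>\<langle>x', b\<rangle> = \<langle>x, ab\<rangle>\<close>; this is enough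
  because a nondegenerate pairing also separates tensors. What remains is to remove a factor
  \<open>\<kappa>(r) = \<Sum>r''S(r')\<close> between the other factors. It is central, since \<open>S\<^sub>A(\<kappa>(r)) = \<Sum>r'S\<^sub>A(r'')\<close>; it
  satisfies \<open>\<Sum>\<kappa>(a'')a' = a\<close>, which is \<open>S\<^sub>A * id * S\<^sub>A = S\<^sub>A\<close>; and \<open>\<Sum>a' \<otimes> \<kappa>(a'') = \<Sum>a'' \<otimes> \<kappa>(a')\<close>,
  which is centrality of \<open>\<Sum>S\<^sub>X(x')x''\<close> in \<open>X\<close>.

  For the quasi-bicrossed product, all matched pair axioms are identities between Sweedler sums of
  the tensor product coalgebra \<open>A \<otimes> X\<close>, so only coassociativity of these joint sums is needed.
\<close>

section \<open>Sweedler sums\<close>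

text \<open>In a Hopf algebra, products \<open>v \<cdot> Sb u\<close> of consecutive Sweedler
  components collapse to counits, and the classical proof for the double consists of such
  cancellations. Here such a product only becomes \<open>\<kappa> r\<close>, which has to be brought
  next to a component able to swallow it. If that component is adjacent in the Sweedler order,
  centrality and absorption suffice (\<open>mult_ad\<close>). If another component lies between, as
  in the comultiplication of \<open>\<lhd>\<close> and in the exchange condition, the components
  must also be permuted; there centrality in \<open>X\<close> enters. No cocommutativity is
  available, so the order of components matters throughout. The skew rule and the inverse antipode
  reverse orders in such a way that components pair up in nested fashion, first with last; nested
  pairs can be split off from outside by coassociativity. The counit conditions fail for the same
  reason: pairing \<open>a \<rhd> x\<close> with the unit gives \<open>B x (ad b a)\<close> with
  \<open>b\<close> the unit, and this \<open>ad b a\<close>, a sum of products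
  \<open>Sb v \<cdot> u\<close>, need not be a multiple of the unit. Hence only an almost bialgebra
  results.\<close>

named_theorems lin \<open>linearity and carrier membership of compound expressions\<close>

text \<open>Linearity goals are settled by repeated \<open>assumption\<close> or
  \<open>rule lin\<close>. The rules therefore treat maps \<open>\<lambda>p. ...\<close> from an
  arbitrary space \<open>P\<close> and peel off the outermost operation, down to
  \<open>linear_on_id\<close> and carrier membership.\<close>

lemmas [lin] = bilinear_onI linear_on_id vec_space_tensor vec_space_scalars bilinear_tens
  tens_carrier

text \<open>The list chosen inside \<open>tsum\<close>, made explicit because it does not depend on
  the map \<open>f\<close>: sums of different maps over one tensor run over one and the same
  list.\<close>

definition tensor_terms ::
  "('k::field, 'v::ab_group_add, 'm) vec_scheme \<Rightarrow> ('k, 'w::ab_group_add, 'n) vec_scheme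
    \<Rightarrow> ('k, 'v, 'w) tensor \<Rightarrow> ('v \<times> 'w) list" where
  "tensor_terms V W t =
     (SOME ps. set ps \<subseteq> carrier V \<times> carrier W \<and> t = (\<Sum>(x, y)\<leftarrow>ps. tens V W x y))"

lemma tsum_terms: "tsum V W f t = (\<Sum>(x, y)\<leftarrow>tensor_terms V W t. f x y)"
  by (simp add: tsum_def tensor_terms_def)

lemma tensor_terms_carrier:
  assumes "vec_space V" "t \<in> carrier (tensor V W)"
  shows "set (tensor_terms V W t) \<subseteq> carrier V \<times> carrier W"
proof -
  let ?P = "\<lambda>ps. set ps \<subseteq> carrier V \<times> carrier W \<and> t = (\<Sum>(x, y)\<leftarrow>ps. tens V W x y)"
  have "?P (SOME ps. ?P ps)" by (rule someI_ex[OF tensor_rep[OF assms]])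
  then show ?thesis by (simp add: tensor_terms_def)
qed

lemma tsum_cong:
  assumes "vec_space V" "t \<in> carrier (tensor V W)"
    and "\<And>u v. u \<in> carrier V \<Longrightarrow> v \<in> carrier W \<Longrightarrow> f u v = g u v"
  shows "tsum V W f t = tsum V W g t"
  unfolding tsum_terms
  by (rule arg_cong[of _ _ sum_list], rule map_cong)
    (use tensor_terms_carrier[OF assms(1,2)] assms(3) in auto)

lemma linear_on_tsum:
  assumes g: "linear_on U W g" and U: "vec_space U" and P: "vec_space P"
    and t: "t \<in> carrier (tensor P R)"
    and f: "\<And>u v. u \<in> carrier P \<Longrightarrow> v \<in> carrier R \<Longrightarrow> f u v \<in> carrier U"
  shows "g (tsum P R f t) = tsum P R (\<lambda>u v. g (f u v)) t"
proof -
  have "set (map (\<lambda>(u, v). f u v) (tensor_terms P R t)) \<subseteq> carrier U"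
    using tensor_terms_carrier[OF P t] f by auto
  from linear_on_sum_list[OF g U this] show ?thesis
    by (simp add: tsum_terms case_prod_unfold o_def)
qed

lemma coalgebraD:
  assumes "coalgebra C"
  shows "vec_space C" "linear_on C (tensor C C) (comult C)" "linear_on C scalars (counit C)"
    "x \<in> carrier C \<Longrightarrow> comult C x \<in> carrier (tensor C C)"
  using assms by (auto simp: coalgebra_def linear_on_def)

lemma sw_cong:
  assumes "coalgebra C" "x \<in> carrier C"
    and "\<And>u v. u \<in> carrier C \<Longrightarrow> v \<in> carrier C \<Longrightarrow> f u v = g u v"
  shows "sw C f x = sw C g x"
  unfolding sw_def by (rule tsum_cong) (use assms coalgebraD in auto)

lemma sum_list_swap:
  "(\<Sum>x\<leftarrow>xs. \<Sum>y\<leftarrow>ys. f x y) = (\<Sum>y\<leftarrow>ys. \<Sum>x\<leftarrow>xs. f x y :: 'u::ab_group_add)"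
  by (induction xs) (simp_all add: sum_list_addf)

text \<open>Both sides are double sums over two fixed lists of terms, one determined by
  \<open>x\<close> and one by \<open>a\<close>, so this is an exchange of finite sums.\<close>

lemma sw_swap:
  "sw C (\<lambda>u v. sw D (\<lambda>p q. F u v p q) a) x = sw D (\<lambda>p q. sw C (\<lambda>u v. F u v p q) x) a"
  unfolding sw_def tsum_terms case_prod_unfold by (rule sum_list_swap)

lemma sw_closed [lin]:
  assumes "coalgebra C" "vec_space U" "x \<in> carrier C"
    and "\<And>u v. u \<in> carrier C \<Longrightarrow> v \<in> carrier C \<Longrightarrow> f u v \<in> carrier U"
  shows "sw C f x \<in> carrier U"
  unfolding sw_def tsum_terms
  by (rule sum_list_closed[OF assms(2)])
    (use tensor_terms_carrier[of C] coalgebraD[OF assms(1)] assms(3,4) in fastforce)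

lemma linear_on_sw:
  assumes g: "linear_on U W g" and "coalgebra C" "vec_space U" "x \<in> carrier C"
    and f: "\<And>u v. u \<in> carrier C \<Longrightarrow> v \<in> carrier C \<Longrightarrow> f u v \<in> carrier U"
  shows "g (sw C f x) = sw C (\<lambda>u v. g (f u v)) x"
  unfolding sw_def by (rule linear_on_tsum[OF g]) (use assms coalgebraD in auto)

lemma tsum_tens_self:
  assumes V: "vec_space V" and t: "t \<in> carrier (tensor V W)"
  shows "tsum V W (tens V W) t = t"
proof -
  obtain ps where "set ps \<subseteq> carrier V \<times> carrier W" "t = (\<Sum>(x, y)\<leftarrow>ps. tens V W x y)"
    using tensor_rep[OF V t] by blast
  then show ?thesis using tsum_sum_list[OF V vec_space_tensor bilinear_tens] by metis
qed

lemma tensor_linear_ext: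
  assumes V: "vec_space V" and g: "linear_on (tensor V W) U g" and h: "linear_on (tensor V W) U h"
    and gh: "\<And>u v. u \<in> carrier V \<Longrightarrow> v \<in> carrier W \<Longrightarrow> g (tens V W u v) = h (tens V W u v)"
    and t: "t \<in> carrier (tensor V W)"
  shows "g t = h t"
proof -
  have "g t = tsum V W (\<lambda>u v. g (tens V W u v)) t"
    using linear_on_tsum[OF g vec_space_tensor V t, of "tens V W"] tsum_tens_self[OF V t]
    by (simp add: tens_carrier)
  also have "\<dots> = tsum V W (\<lambda>u v. h (tens V W u v)) t"
    by (rule tsum_cong[OF V t gh])
  also have "\<dots> = h t"
    using linear_on_tsum[OF h vec_space_tensor V t, of "tens V W"] tsum_tens_self[OF V t]
    by (simp add: tens_carrier)
  finally show ?thesis .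
qed

lemma tsum_sw_tens:
  assumes V: "vec_space V" and U: "vec_space U" and f: "bilinear_on V W U f"
    and D: "coalgebra D" and a: "a \<in> carrier D"
    and g: "\<And>u v. u \<in> carrier D \<Longrightarrow> v \<in> carrier D \<Longrightarrow> g u v \<in> carrier V"
    and h: "\<And>u v. u \<in> carrier D \<Longrightarrow> v \<in> carrier D \<Longrightarrow> h u v \<in> carrier W"
  shows "tsum V W f (sw D (\<lambda>u v. tens V W (g u v) (h u v)) a) = sw D (\<lambda>u v. f (g u v) (h u v)) a"
  by (simp add: linear_on_sw[OF linear_tsum[OF V U f] D vec_space_tensor a] tens_carrier g h
      tsum_tens[OF V U f] cong: sw_cong[OF D a])

lemma linear_on_sw_arg [lin]:
  "coalgebra C \<Longrightarrow> vec_space U \<Longrightarrow> bilinear_on C C U f \<Longrightarrow> linear_on P C g \<Longrightarrow>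
    linear_on P U (\<lambda>p. sw C f (g p))"
  by (rule linear_on_compose[OF _ linear_sw])

lemma linear_on_tsum_arg [lin]:
  "vec_space V \<Longrightarrow> vec_space U \<Longrightarrow> bilinear_on V W U f \<Longrightarrow> linear_on P (tensor V W) g \<Longrightarrow>
    linear_on P U (\<lambda>p. tsum V W f (g p))"
  by (rule linear_on_compose[OF _ linear_tsum])

lemma tsum_closed [lin]:
  "vec_space V \<Longrightarrow> vec_space U \<Longrightarrow> bilinear_on V W U f \<Longrightarrow> t \<in> carrier (tensor V W) \<Longrightarrow>
    tsum V W f t \<in> carrier U"
  using linear_tsum[of V U W f] by (auto simp: linear_on_def)

lemmas [lin] = linear_sw_param linear_tsum_param bilinear_left[OF bilinear_tens]
  bilinear_right[OF bilinear_tens]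

text \<open>The axiom in \<open>coalgebra\<close> is an equation in
  \<open>C \<otimes> (C \<otimes> C)\<close>. Two uses of the universal property turn
  \<open>f\<close> into a linear map \<open>?G\<close> on that space, and \<open>?G\<close> is
  applied to both sides.\<close>

lemma sw_coassoc:
  assumes C: "coalgebra C" and U: "vec_space U" and x: "x \<in> carrier C"
    and f1: "\<And>v w. v \<in> carrier C \<Longrightarrow> w \<in> carrier C \<Longrightarrow> linear_on C U (\<lambda>u. f u v w)"
    and f2: "\<And>u w. u \<in> carrier C \<Longrightarrow> w \<in> carrier C \<Longrightarrow> linear_on C U (\<lambda>v. f u v w)"
    and f3: "\<And>u v. u \<in> carrier C \<Longrightarrow> v \<in> carrier C \<Longrightarrow> linear_on C U (\<lambda>w. f u v w)"
  shows "sw C (\<lambda>u z. sw C (\<lambda>x' x''. f x' x'' z) u) x = sw C (\<lambda>y u. sw C (\<lambda>x' x''. f y x' x'') u) x"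
proof -
  note V = coalgebraD(1)[OF C]
  have f23: "bilinear_on C C U (f u)" if "u \<in> carrier C" for u
    by (rule bilinear_onI) (use f2 f3 that in auto)
  let ?g = "\<lambda>y t. tsum C C (f y) t"
  have g: "bilinear_on C (tensor C C) U ?g"
    by (rule bilinear_onI) (rule linear_tsum V U f23 linear_tsum_param f1 | assumption)+
  let ?G = "tsum C (tensor C C) ?g"
  let ?T = "tens C (tensor C C)"
  have G: "linear_on (tensor C (tensor C C)) U ?G" by (rule linear_tsum[OF V U g])
  have GT: "?G (?T u (tens C C v w)) = f u v w"
    if "u \<in> carrier C" "v \<in> carrier C" "w \<in> carrier C" for u v w
    using that by (simp add: tsum_tens[OF V U g] tsum_tens[OF V U f23] tens_carrier)
  have "?G (sw C (\<lambda>u z. sw C (\<lambda>x' x''. ?T x' (tens C C x'' z)) u) x) =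
      sw C (\<lambda>u z. ?G (sw C (\<lambda>x' x''. ?T x' (tens C C x'' z)) u)) x"
    by (rule linear_on_sw[OF G C vec_space_tensor x]) (assumption | rule lin C)+
  also have "\<dots> = sw C (\<lambda>u z. sw C (\<lambda>x' x''. ?G (?T x' (tens C C x'' z))) u) x"
    by (rule sw_cong[OF C x], rule linear_on_sw[OF G C vec_space_tensor]) (assumption | rule lin C)+
  also have "\<dots> = sw C (\<lambda>u z. sw C (\<lambda>x' x''. f x' x'' z) u) x"
    by (rule sw_cong[OF C x], rule sw_cong[OF C], assumption, rule GT)
  finally have 1: "?G (sw C (\<lambda>u z. sw C (\<lambda>x' x''. ?T x' (tens C C x'' z)) u) x) =
      sw C (\<lambda>u z. sw C (\<lambda>x' x''. f x' x'' z) u) x" .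
  have "?G (sw C (\<lambda>y u. sw C (\<lambda>x' x''. ?T y (tens C C x' x'')) u) x) =
      sw C (\<lambda>y u. ?G (sw C (\<lambda>x' x''. ?T y (tens C C x' x'')) u)) x"
    by (rule linear_on_sw[OF G C vec_space_tensor x]) (assumption | rule lin C)+
  also have "\<dots> = sw C (\<lambda>y u. sw C (\<lambda>x' x''. ?G (?T y (tens C C x' x''))) u) x"
    by (rule sw_cong[OF C x], rule linear_on_sw[OF G C vec_space_tensor]) (assumption | rule lin C)+
  also have "\<dots> = sw C (\<lambda>y u. sw C (\<lambda>x' x''. f y x' x'') u) x"
    by (rule sw_cong[OF C x], rule sw_cong[OF C], assumption, rule GT)
  finally show ?thesis
    using 1 C x by (simp add: coalgebra_def)
qed

lemma sw_counit:
  assumes C: "coalgebra C" and U: "vec_space U" and x: "x \<in> carrier C" and f: "linear_on C U f"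
  shows "sw C (\<lambda>u v. smult U (counit C u) (f v)) x = f x"
    and "sw C (\<lambda>u v. smult U (counit C v) (f u)) x = f x"
proof -
  note V = coalgebraD(1)[OF C]
  have "sw C (\<lambda>u v. smult U (counit C u) (f v)) x = sw C (\<lambda>u v. f (smult C (counit C u) v)) x"
    by (rule sw_cong[OF C x]) (use f in \<open>auto simp: linear_on_def\<close>)
  also have "\<dots> = f (sw C (\<lambda>u v. smult C (counit C u) v) x)"
    by (rule linear_on_sw[OF f C V x, symmetric]) (rule vec_spaceD[OF V])
  finally show "sw C (\<lambda>u v. smult U (counit C u) (f v)) x = f x"
    using C x by (simp add: coalgebra_def)
  have "sw C (\<lambda>u v. smult U (counit C v) (f u)) x = sw C (\<lambda>u v. f (smult C (counit C v) u)) x"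
    by (rule sw_cong[OF C x]) (use f in \<open>auto simp: linear_on_def\<close>)
  also have "\<dots> = f (sw C (\<lambda>u v. smult C (counit C v) u) x)"
    by (rule linear_on_sw[OF f C V x, symmetric]) (rule vec_spaceD[OF V])
  finally show "sw C (\<lambda>u v. smult U (counit C v) (f u)) x = f x"
    using C x by (simp add: coalgebra_def)
qed

lemma linear_scaleI [lin]:
  "linear_on P scalars g \<Longrightarrow> linear_on P scalars (\<lambda>p. g p * c)"
  "linear_on P scalars g \<Longrightarrow> linear_on P scalars (\<lambda>p. c * g p)"
  by (auto simp: linear_on_def scalars_def algebra_simps)

lemma linear_smultI [lin]:
  assumes U: "vec_space U"
  shows "linear_on P scalars g \<Longrightarrow> u \<in> carrier U \<Longrightarrow> linear_on P U (\<lambda>p. smult U (g p) u)"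
    "linear_on P U h \<Longrightarrow> linear_on P U (\<lambda>p. smult U c (h p))"
proof -
  interpret vector_space "smult U" using U by (simp add: vec_space_def)
  show "linear_on P scalars g \<Longrightarrow> u \<in> carrier U \<Longrightarrow> linear_on P U (\<lambda>p. smult U (g p) u)"
    "linear_on P U h \<Longrightarrow> linear_on P U (\<lambda>p. smult U c (h p))"
    using vec_spaceD(3)[OF U]
    by (auto simp: linear_on_def scalars_def scale_left_distrib scale_right_distrib mult.commute)
qed

lemma smult_closed [lin]: "vec_space U \<Longrightarrow> u \<in> carrier U \<Longrightarrow> smult U c u \<in> carrier U"
  by (rule vec_spaceD)

lemma scalars_closed [lin]: "c \<in> carrier scalars"
  by (simp add: scalars_def)

definition trilinear_on ::
  "('k::field, 'v::ab_group_add, 'm) vec_scheme \<Rightarrow> ('k, 'u::ab_group_add, 'n) vec_scheme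
    \<Rightarrow> ('v \<Rightarrow> 'v \<Rightarrow> 'v \<Rightarrow> 'u) \<Rightarrow> bool" where
  "trilinear_on V U f \<longleftrightarrow>
     (\<forall>v\<in>carrier V. \<forall>w\<in>carrier V. linear_on V U (\<lambda>u. f u v w)) \<and>
     (\<forall>u\<in>carrier V. \<forall>w\<in>carrier V. linear_on V U (\<lambda>v. f u v w)) \<and>
     (\<forall>u\<in>carrier V. \<forall>v\<in>carrier V. linear_on V U (\<lambda>w. f u v w))"

lemma trilinear_onI [lin]:
  assumes "\<And>v w. v \<in> carrier V \<Longrightarrow> w \<in> carrier V \<Longrightarrow> linear_on V U (\<lambda>u. f u v w)"
    and "\<And>u w. u \<in> carrier V \<Longrightarrow> w \<in> carrier V \<Longrightarrow> linear_on V U (\<lambda>v. f u v w)"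
    and "\<And>u v. u \<in> carrier V \<Longrightarrow> v \<in> carrier V \<Longrightarrow> linear_on V U (\<lambda>w. f u v w)"
  shows "trilinear_on V U f"
  using assms by (auto simp: trilinear_on_def)

lemma trilinear_onD:
  assumes f: "trilinear_on V U f"
  shows "v \<in> carrier V \<Longrightarrow> w \<in> carrier V \<Longrightarrow> linear_on P V g \<Longrightarrow> linear_on P U (\<lambda>p. f (g p) v w)"
    "u \<in> carrier V \<Longrightarrow> w \<in> carrier V \<Longrightarrow> linear_on P V g \<Longrightarrow> linear_on P U (\<lambda>p. f u (g p) w)"
    "u \<in> carrier V \<Longrightarrow> v \<in> carrier V \<Longrightarrow> linear_on P V g \<Longrightarrow> linear_on P U (\<lambda>p. f u v (g p))"
    "u \<in> carrier V \<Longrightarrow> v \<in> carrier V \<Longrightarrow> w \<in> carrier V \<Longrightarrow> f u v w \<in> carrier U"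
  using f by (auto simp: trilinear_on_def linear_on_def)

lemma sw_assoc:
  assumes "coalgebra C" "vec_space U" "x \<in> carrier C" "trilinear_on C U f"
  shows "sw C (\<lambda>u z. sw C (\<lambda>x' x''. f x' x'' z) u) x = sw C (\<lambda>y u. sw C (\<lambda>x' x''. f y x' x'') u) x"
  using sw_coassoc[OF assms(1-3), of f] assms(4) by (auto simp: trilinear_on_def)

lemma bilinearD:
  assumes f: "bilinear_on V W U f"
  shows "y \<in> carrier W \<Longrightarrow> linear_on P V g \<Longrightarrow> linear_on P U (\<lambda>p. f (g p) y)"
    "x \<in> carrier V \<Longrightarrow> linear_on P W h \<Longrightarrow> linear_on P U (\<lambda>p. f x (h p))"
    "x \<in> carrier V \<Longrightarrow> y \<in> carrier W \<Longrightarrow> f x y \<in> carrier U"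
  using bilinear_left[OF f] bilinear_right[OF f] bilinear_carrier[OF f] by auto

lemma bialgebraD:
  assumes "bialgebra H"
  shows "coalgebra H" "vec_space H" "bilinear_on H H H (mult H)" "unit_elt H \<in> carrier H"
    "x \<in> carrier H \<Longrightarrow> y \<in> carrier H \<Longrightarrow> z \<in> carrier H \<Longrightarrow>
      mult H (mult H x y) z = mult H x (mult H y z)"
    "x \<in> carrier H \<Longrightarrow> mult H (unit_elt H) x = x" "x \<in> carrier H \<Longrightarrow> mult H x (unit_elt H) = x"
    "x \<in> carrier H \<Longrightarrow> y \<in> carrier H \<Longrightarrow> counit H (mult H x y) = counit H x * counit H y"
    "counit H (unit_elt H) = 1"
    "x \<in> carrier H \<Longrightarrow> y \<in> carrier H \<Longrightarrow> comult H (mult H x y) =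
        sw H (\<lambda>x' x''. sw H (\<lambda>y' y''. tens H H (mult H x' y') (mult H x'' y'')) y) x"
    "comult H (unit_elt H) = tens H H (unit_elt H) (unit_elt H)"
  using assms by (auto simp: bialgebra_def almost_bialgebra_def unital_algebra_def coalgebra_def)

lemma sw_unit:
  assumes "bialgebra H" "vec_space U" "bilinear_on H H U f"
  shows "sw H f (unit_elt H) = f (unit_elt H) (unit_elt H)"
  unfolding sw_def bialgebraD(11)[OF assms(1)]
  by (rule tsum_tens) (use assms bialgebraD(2,4) in auto)

text \<open>Coproducts of products and of acted-on elements are given as double Sweedler sums of
  elementary tensors; this evaluates a bilinear map on any such expression.\<close>

lemma tsum_sw_sw_tens:
  assumes V: "vec_space V" and U: "vec_space U" and f: "bilinear_on V W U f"
    and D: "coalgebra D" and a: "a \<in> carrier D" and E: "coalgebra E" and x: "x \<in> carrier E"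
    and g: "\<And>u v p q. u \<in> carrier D \<Longrightarrow> v \<in> carrier D \<Longrightarrow> p \<in> carrier E \<Longrightarrow> q \<in> carrier E \<Longrightarrow>
      g u v p q \<in> carrier V"
    and h: "\<And>u v p q. u \<in> carrier D \<Longrightarrow> v \<in> carrier D \<Longrightarrow> p \<in> carrier E \<Longrightarrow> q \<in> carrier E \<Longrightarrow>
      h u v p q \<in> carrier W"
  shows "tsum V W f (sw D (\<lambda>u v. sw E (\<lambda>p q. tens V W (g u v p q) (h u v p q)) x) a) =
    sw D (\<lambda>u v. sw E (\<lambda>p q. f (g u v p q) (h u v p q)) x) a"
proof -
  have "tsum V W f (sw D (\<lambda>u v. sw E (\<lambda>p q. tens V W (g u v p q) (h u v p q)) x) a) =
      sw D (\<lambda>u v. tsum V W f (sw E (\<lambda>p q. tens V W (g u v p q) (h u v p q)) x)) a"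
    by (rule linear_on_sw[OF linear_tsum[OF V U f] D vec_space_tensor a])
      (assumption | rule sw_closed E x vec_space_tensor tens_carrier g h)+
  also have "\<dots> = sw D (\<lambda>u v. sw E (\<lambda>p q. f (g u v p q) (h u v p q)) x) a"
    by (rule sw_cong[OF D a], rule tsum_sw_tens[OF V U f E x]) (assumption | rule g h)+
  finally show ?thesis .
qed

lemma sw_mult:
  assumes H: "bialgebra H" and U: "vec_space U" and f: "bilinear_on H H U f"
    and x: "x \<in> carrier H" and y: "y \<in> carrier H"
  shows "sw H f (mult H x y) =
    sw H (\<lambda>x' x''. sw H (\<lambda>y' y''. f (mult H x' y') (mult H x'' y'')) y) x"
  unfolding sw_def[of H f "mult H x y"] bialgebraD(10)[OF H x y]
  by (rule tsum_sw_sw_tens) (assumption | rule bialgebraD[OF H] U f x y bilinear_carrier)+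

section \<open>Threefold Sweedler sums\<close>

lemma sw3_cong:
  assumes "coalgebra C" "x \<in> carrier C"
    and "\<And>u v w. u \<in> carrier C \<Longrightarrow> v \<in> carrier C \<Longrightarrow> w \<in> carrier C \<Longrightarrow> f u v w = g u v w"
  shows "sw3 C f x = sw3 C g x"
  unfolding sw3_def
  by (rule sw_cong[OF assms(1,2)], rule sw_cong[OF assms(1)], assumption, rule assms(3))

lemma sw3_swap:
  "sw3 C (\<lambda>u v w. sw D (\<lambda>p q. F u v w p q) a) x = sw D (\<lambda>p q. sw3 C (\<lambda>u v w. F u v w p q) x) a"
  unfolding sw3_def sw_swap[of C D] ..

lemma sw3_closed [lin]:
  assumes "coalgebra C" "vec_space U" "x \<in> carrier C"
    and "\<And>u v w. u \<in> carrier C \<Longrightarrow> v \<in> carrier C \<Longrightarrow> w \<in> carrier C \<Longrightarrow> f u v w \<in> carrier U"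
  shows "sw3 C f x \<in> carrier U"
  unfolding sw3_def by (assumption | rule sw_closed assms)+

lemma linear_on_sw3:
  assumes g: "linear_on U W g" and C: "coalgebra C" and U: "vec_space U" and x: "x \<in> carrier C"
    and f: "\<And>u v w. u \<in> carrier C \<Longrightarrow> v \<in> carrier C \<Longrightarrow> w \<in> carrier C \<Longrightarrow> f u v w \<in> carrier U"
  shows "g (sw3 C f x) = sw3 C (\<lambda>u v w. g (f u v w)) x"
proof -
  have "g (sw3 C f x) = sw C (\<lambda>z w. g (sw C (\<lambda>u v. f u v w) z)) x"
    unfolding sw3_def by (rule linear_on_sw[OF g C U x]) (assumption | rule sw_closed C U f)+
  also have "\<dots> = sw3 C (\<lambda>u v w. g (f u v w)) x"
    unfolding sw3_def by (rule sw_cong[OF C x], rule linear_on_sw[OF g C U]) (assumption | rule f)+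
  finally show ?thesis .
qed

lemma linear_on_sw3_arg [lin]:
  assumes C: "coalgebra C" and U: "vec_space U" and f: "trilinear_on C U f" and g: "linear_on P C g"
  shows "linear_on P U (\<lambda>p. sw3 C f (g p))"
  unfolding sw3_def by (assumption | rule lin C U g trilinear_onD[OF f])+

lemma linear_on_sw3_param [lin]:
  assumes C: "coalgebra C" and U: "vec_space U" and x: "x \<in> carrier C"
    and F: "\<And>u v w. u \<in> carrier C \<Longrightarrow> v \<in> carrier C \<Longrightarrow> w \<in> carrier C \<Longrightarrow>
      linear_on P U (\<lambda>p. F p u v w)"
  shows "linear_on P U (\<lambda>p. sw3 C (F p) x)"
  unfolding sw3_def by (assumption | rule linear_sw_param[OF C U] x F)+

lemma sw3_unit:
  assumes H: "bialgebra H" and U: "vec_space U" and f: "trilinear_on H U f"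
  shows "sw3 H f (unit_elt H) = f (unit_elt H) (unit_elt H) (unit_elt H)"
proof -
  have "sw3 H f (unit_elt H) = sw H (\<lambda>u v. f u v (unit_elt H)) (unit_elt H)"
    unfolding sw3_def by (rule sw_unit[OF H U]) (assumption | rule lin bialgebraD[OF H] U trilinear_onD[OF f])+
  also have "\<dots> = f (unit_elt H) (unit_elt H) (unit_elt H)"
    by (rule sw_unit[OF H U]) (assumption | rule lin bialgebraD[OF H] trilinear_onD[OF f])+
  finally show ?thesis .
qed

lemma sw3_mult:
  assumes H: "bialgebra H" and U: "vec_space U" and f: "trilinear_on H U f"
    and a: "a \<in> carrier H" and b: "b \<in> carrier H"
  shows "sw3 H f (mult H a b) =
    sw3 H (\<lambda>p q z. sw3 H (\<lambda>p' q' z'. f (mult H p p') (mult H q q') (mult H z z')) b) a"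
proof -
  note f_lin = lin U trilinear_onD[OF f] bialgebraD(1-4)[OF H] bilinear_carrier[OF bialgebraD(3)[OF H]]
    bilinear_left[OF bialgebraD(3)[OF H]] bilinear_right[OF bialgebraD(3)[OF H]]
  note C = bialgebraD(1)[OF H]
  let ?f = "\<lambda>p p' q q' z z'. f (mult H p p') (mult H q q') (mult H z z')"
  have "sw3 H f (mult H a b) =
      sw H (\<lambda>u z. sw H (\<lambda>u' z'. sw H (\<lambda>p q. f p q (mult H z z')) (mult H u u')) b) a"
    unfolding sw3_def by (rule sw_mult[OF H U]) (assumption | rule f_lin a b)+
  also have "\<dots> = sw H (\<lambda>u z. sw H (\<lambda>u' z'. sw H (\<lambda>p q. sw H (\<lambda>p' q'. ?f p p' q q' z z') u') u) b) a"
    by (rule sw_cong[OF C a], rule sw_cong[OF C b], rule sw_mult[OF H U]) (assumption | rule f_lin)+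
  also have "\<dots> = sw H (\<lambda>u z. sw H (\<lambda>p q. sw H (\<lambda>u' z'. sw H (\<lambda>p' q'. ?f p p' q q' z z') u') b) u) a"
    by (rule sw_cong[OF C a], rule sw_swap)
  finally show ?thesis unfolding sw3_def .
qed

text \<open>The Sweedler sum of the tensor product coalgebra \<open>C \<otimes> D\<close>: the sum of \<open>F a' x' a'' x''\<close>.\<close>

definition dsw ::
  "('k::field, 'v::ab_group_add, 'm) coalg_scheme \<Rightarrow> ('k, 'w::ab_group_add, 'n) coalg_scheme
    \<Rightarrow> ('v \<Rightarrow> 'w \<Rightarrow> 'v \<Rightarrow> 'w \<Rightarrow> 'u::ab_group_add) \<Rightarrow> 'v \<Rightarrow> 'w \<Rightarrow> 'u" where
  "dsw C D F a x = sw C (\<lambda>u v. sw D (\<lambda>p q. F u p v q) x) a"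

lemma dsw_cong:
  assumes "coalgebra C" "coalgebra D" "a \<in> carrier C" "x \<in> carrier D"
    and "\<And>u p v q. u \<in> carrier C \<Longrightarrow> p \<in> carrier D \<Longrightarrow> v \<in> carrier C \<Longrightarrow> q \<in> carrier D \<Longrightarrow>
      F u p v q = G u p v q"
  shows "dsw C D F a x = dsw C D G a x"
  unfolding dsw_def
  by (rule sw_cong[OF assms(1,3)], rule sw_cong[OF assms(2,4)], rule assms(5))

lemma dsw_swap:
  "dsw C D (\<lambda>u p v q. dsw C' D' (\<lambda>u' p' v' q'. F u p v q u' p' v' q') b y) a x =
    dsw C' D' (\<lambda>u' p' v' q'. dsw C D (\<lambda>u p v q. F u p v q u' p' v' q') a x) b y"
  unfolding dsw_def sw_swap[of D C'] sw_swap[of C C'] sw_swap[of D D'] sw_swap[of C D'] ..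

lemma dsw_closed [lin]:
  assumes "coalgebra C" "coalgebra D" "vec_space U" "a \<in> carrier C" "x \<in> carrier D"
    and "\<And>u p v q. u \<in> carrier C \<Longrightarrow> p \<in> carrier D \<Longrightarrow> v \<in> carrier C \<Longrightarrow> q \<in> carrier D \<Longrightarrow>
      F u p v q \<in> carrier U"
  shows "dsw C D F a x \<in> carrier U"
  unfolding dsw_def by (assumption | rule sw_closed assms)+

lemma linear_on_dsw:
  assumes g: "linear_on U W g" and C: "coalgebra C" and D: "coalgebra D" and U: "vec_space U"
    and a: "a \<in> carrier C" and x: "x \<in> carrier D"
    and F: "\<And>u p v q. u \<in> carrier C \<Longrightarrow> p \<in> carrier D \<Longrightarrow> v \<in> carrier C \<Longrightarrow> q \<in> carrier D \<Longrightarrow>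
      F u p v q \<in> carrier U"
  shows "g (dsw C D F a x) = dsw C D (\<lambda>u p v q. g (F u p v q)) a x"
proof -
  have "g (dsw C D F a x) = sw C (\<lambda>u v. g (sw D (\<lambda>p q. F u p v q) x)) a"
    unfolding dsw_def by (rule linear_on_sw[OF g C U a]) (assumption | rule sw_closed D U x F)+
  also have "\<dots> = dsw C D (\<lambda>u p v q. g (F u p v q)) a x"
    unfolding dsw_def by (rule sw_cong[OF C a], rule linear_on_sw[OF g D U x]) (assumption | rule F)+
  finally show ?thesis .
qed

lemma linear_on_dsw_param [lin]:
  assumes "coalgebra C" "coalgebra D" "vec_space U" "a \<in> carrier C" "x \<in> carrier D"
    and "\<And>u p v q. u \<in> carrier C \<Longrightarrow> p \<in> carrier D \<Longrightarrow> v \<in> carrier C \<Longrightarrow> q \<in> carrier D \<Longrightarrow>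
      linear_on P U (\<lambda>t. F t u p v q)"
  shows "linear_on P U (\<lambda>t. dsw C D (F t) a x)"
  unfolding dsw_def by (assumption | rule lin assms)+

lemma linear_on_dsw_arg1 [lin]:
  assumes "coalgebra C" "coalgebra D" "vec_space U" "x \<in> carrier D" "linear_on P C g"
    and "\<And>p q. p \<in> carrier D \<Longrightarrow> q \<in> carrier D \<Longrightarrow> bilinear_on C C U (\<lambda>u v. F u p v q)"
  shows "linear_on P U (\<lambda>t. dsw C D F (g t) x)"
  unfolding dsw_def by (assumption | rule lin assms bilinearD[OF assms(6)])+

lemma linear_on_dsw_arg2 [lin]:
  assumes "coalgebra C" "coalgebra D" "vec_space U" "a \<in> carrier C" "linear_on P D g"
    and "\<And>u v. u \<in> carrier C \<Longrightarrow> v \<in> carrier C \<Longrightarrow> bilinear_on D D U (\<lambda>p q. F u p v q)"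
  shows "linear_on P U (\<lambda>t. dsw C D F a (g t))"
  unfolding dsw_def by (assumption | rule lin assms bilinearD[OF assms(6)])+

text \<open>Once all sums over \<open>C\<close> stand outside those over \<open>D\<close>,
  coassociativity applies separately, in \<open>D\<close> and then in \<open>C\<close>.\<close>

lemma dsw_assoc:
  assumes C: "coalgebra C" and D: "coalgebra D" and U: "vec_space U"
    and a: "a \<in> carrier C" and x: "x \<in> carrier D"
    and F1: "\<And>p q s. p \<in> carrier D \<Longrightarrow> q \<in> carrier D \<Longrightarrow> s \<in> carrier D \<Longrightarrow>
      trilinear_on C U (\<lambda>u v w. F u p v q w s)"
    and F2: "\<And>u v w. u \<in> carrier C \<Longrightarrow> v \<in> carrier C \<Longrightarrow> w \<in> carrier C \<Longrightarrow>
      trilinear_on D U (\<lambda>p q s. F u p v q w s)"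
  shows "dsw C D (\<lambda>u p w s. dsw C D (\<lambda>u p v q. F u p v q w s) u p) a x =
    dsw C D (\<lambda>u p w s. dsw C D (\<lambda>v q w s. F u p v q w s) w s) a x"
proof -
  note F_lin = lin C D U trilinear_onD[OF F1] trilinear_onD[OF F2]
  have "dsw C D (\<lambda>u p w s. dsw C D (\<lambda>u p v q. F u p v q w s) u p) a x =
      sw C (\<lambda>u w. sw C (\<lambda>u v. sw D (\<lambda>p s. sw D (\<lambda>p q. F u p v q w s) p) x) u) a"
    unfolding dsw_def by (rule sw_cong[OF C a], rule sw_swap)
  also have "\<dots> = sw C (\<lambda>u w. sw C (\<lambda>u v. sw D (\<lambda>p s. sw D (\<lambda>q s. F u p v q w s) s) x) u) a"
    by (rule sw_cong[OF C a], rule sw_cong[OF C], assumption, rule sw_assoc[OF D U x F2])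
  also have "\<dots> = sw C (\<lambda>u w. sw C (\<lambda>v w. sw D (\<lambda>p s. sw D (\<lambda>q s. F u p v q w s) s) x) w) a"
    by (rule sw_assoc[OF C U a]) (assumption | rule F_lin x)+
  also have "\<dots> = dsw C D (\<lambda>u p w s. dsw C D (\<lambda>v q w s. F u p v q w s) w s) a x"
    unfolding dsw_def by (rule sw_cong[OF C a], rule sw_swap)
  finally show ?thesis .
qed

text \<open>The quasi-bicrossed product and the tensor product \<open>tensor X A\<close> share
  carrier and scalar multiplication but are records of different types; this transfers linearity
  between them.\<close>

lemma linear_on_carrier_cong:
  assumes "carrier V = carrier V'" "smult V = smult V'"
  shows "linear_on V W f = linear_on V' W f" "linear_on W V g = linear_on W V' g"
  using assms by (simp_all add: linear_on_def)

section \<open>Separation of tensors\<close>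

text \<open>A basis of \<open>W\<close> may be infinite, but each of the finitely many vectors in
  \<open>ys\<close> has only finitely many nonzero coordinates; \<open>N\<close> collects the basis
  vectors that occur, and \<open>c\<close> consists of the coordinate functionals.\<close>

lemma finite_coordinates:
  fixes W :: "('k::field, 'w::ab_group_add, 'n) vec_scheme"
  assumes W: "vec_space W" and ys: "set ys \<subseteq> carrier W"
  obtains N c where "finite N" "N \<subseteq> carrier W" "\<And>b. linear_on W scalars (c b :: 'w \<Rightarrow> 'k)"
    "\<And>y. y \<in> set ys \<Longrightarrow> y = (\<Sum>b\<in>N. smult W (c b y) b)"
proof -
  interpret vector_space "smult W" using W by (simp add: vec_space_def)
  obtain E where E: "E \<subseteq> carrier W" "independent E" "carrier W \<subseteq> span E"
    by (rule basis_exists)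
  let ?c = "\<lambda>b y. representation E y b"
  let ?N = "\<Union>y\<in>set ys. {b. ?c b y \<noteq> 0}"
  have c: "linear_on W scalars (?c b)" for b
  proof (rule linear_onI)
    fix x y assume "x \<in> carrier W" "y \<in> carrier W"
    then show "?c b (x + y) = ?c b x + ?c b y"
      using representation_add[OF E(2), of y x] subsetD[OF E(3)] by simp
  next
    fix k x assume "x \<in> carrier W"
    then show "?c b (smult W k x) = smult scalars k (?c b x)"
      using representation_scale[OF E(2), of x k] subsetD[OF E(3)] by (simp add: scalars_def)
  qed (simp add: scalars_def)
  have fin: "finite ?N" by (auto simp: finite_representation)
  have N: "?N \<subseteq> carrier W"
    using E(1) by (auto dest: representation_ne_zero)
  have "y = (\<Sum>b\<in>?N. smult W (?c b y) b)" if y: "y \<in> set ys" for y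
  proof -
    have "y = (\<Sum>b | ?c b y \<noteq> 0. smult W (?c b y) b)"
      using sum_nonzero_representation_eq[OF E(2), of y] E(3) ys y by auto
    also have "\<dots> = (\<Sum>b\<in>?N. smult W (?c b y) b)"
      by (rule sum.mono_neutral_left) (use fin y in auto)
    finally show ?thesis .
  qed
  from that[OF fin N c this] show ?thesis .
qed

lemma sum_list_sum_swap:
  "(\<Sum>p\<leftarrow>ps. \<Sum>b\<in>N. f p b) = (\<Sum>b\<in>N. \<Sum>p\<leftarrow>ps. f p b :: 'u::comm_monoid_add)"
  by (induction ps) (auto simp: sum.distrib)

text \<open>Slicing in both directions. Each slice of \<open>t\<close> by \<open>\<phi> i\<close>
  lies in \<open>W\<close> and is killed by all \<open>\<psi> j\<close>, so it vanishes
  (\<open>A\<close>). Therefore the slice of \<open>t\<close> by any functional \<open>c\<close> on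
  \<open>W\<close> is killed by all \<open>\<phi> i\<close> and vanishes too (\<open>B\<close>).
  Expanding the second factors of \<open>t\<close> in coordinates writes \<open>t\<close> as a sum
  of such slices tensored with basis vectors.\<close>

lemma tensor_eq_0I:
  assumes V: "vec_space V" and W: "vec_space W"
    and \<phi>: "\<And>i. i \<in> I \<Longrightarrow> linear_on V scalars (\<phi> i)" and \<psi>: "\<And>j. j \<in> J \<Longrightarrow> linear_on W scalars (\<psi> j)"
    and sep\<phi>: "\<And>v. v \<in> carrier V \<Longrightarrow> (\<And>i. i \<in> I \<Longrightarrow> \<phi> i v = 0) \<Longrightarrow> v = 0"
    and sep\<psi>: "\<And>w. w \<in> carrier W \<Longrightarrow> (\<And>j. j \<in> J \<Longrightarrow> \<psi> j w = 0) \<Longrightarrow> w = 0"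
    and t: "t \<in> carrier (tensor V W)"
    and eq: "\<And>i j. i \<in> I \<Longrightarrow> j \<in> J \<Longrightarrow> tsum V W (\<lambda>v w. \<phi> i v * \<psi> j w) t = 0"
  shows "t = 0"
proof -
  let ?ps = "tensor_terms V W t"
  have ps: "set ?ps \<subseteq> carrier V \<times> carrier W" by (rule tensor_terms_carrier[OF V t])
  have "tsum V W (\<lambda>v w. smult W (\<phi> i v) w) t = 0" if i: "i \<in> I" for i
  proof (rule sep\<psi>)
    show "tsum V W (\<lambda>v w. smult W (\<phi> i v) w) t \<in> carrier W"
      by (rule lin V W t linear_on_compose[OF _ \<phi>[OF i]] \<phi>[OF i] | assumption)+
    fix j assume j: "j \<in> J"
    have "\<psi> j (tsum V W (\<lambda>v w. smult W (\<phi> i v) w) t) = tsum V W (\<lambda>v w. \<psi> j (smult W (\<phi> i v) w)) t"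
      by (rule linear_on_tsum[OF \<psi>[OF j] W V t]) (rule vec_spaceD(3)[OF W])
    also have "\<dots> = tsum V W (\<lambda>v w. \<phi> i v * \<psi> j w) t"
      by (rule tsum_cong[OF V t]) (simp add: linear_onD(3)[OF \<psi>[OF j]] scalars_def)
    finally show "\<psi> j (tsum V W (\<lambda>v w. smult W (\<phi> i v) w) t) = 0" using eq i j by simp
  qed note A = this
  have B: "tsum V W (\<lambda>v w. smult V (c w) v) t = 0" if c: "linear_on W scalars c" for c
  proof (rule sep\<phi>)
    show "tsum V W (\<lambda>v w. smult V (c w) v) t \<in> carrier V"
      by (rule lin V W t c | assumption)+
    fix i assume i: "i \<in> I"
    have "\<phi> i (tsum V W (\<lambda>v w. smult V (c w) v) t) = tsum V W (\<lambda>v w. \<phi> i (smult V (c w) v)) t"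
      by (rule linear_on_tsum[OF \<phi>[OF i] V V t]) (rule vec_spaceD(3)[OF V])
    also have "\<dots> = tsum V W (\<lambda>v w. c (smult W (\<phi> i v) w)) t"
      by (rule tsum_cong[OF V t])
        (simp add: linear_onD(3)[OF \<phi>[OF i]] linear_onD(3)[OF c] scalars_def mult.commute)
    also have "\<dots> = c (tsum V W (\<lambda>v w. smult W (\<phi> i v) w) t)"
      by (rule linear_on_tsum[OF c W V t, symmetric]) (rule vec_spaceD(3)[OF W])
    finally show "\<phi> i (tsum V W (\<lambda>v w. smult V (c w) v) t) = 0"
      using A[OF i] linear_on_zero[OF c W] by simp
  qed
  have "set (map snd ?ps) \<subseteq> carrier W" using ps by auto
  then obtain N c where N: "finite N" "N \<subseteq> carrier W" and c: "\<And>b. linear_on W scalars (c b)"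
    and cN: "\<And>w. w \<in> set (map snd ?ps) \<Longrightarrow> w = (\<Sum>b\<in>N. smult W (c b w) b)"
    by (rule finite_coordinates[OF W]) (rule that)
  have "t = (\<Sum>(v, w)\<leftarrow>?ps. tens V W v w)"
    using tsum_tens_self[OF V t] by (simp add: tsum_terms)
  also have "\<dots> = (\<Sum>(v, w)\<leftarrow>?ps. \<Sum>b\<in>N. tens V W (smult V (c b w) v) b)"
  proof (rule arg_cong[of _ _ sum_list], rule map_cong[OF refl], clarify)
    fix v w assume vw: "(v, w) \<in> set ?ps"
    then have v: "v \<in> carrier V" using ps by auto
    have w: "w = (\<Sum>b\<in>N. smult W (c b w) b)"
      by (rule cN) (use image_eqI[of w snd, OF _ vw] in simp)
    \<comment> \<open>Generalised to subsets \<open>M\<close> of \<open>N\<close> for the induction;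
      membership in the carrier is carried along because \<open>tens_add_right\<close> requires
      it.\<close>
    have "tens V W v (\<Sum>b\<in>M. smult W (d b) b) = (\<Sum>b\<in>M. tens V W (smult V (d b) v) b)
        \<and> (\<Sum>b\<in>M. smult W (d b) b) \<in> carrier W" if "M \<subseteq> N" for M and d :: "_ \<Rightarrow> 'a"
      using finite_subset[OF that N(1)] that
    proof (induction M rule: finite_induct)
      case empty
      then show ?case
        using linear_on_zero[OF _ W, of "tensor V W" "tens V W v"] bilinear_tens[of V W] v
        by (auto simp: bilinear_on_def vec_spaceD(1)[OF W])
    next
      case (insert b M)
      then have "b \<in> carrier W" using N(2) by auto
      with insert show ?case
        by (auto simp: tens_add_right v vec_spaceD[OF W] tens_smult)
    qed
    from conjunct1[OF this[OF order_refl]] show "tens V W v w = (\<Sum>b\<in>N. tens V W (smult V (c b w) v) b)"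
      by (rule trans[OF arg_cong[OF w, of "tens V W v"]])
  qed
  also have "\<dots> = (\<Sum>b\<in>N. tsum V W (\<lambda>v w. tens V W (smult V (c b w) v) b) t)"
    unfolding tsum_terms case_prod_unfold by (rule sum_list_sum_swap)
  also have "\<dots> = (\<Sum>b\<in>N. tens V W (tsum V W (\<lambda>v w. smult V (c b w) v) t) b)"
  proof (rule sum.cong[OF refl])
    fix b assume "b \<in> N"
    then have "linear_on V (tensor V W) (\<lambda>v. tens V W v b)"
      using N(2) bilinear_tens[of V W] by (auto simp: bilinear_on_def)
    from linear_on_tsum[OF this V V t, of "\<lambda>v w. smult V (c b w) v"]
    show "tsum V W (\<lambda>v w. tens V W (smult V (c b w) v) b) t = tens V W (tsum V W (\<lambda>v w. smult V (c b w) v) t) b"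
      using vec_spaceD(3)[OF V] by simp
  qed
  also have "\<dots> = 0"
  proof (rule sum.neutral, rule ballI)
    fix b assume "b \<in> N"
    then have "linear_on V (tensor V W) (\<lambda>v. tens V W v b)"
      using N(2) bilinear_tens[of V W] by (auto simp: bilinear_on_def)
    from linear_on_zero[OF this V]
    show "tens V W (tsum V W (\<lambda>v w. smult V (c b w) v) t) b = 0" by (simp add: B[OF c])
  qed
  finally show ?thesis .
qed

lemma tensor_eqI:
  assumes V: "vec_space V" and W: "vec_space W"
    and \<phi>: "\<And>i. i \<in> I \<Longrightarrow> linear_on V scalars (\<phi> i)" and \<psi>: "\<And>j. j \<in> J \<Longrightarrow> linear_on W scalars (\<psi> j)"
    and sep: "\<And>v. v \<in> carrier V \<Longrightarrow> (\<And>i. i \<in> I \<Longrightarrow> \<phi> i v = 0) \<Longrightarrow> v = 0"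
      "\<And>w. w \<in> carrier W \<Longrightarrow> (\<And>j. j \<in> J \<Longrightarrow> \<psi> j w = 0) \<Longrightarrow> w = 0"
    and s: "s \<in> carrier (tensor V W)" and t: "t \<in> carrier (tensor V W)"
    and eq: "\<And>i j. i \<in> I \<Longrightarrow> j \<in> J \<Longrightarrow>
      tsum V W (\<lambda>v w. \<phi> i v * \<psi> j w) s = tsum V W (\<lambda>v w. \<phi> i v * \<psi> j w) t"
  shows "s = t"
proof -
  have "s - t = 0"
  proof (rule tensor_eq_0I[OF V W \<phi> \<psi> sep])
    show "s - t \<in> carrier (tensor V W)" by (rule vec_spaceD(4)[OF vec_space_tensor s t])
    fix i j assume ij: "i \<in> I" "j \<in> J"
    have "linear_on (tensor V W) scalars (tsum V W (\<lambda>v w. \<phi> i v * \<psi> j w))"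
      by (rule linear_tsum[OF V vec_space_scalars] lin \<phi> \<psi> ij)+
    then show "tsum V W (\<lambda>v w. \<phi> i v * \<psi> j w) (s - t) = 0"
      by (simp add: linear_on_diff[OF _ vec_space_tensor s t] eq[OF ij])
  qed auto
  then show ?thesis by simp
qed

section \<open>Weak Hopf skew-pairs\<close>

locale skew_pairing =
  fixes X :: "('k::field, 'x::ab_group_add) bialg" and SX :: "'x \<Rightarrow> 'x"
    and A :: "('k, 'a::ab_group_add) bialg" and SA :: "'a \<Rightarrow> 'a"
    and B :: "'x \<Rightarrow> 'a \<Rightarrow> 'k"
  assumes perfect_A: "perfect_weak_hopf_algebra A SA"
    and perfect_X: "perfect_weak_hopf_algebra X SX"
    and bij_SA: "bij_betw SA (carrier A) (carrier A)"
    and skew: "weak_hopf_skew_pair X SX A SA B"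
begin

abbreviation times_A (infixl \<open>\<cdot>\<close> 70) where "a \<cdot> b \<equiv> mult A a b"
abbreviation times_X (infixl \<open>\<star>\<close> 70) where "x \<star> y \<equiv> mult X x y"
abbreviation Sb where "Sb \<equiv> antipode_inv A SA"

section \<open>The antipodes and the inverse of \<open>SA\<close>\<close>

lemma bialg: "bialgebra X" "bialgebra A"
  using perfect_A perfect_X by (auto simp: perfect_weak_hopf_algebra_def weak_hopf_algebra_def)

lemmas [simp, lin] = bialgebraD(1,2,4)[OF bialg(1)] bialgebraD(1,2,4)[OF bialg(2)]
lemmas [simp] = bialgebraD(6,7)[OF bialg(1)] bialgebraD(6,7)[OF bialg(2)]

lemmas assoc_A = bialgebraD(5)[OF bialg(2)]
lemmas assoc_X = bialgebraD(5)[OF bialg(1)]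

lemmas bil_A [lin] = bialgebraD(3)[OF bialg(2)]
lemmas bil_X [lin] = bialgebraD(3)[OF bialg(1)]

lemma bil_B [lin]: "bilinear_on X A scalars B"
  using skew by (auto simp: weak_hopf_skew_pair_def nondegenerate_form_def)

lemma lin_SA: "linear_on A A SA" and lin_SX: "linear_on X X SX"
  using perfect_A perfect_X by (auto simp: perfect_weak_hopf_algebra_def weak_hopf_algebra_def)

lemmas [simp, lin] = bilinear_carrier[OF bil_A] bilinear_carrier[OF bil_X]
  linear_onD(1)[OF lin_SA] linear_onD(1)[OF lin_SX]

lemma Sb_closed [simp, lin]: "a \<in> carrier A \<Longrightarrow> Sb a \<in> carrier A"
  and SA_Sb [simp]: "a \<in> carrier A \<Longrightarrow> SA (Sb a) = a"
  and Sb_SA [simp]: "a \<in> carrier A \<Longrightarrow> Sb (SA a) = a"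
  using bij_betw_inv_into[OF bij_SA, THEN bij_betw_apply] bij_betw_inv_into_left[OF bij_SA]
    bij_betw_inv_into_right[OF bij_SA] by blast+

lemma SA_inj: "SA a = SA b \<Longrightarrow> a \<in> carrier A \<Longrightarrow> b \<in> carrier A \<Longrightarrow> a = b"
  by (drule arg_cong[of _ _ Sb]) simp

lemma lin_Sb: "linear_on A A Sb"
proof (rule linear_onI)
  fix a b assume a: "a \<in> carrier A" and b: "b \<in> carrier A"
  then have ab: "a + b \<in> carrier A" "Sb a + Sb b \<in> carrier A" by (auto intro: vec_spaceD(2))
  show "Sb (a + b) = Sb a + Sb b"
    by (rule SA_inj[OF _ Sb_closed ab(2)])
      (simp_all add: a b ab linear_onD(2)[OF lin_SA Sb_closed Sb_closed])
next
  fix c a assume a: "a \<in> carrier A"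
  then have ca: "smult A c a \<in> carrier A" "smult A c (Sb a) \<in> carrier A"
    by (auto intro: vec_spaceD(3))
  show "Sb (smult A c a) = smult A c (Sb a)"
    by (rule SA_inj[OF _ Sb_closed ca(2)])
      (simp_all add: a ca linear_onD(3)[OF lin_SA Sb_closed])
qed simp

lemmas [lin] = bilinear_left[OF bil_A] bilinear_right[OF bil_A]
  bilinear_left[OF bil_X] bilinear_right[OF bil_X] bilinear_left[OF bil_B] bilinear_right[OF bil_B]
  linear_on_compose[OF _ lin_SA] linear_on_compose[OF _ lin_SX] linear_on_compose[OF _ lin_Sb]

lemma SA_mult: "a \<in> carrier A \<Longrightarrow> b \<in> carrier A \<Longrightarrow> SA (a \<cdot> b) = SA b \<cdot> SA a"
  and SX_mult: "x \<in> carrier X \<Longrightarrow> y \<in> carrier X \<Longrightarrow> SX (x \<star> y) = SX y \<star> SX x"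
  and SA_unit: "SA (unit_elt A) = unit_elt A"
  using perfect_A perfect_X by (auto simp: perfect_weak_hopf_algebra_def anti_algebra_morphism_def)

lemma Sb_mult: "a \<in> carrier A \<Longrightarrow> b \<in> carrier A \<Longrightarrow> Sb (a \<cdot> b) = Sb b \<cdot> Sb a"
  by (rule SA_inj) (auto simp: SA_mult)

lemma Sb_unit: "Sb (unit_elt A) = unit_elt A"
  using Sb_SA[of "unit_elt A"] by (simp add: SA_unit)

lemma comult_S: "a \<in> carrier A \<Longrightarrow> comult A (SA a) = sw A (\<lambda>u v. tens A A (SA v) (SA u)) a"
    "x \<in> carrier X \<Longrightarrow> comult X (SX x) = sw X (\<lambda>u v. tens X X (SX v) (SX u)) x"
  using perfect_A perfect_X by (auto simp: perfect_weak_hopf_algebra_def anti_coalgebra_morphism_def)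

lemma counit_Sb: "a \<in> carrier A \<Longrightarrow> counit A (Sb a) = counit A a"
proof -
  assume a: "a \<in> carrier A"
  have "counit A (SA (Sb a)) = counit A (Sb a)"
    using perfect_A Sb_closed[OF a]
    unfolding perfect_weak_hopf_algebra_def anti_coalgebra_morphism_def by blast
  then show ?thesis by (simp add: a)
qed

lemma sw_SA:
  assumes "vec_space U" "bilinear_on A A U f" "a \<in> carrier A"
  shows "sw A f (SA a) = sw A (\<lambda>u v. f (SA v) (SA u)) a"
  unfolding sw_def[of A f "SA a"] comult_S(1)[OF assms(3)]
  by (rule tsum_sw_tens) (use assms in auto)

lemma sw_SX:
  assumes "vec_space U" "bilinear_on X X U f" "a \<in> carrier X"
  shows "sw X f (SX a) = sw X (\<lambda>u v. f (SX v) (SX u)) a"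
  unfolding sw_def[of X f "SX a"] comult_S(2)[OF assms(3)]
  by (rule tsum_sw_tens) (use assms in auto)

text \<open>The inverse of an order-reversing coalgebra bijection reverses the order again:
  \<open>sw_SA\<close> is applied at \<open>Sb a\<close> to \<open>f\<close> precomposed with
  \<open>Sb\<close> in both arguments.\<close>

lemma sw_Sb:
  assumes U: "vec_space U" and f: "bilinear_on A A U f" and a: "a \<in> carrier A"
  shows "sw A f (Sb a) = sw A (\<lambda>u v. f (Sb v) (Sb u)) a"
proof -
  have "bilinear_on A A U (\<lambda>u v. f (Sb v) (Sb u))"
    by (assumption | rule lin bilinear_left[OF f] bilinear_right[OF f])+
  from sw_SA[OF U this, of "Sb a"] a
  have "sw A (\<lambda>u v. f (Sb v) (Sb u)) a = sw A (\<lambda>u v. f (Sb (SA u)) (Sb (SA v))) (Sb a)" by simp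
  also have "\<dots> = sw A f (Sb a)"
    by (rule sw_cong) (use a in auto)
  finally show ?thesis ..
qed

section \<open>The central factor \<open>\<kappa>\<close> and its transpose under the
  pairing\<close>

lemma conv_SA_central: "a \<in> carrier A \<Longrightarrow> b \<in> carrier A \<Longrightarrow>
    sw A (\<lambda>u v. u \<cdot> SA v) a \<cdot> b = b \<cdot> sw A (\<lambda>u v. u \<cdot> SA v) a"
  and conv_SX_central: "x \<in> carrier X \<Longrightarrow> y \<in> carrier X \<Longrightarrow>
    sw X (\<lambda>u v. u \<star> SX v) x \<star> y = y \<star> sw X (\<lambda>u v. u \<star> SX v) x"
  using perfect_A perfect_X
  by (auto simp: perfect_weak_hopf_algebra_def center_def convolution_def image_subset_iff)

text \<open>In a Hopf algebra with invertible antipode this is \<open>counit A a\<close> times the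
  unit.\<close>

definition \<kappa> where "\<kappa> a = sw A (\<lambda>u v. v \<cdot> Sb u) a"

lemma lin_\<kappa>': "linear_on A A \<kappa>"
  unfolding \<kappa>_def by (assumption | rule lin)+

lemmas [lin] = linear_on_compose[OF _ lin_\<kappa>']
lemmas \<kappa>_closed [simp, lin] = linear_onD(1)[OF lin_\<kappa>']

lemma SA_\<kappa>: "a \<in> carrier A \<Longrightarrow> SA (\<kappa> a) = sw A (\<lambda>u v. u \<cdot> SA v) a"
  unfolding \<kappa>_def
  by (subst linear_on_sw[OF lin_SA]) (auto simp: SA_mult intro!: sw_cong)

lemma \<kappa>_central:
  assumes "a \<in> carrier A" "b \<in> carrier A"
  shows "\<kappa> a \<cdot> b = b \<cdot> \<kappa> a"
  by (rule SA_inj) (use assms in \<open>auto simp: SA_mult SA_\<kappa> conv_SA_central\<close>)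

lemma \<kappa>_mult:
  assumes a: "a \<in> carrier A"
  shows "sw A (\<lambda>u r. \<kappa> r \<cdot> u) a = a"
proof (rule SA_inj)
  show "sw A (\<lambda>u r. \<kappa> r \<cdot> u) a \<in> carrier A" by (rule lin a | assumption)+
  have "SA (sw A (\<lambda>u r. \<kappa> r \<cdot> u) a) = sw A (\<lambda>u r. SA (\<kappa> r \<cdot> u)) a"
    by (rule linear_on_sw[OF lin_SA]) (use a in auto)
  also have "\<dots> = sw A (\<lambda>u r. SA u \<cdot> sw A (\<lambda>p q. p \<cdot> SA q) r) a"
    by (rule sw_cong) (use a in \<open>auto simp: SA_mult SA_\<kappa>\<close>)
  also have "\<dots> = sw A (\<lambda>u r. sw A (\<lambda>p q. SA u \<cdot> (p \<cdot> SA q)) r) a"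
    by (rule sw_cong, simp, rule a, rule linear_on_sw[where U = A]) (assumption | rule lin)+
  \<comment> \<open>Bracketed to the left, as in the second weak antipode equation.\<close>
  also have "\<dots> = sw A (\<lambda>r q. sw A (\<lambda>u p. SA u \<cdot> (p \<cdot> SA q)) r) a"
    by (rule sw_coassoc[where U = A, symmetric]) (assumption | rule lin a)+
  also have "\<dots> = sw A (\<lambda>r q. sw A (\<lambda>u p. SA u \<cdot> p) r \<cdot> SA q) a"
  proof (rule sw_cong[OF _ a])
    fix r q assume "r \<in> carrier A" "q \<in> carrier A"
    then show "sw A (\<lambda>u p. SA u \<cdot> (p \<cdot> SA q)) r = sw A (\<lambda>u p. SA u \<cdot> p) r \<cdot> SA q"
      by (subst linear_on_sw[where U = A and g = "\<lambda>w. w \<cdot> SA q"])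
        (auto simp: assoc_A intro!: lin sw_cong)
  qed simp
  also have "\<dots> = SA a"
    using perfect_A a
    by (auto simp: perfect_weak_hopf_algebra_def weak_hopf_algebra_def convolution_def)
  finally show "SA (sw A (\<lambda>u r. \<kappa> r \<cdot> u) a) = SA a" .
qed (rule a)

lemma pair_mult: "x \<in> carrier X \<Longrightarrow> a \<in> carrier A \<Longrightarrow> b \<in> carrier A \<Longrightarrow>
    sw X (\<lambda>u v. B v a * B u b) x = B x (a \<cdot> b)"
  and pair_star: "x \<in> carrier X \<Longrightarrow> y \<in> carrier X \<Longrightarrow> a \<in> carrier A \<Longrightarrow>
    sw A (\<lambda>u v. B x u * B y v) a = B (x \<star> y) a"
  and pair_SX: "x \<in> carrier X \<Longrightarrow> a \<in> carrier A \<Longrightarrow> B (SX x) a = B x (Sb a)"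
  and pair_unit: "x \<in> carrier X \<Longrightarrow> B x (unit_elt A) = counit X x"
    "a \<in> carrier A \<Longrightarrow> B (unit_elt X) a = counit A a"
  using skew by (auto simp: weak_hopf_skew_pair_def)

lemma pair_mult': "x \<in> carrier X \<Longrightarrow> a \<in> carrier A \<Longrightarrow> b \<in> carrier A \<Longrightarrow>
    sw X (\<lambda>u v. B u b * B v a) x = B x (a \<cdot> b)"
  using pair_mult[of x a b] by (simp add: mult.commute)

lemma pair_lin: "a \<in> carrier A \<Longrightarrow> linear_on X scalars (\<lambda>x. B x a)"
  "x \<in> carrier X \<Longrightarrow> linear_on A scalars (B x)"
  using bil_B by (auto simp: bilinear_on_def)

lemma nondeg: "x \<in> carrier X \<Longrightarrow> (\<And>a. a \<in> carrier A \<Longrightarrow> B x a = 0) \<Longrightarrow> x = 0"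
  "a \<in> carrier A \<Longrightarrow> (\<And>x. x \<in> carrier X \<Longrightarrow> B x a = 0) \<Longrightarrow> a = 0"
  using skew by (auto simp: weak_hopf_skew_pair_def nondegenerate_form_def)

lemma X_eqI:
  assumes x: "x \<in> carrier X" and y: "y \<in> carrier X"
    and eq: "\<And>a. a \<in> carrier A \<Longrightarrow> B x a = B y a"
  shows "x = y"
proof -
  have "x - y = 0"
  proof (rule nondeg(1))
    show "x - y \<in> carrier X" by (rule vec_spaceD(4)[OF _ x y]) simp
    fix a assume a: "a \<in> carrier A"
    show "B (x - y) a = 0"
      using linear_on_diff[OF pair_lin(1)[OF a] _ x y] eq[OF a] by simp
  qed
  then show ?thesis by simp
qed

text \<open>Only \<open>SA\<close> is given as a bijection. Injectivity of \<open>SX\<close> is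
  inherited through the pairing: \<open>B (SX x) (SA a) = B x a\<close> by \<open>pair_SX\<close>,
  and the form is nondegenerate.\<close>

lemma SX_inj:
  assumes x: "x \<in> carrier X" and y: "y \<in> carrier X" and eq: "SX x = SX y"
  shows "x = y"
proof (rule X_eqI[OF x y])
  fix a assume a: "a \<in> carrier A"
  have "B (SX x) (SA a) = B (SX y) (SA a)" by (simp add: eq)
  then show "B x a = B y a" using x y a by (simp add: pair_SX)
qed

text \<open>The counterpart of \<open>\<kappa>\<close> in \<open>X\<close>;
  \<open>pair_\<kappa>\<close> shows that it is the transpose of \<open>\<kappa>\<close>.\<close>

definition \<theta> where "\<theta> x = sw X (\<lambda>u v. SX u \<star> v) x"

lemma \<theta>_closed [simp, lin]: "x \<in> carrier X \<Longrightarrow> \<theta> x \<in> carrier X"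
  unfolding \<theta>_def by (assumption | rule lin)+

lemma SX_\<theta>:
  assumes x: "x \<in> carrier X"
  shows "SX (\<theta> x) = sw X (\<lambda>u v. u \<star> SX v) (SX x)"
proof -
  have "SX (\<theta> x) = sw X (\<lambda>u v. SX (SX u \<star> v)) x"
    unfolding \<theta>_def by (rule linear_on_sw[OF lin_SX]) (assumption | rule lin x)+
  also have "\<dots> = sw X (\<lambda>u v. SX v \<star> SX (SX u)) x"
    by (rule sw_cong) (simp_all add: x SX_mult)
  also have "\<dots> = sw X (\<lambda>u v. u \<star> SX v) (SX x)"
    by (rule sw_SX[where U = X, symmetric]) (assumption | rule lin x)+
  finally show ?thesis .
qed

text \<open>\<open>S\<^sub>X\<close> maps \<open>S(x')x''\<close> to \<open>y'S(y'')\<close> with \<open>y = S(x)\<close>, which is central because \<open>X\<close> is perfect.\<close>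

lemma \<theta>_central:
  assumes x: "x \<in> carrier X" and y: "y \<in> carrier X"
  shows "\<theta> x \<star> y = y \<star> \<theta> x"
  by (rule SX_inj) (simp_all add: x y SX_mult SX_\<theta> conv_SX_central)

text \<open>The skew rule splits \<open>x\<close> over the product \<open>v \<cdot> Sb u\<close> so
  that its first component meets \<open>Sb u\<close>; \<open>pair_SX\<close> turns that factor into
  \<open>B (SX p) u\<close>, and \<open>pair_star\<close> reassembles the two components of
  \<open>a\<close>.\<close>

lemma pair_\<kappa>:
  assumes x: "x \<in> carrier X" and a: "a \<in> carrier A"
  shows "B x (\<kappa> a) = B (\<theta> x) a"
proof -
  have "B x (\<kappa> a) = sw A (\<lambda>u v. B x (v \<cdot> Sb u)) a"
    unfolding \<kappa>_def by (rule linear_on_sw[OF pair_lin(2)]) (assumption | rule lin x a)+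
  also have "\<dots> = sw A (\<lambda>u v. sw X (\<lambda>p q. B (SX p) u * B q v) x) a"
  proof (rule sw_cong[OF _ a])
    fix u v assume u: "u \<in> carrier A" and v: "v \<in> carrier A"
    have "B x (v \<cdot> Sb u) = sw X (\<lambda>p q. B p (Sb u) * B q v) x"
      by (rule pair_mult'[symmetric]) (simp_all add: x u v)
    also have "\<dots> = sw X (\<lambda>p q. B (SX p) u * B q v) x"
      by (rule sw_cong) (simp_all add: x u pair_SX)
    finally show "B x (v \<cdot> Sb u) = sw X (\<lambda>p q. B (SX p) u * B q v) x" .
  qed simp
  also have "\<dots> = sw X (\<lambda>p q. sw A (\<lambda>u v. B (SX p) u * B q v) a) x" by (rule sw_swap)
  also have "\<dots> = sw X (\<lambda>p q. B (SX p \<star> q) a) x"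
    by (rule sw_cong) (simp_all add: x a pair_star)
  also have "\<dots> = B (\<theta> x) a"
    unfolding \<theta>_def by (rule linear_on_sw[OF pair_lin(1)[OF a], symmetric]) (assumption | rule lin x)+
  finally show ?thesis .
qed

text \<open>Centrality of \<open>S(x')x''\<close> in \<open>X\<close>, transported to \<open>A\<close> through the pairing.\<close>

lemma \<kappa>_swap:
  assumes U: "vec_space U" and f: "bilinear_on A A U f" and a: "a \<in> carrier A"
  shows "sw A (\<lambda>u r. f u (\<kappa> r)) a = sw A (\<lambda>r u. f u (\<kappa> r)) a"
proof -
  have "sw A (\<lambda>u r. tens A A u (\<kappa> r)) a = sw A (\<lambda>r u. tens A A u (\<kappa> r)) a" (is "?s = ?t")
  proof (rule tensor_eqI[of A A "carrier X" B "carrier X" B])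
    show "?s \<in> carrier (tensor A A)" "?t \<in> carrier (tensor A A)"
      by (rule lin a | assumption)+
    fix x y assume x: "x \<in> carrier X" and y: "y \<in> carrier X"
    let ?f = "\<lambda>u v. B x u * B y v"
    have f: "bilinear_on A A scalars ?f" by (assumption | rule lin x y)+
    have "tsum A A ?f ?s = sw A (\<lambda>u r. B x u * B y (\<kappa> r)) a"
      by (rule tsum_sw_tens[OF _ vec_space_scalars f]) (simp_all add: a)
    also have "\<dots> = sw A (\<lambda>u r. B x u * B (\<theta> y) r) a"
      by (rule sw_cong) (simp_all add: a y pair_\<kappa>)
    \<comment> \<open>The sum is \<open>B (x \<star> \<theta> y) a\<close>. Reading the product in
      the other order, by centrality of \<open>\<theta> y\<close>, exchanges the two components of
      \<open>a\<close>.\<close>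
    also have "\<dots> = B (\<theta> y \<star> x) a" by (simp add: x y a pair_star \<theta>_central)
    also have "\<dots> = sw A (\<lambda>r u. B (\<theta> y) r * B x u) a" by (simp add: x y a pair_star)
    also have "\<dots> = sw A (\<lambda>r u. B x u * B y (\<kappa> r)) a"
      by (rule sw_cong) (simp_all add: a y pair_\<kappa>)
    also have "\<dots> = tsum A A ?f ?t"
      by (rule tsum_sw_tens[OF _ vec_space_scalars f, symmetric]) (simp_all add: a)
    finally show "tsum A A ?f ?s = tsum A A ?f ?t" .
  qed (auto intro: pair_lin nondeg)
  then have "tsum A A f ?s = tsum A A f ?t" by simp
  moreover have "tsum A A f ?s = sw A (\<lambda>u r. f u (\<kappa> r)) a"
    "tsum A A f ?t = sw A (\<lambda>r u. f u (\<kappa> r)) a"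
    by (rule tsum_sw_tens[OF _ U f]; simp add: a)+
  ultimately show ?thesis by simp
qed

section \<open>The adjoint action \<open>ad\<close> and the removal of
  \<open>\<kappa>\<close>\<close>

lemmas sw_assoc_A = sw_assoc[of A, OF bialgebraD(1)[OF bialg(2)]]
lemmas sw_cong_A = sw_cong[of A, OF bialgebraD(1)[OF bialg(2)]]
lemmas sw_cong_X = sw_cong[of X, OF bialgebraD(1)[OF bialg(1)]]
lemmas linear_on_sw_A = linear_on_sw[where C = A, OF _ bialgebraD(1)[OF bialg(2)]]
lemmas linear_on_sw_X = linear_on_sw[where C = X, OF _ bialgebraD(1)[OF bialg(1)]]

text \<open>A right adjoint action of \<open>A\<close> on itself, built with the inverse antipode:
  \<open>ad_ad\<close> and \<open>ad_unit\<close> are its action laws, which transpose to those of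
  the left action \<open>\<rhd>\<close>.\<close>

definition ad where "ad b a = sw A (\<lambda>u v. Sb v \<cdot> (b \<cdot> u)) a"

lemma bilinear_ad: "bilinear_on A A A ad"
  unfolding ad_def by (assumption | rule lin)+

lemmas [lin] = bilinear_left[OF bilinear_ad] bilinear_right[OF bilinear_ad]
lemmas ad_closed [simp, lin] = bilinear_carrier[OF bilinear_ad]

lemma \<kappa>_mult_apply:
  assumes U: "vec_space U" and h: "linear_on A U h" and a: "a \<in> carrier A"
  shows "sw A (\<lambda>u r. h (\<kappa> r \<cdot> u)) a = h a"
  using linear_on_sw_A[OF h _ a, of "\<lambda>u r. \<kappa> r \<cdot> u"] \<kappa>_mult[OF a] by simp

text \<open>With three components of \<open>w\<close> the left side is the sum of
  \<open>w''' \<cdot> Sb w'' \<cdot> c \<cdot> w'\<close>. The first two factors form some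
  \<open>\<kappa> r\<close>, which moves past \<open>c\<close> by centrality and is absorbed by the
  adjacent component \<open>w'\<close>.\<close>

lemma mult_ad:
  assumes c: "c \<in> carrier A" and w: "w \<in> carrier A"
  shows "sw A (\<lambda>u v. v \<cdot> ad c u) w = c \<cdot> w"
proof -
  have "sw A (\<lambda>u v. v \<cdot> ad c u) w = sw A (\<lambda>u v. sw A (\<lambda>p q. v \<cdot> (Sb q \<cdot> (c \<cdot> p))) u) w"
    unfolding ad_def by (rule sw_cong_A[OF w], rule linear_on_sw_A) (assumption | rule lin c)+
  also have "\<dots> = sw A (\<lambda>p r. sw A (\<lambda>q v. v \<cdot> (Sb q \<cdot> (c \<cdot> p))) r) w"
    by (rule sw_assoc_A[where U = A]) (assumption | rule lin c w)+
  also have "\<dots> = sw A (\<lambda>p r. c \<cdot> (\<kappa> r \<cdot> p)) w"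
  proof (rule sw_cong_A[OF w])
    fix p r assume p: "p \<in> carrier A" and r: "r \<in> carrier A"
    have "sw A (\<lambda>q v. v \<cdot> (Sb q \<cdot> (c \<cdot> p))) r = sw A (\<lambda>q v. (v \<cdot> Sb q) \<cdot> (c \<cdot> p)) r"
      by (rule sw_cong_A[OF r]) (simp add: assoc_A p c)
    also have "\<dots> = \<kappa> r \<cdot> (c \<cdot> p)"
      unfolding \<kappa>_def by (rule linear_on_sw_A[where U = A, symmetric]) (assumption | rule lin c p r)+
    also have "\<dots> = c \<cdot> (\<kappa> r \<cdot> p)"
      using assoc_A[of "\<kappa> r" c p] assoc_A[of c "\<kappa> r" p] \<kappa>_central[of r c] c p r by simp
    finally show "sw A (\<lambda>q v. v \<cdot> (Sb q \<cdot> (c \<cdot> p))) r = c \<cdot> (\<kappa> r \<cdot> p)" .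
  qed
  also have "\<dots> = c \<cdot> w"
    by (rule \<kappa>_mult_apply[where U = A]) (assumption | rule lin c w)+
  finally show ?thesis .
qed

text \<open>Writing out \<open>ad b v\<close> exposes a factor \<open>p\<close> directly before
  \<open>ad c u\<close>, where \<open>p\<close> is the component of \<open>a\<close> following
  \<open>u\<close>, so \<open>mult_ad\<close> applies inside. Dually, this is compatibility of
  \<open>\<rhd>\<close> with the comultiplication of \<open>X\<close>.\<close>

lemma ad_mult:
  assumes b: "b \<in> carrier A" and c: "c \<in> carrier A" and a: "a \<in> carrier A"
  shows "sw A (\<lambda>u v. ad b v \<cdot> ad c u) a = ad (b \<cdot> c) a"
proof -
  have "sw A (\<lambda>u v. ad b v \<cdot> ad c u) a =
      sw A (\<lambda>u v. sw A (\<lambda>p q. (Sb q \<cdot> (b \<cdot> p)) \<cdot> ad c u) v) a"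
    unfolding ad_def[of b]
    by (rule sw_cong_A[OF a], rule linear_on_sw_A[where U = A]) (assumption | rule lin b c)+
  also have "\<dots> = sw A (\<lambda>w q. sw A (\<lambda>u p. (Sb q \<cdot> (b \<cdot> p)) \<cdot> ad c u) w) a"
    by (rule sw_assoc_A[where U = A, symmetric]) (assumption | rule lin b c a)+
  also have "\<dots> = sw A (\<lambda>w q. Sb q \<cdot> (b \<cdot> c \<cdot> w)) a"
  proof (rule sw_cong_A[OF a])
    fix w q assume w: "w \<in> carrier A" and q: "q \<in> carrier A"
    have "sw A (\<lambda>u p. (Sb q \<cdot> (b \<cdot> p)) \<cdot> ad c u) w = sw A (\<lambda>u p. Sb q \<cdot> (b \<cdot> (p \<cdot> ad c u))) w"
      by (rule sw_cong_A[OF w]) (simp add: assoc_A b c q)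
    also have "\<dots> = Sb q \<cdot> (b \<cdot> sw A (\<lambda>u p. p \<cdot> ad c u) w)"
      by (rule linear_on_sw_A[where U = A, symmetric]) (assumption | rule lin b c q w)+
    also have "\<dots> = Sb q \<cdot> (b \<cdot> c \<cdot> w)" by (simp add: mult_ad assoc_A b c w q)
    finally show "sw A (\<lambda>u p. (Sb q \<cdot> (b \<cdot> p)) \<cdot> ad c u) w = Sb q \<cdot> (b \<cdot> c \<cdot> w)" .
  qed
  finally show ?thesis by (simp add: ad_def)
qed

text \<open>The comultiplication respects products and \<open>Sb\<close> reverses them, so the
  components of \<open>c\<close> wrap around those of \<open>a\<close>.\<close>

lemma ad_ad:
  assumes b: "b \<in> carrier A" and c: "c \<in> carrier A" and a: "a \<in> carrier A"
  shows "ad b (a \<cdot> c) = ad (ad b a) c"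
proof -
  have "ad b (a \<cdot> c) =
      sw A (\<lambda>u v. sw A (\<lambda>p q. Sb (v \<cdot> q) \<cdot> (b \<cdot> (u \<cdot> p))) c) a"
    unfolding ad_def by (rule sw_mult[OF bialg(2), where U = A]) (assumption | rule lin a b c)+
  also have "\<dots> = sw A (\<lambda>u v. sw A (\<lambda>p q. Sb q \<cdot> (Sb v \<cdot> (b \<cdot> u) \<cdot> p)) c) a"
    by (rule sw_cong_A[OF a], rule sw_cong_A[OF c]) (simp add: Sb_mult assoc_A b)
  also have "\<dots> = sw A (\<lambda>p q. sw A (\<lambda>u v. Sb q \<cdot> (Sb v \<cdot> (b \<cdot> u) \<cdot> p)) a) c"
    by (rule sw_swap)
  also have "\<dots> = ad (ad b a) c"
    unfolding ad_def
    by (rule sw_cong_A[OF c], rule linear_on_sw_A[where U = A, symmetric]) (assumption | rule lin a b)+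
  finally show ?thesis .
qed

lemmas sw3_cong_A = sw3_cong[of A, OF bialgebraD(1)[OF bialg(2)]]
lemmas linear_on_sw3_A = linear_on_sw3[where C = A, OF _ bialgebraD(1)[OF bialg(2)]]

text \<open>In \<open>\<Sum>K(a\<^sub>4S\<^sup>-\<^sup>1(a\<^sub>3)a\<^sub>1, a\<^sub>2, a\<^sub>5)\<close> the central factor \<open>\<kappa>(r) = r''S\<^sup>-\<^sup>1(r')\<close> is first moved past
  \<open>a\<^sub>2\<close> by \<open>\<kappa>_swap\<close> and then absorbed by \<open>a\<^sub>1\<close>.\<close>

lemma \<kappa>_absorb:
  assumes U: "vec_space U" and K: "trilinear_on A U K" and a: "a \<in> carrier A"
  shows "sw A (\<lambda>u v. sw3 A (\<lambda>p q z. sw A (\<lambda>v1 v2. K (v1 \<cdot> (Sb z \<cdot> p)) q v2) v) u) a = sw3 A K a"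
proof -
  note K_lin = lin U trilinear_onD[OF K]
  let ?F = "\<lambda>p q z v. sw A (\<lambda>v1 v2. K (v1 \<cdot> (Sb z \<cdot> p)) q v2) v"
  let ?G = "\<lambda>p q r y. K (\<kappa> r \<cdot> p) q y"
  have inner: "sw A (\<lambda>z v. ?F p q z v) y = sw A (\<lambda>r v. ?G p q r v) y"
    if p: "p \<in> carrier A" and q: "q \<in> carrier A" and y: "y \<in> carrier A" for p q y
  proof -
    \<comment> \<open>The consecutive components \<open>z\<close> and \<open>v1\<close> are
      regrouped into \<open>r\<close>, so that the products \<open>v1 \<cdot> Sb z\<close> add up to
      \<open>\<kappa> r\<close>.\<close>
    have "sw A (\<lambda>z v. ?F p q z v) y = sw A (\<lambda>r v2. sw A (\<lambda>z v1. K (v1 \<cdot> (Sb z \<cdot> p)) q v2) r) y"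
      by (rule sw_assoc_A[symmetric, OF U]) (assumption | rule K_lin p q y)+
    also have "\<dots> = sw A (\<lambda>r v. ?G p q r v) y"
    proof (rule sw_cong_A[OF y])
      fix r v assume r: "r \<in> carrier A" and v: "v \<in> carrier A"
      have "sw A (\<lambda>z v1. K (v1 \<cdot> (Sb z \<cdot> p)) q v) r = sw A (\<lambda>z v1. K ((v1 \<cdot> Sb z) \<cdot> p) q v) r"
        by (rule sw_cong_A[OF r]) (simp add: p assoc_A)
      also have "\<dots> = K (\<kappa> r \<cdot> p) q v"
        unfolding \<kappa>_def
        by (rule linear_on_sw_A[where U = A and W = U, symmetric]) (assumption | rule K_lin p q v r)+
      finally show "sw A (\<lambda>z v1. K (v1 \<cdot> (Sb z \<cdot> p)) q v) r = K (\<kappa> r \<cdot> p) q v" .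
    qed
    finally show ?thesis .
  qed
  have outer: "sw A (\<lambda>w r. sw A (\<lambda>p q. ?G p q r v) w) t = sw A (\<lambda>s q. K s q v) t"
    if v: "v \<in> carrier A" and t: "t \<in> carrier A" for t v
  proof -
    have "sw A (\<lambda>w r. sw A (\<lambda>p q. ?G p q r v) w) t = sw A (\<lambda>p s. sw A (\<lambda>q r. ?G p q r v) s) t"
      by (rule sw_assoc_A[OF U]) (assumption | rule K_lin v t)+
    also have "\<dots> = sw A (\<lambda>p s. sw A (\<lambda>r q. ?G p q r v) s) t"
      by (rule sw_cong_A[OF t], rule \<kappa>_swap[OF U]) (assumption | rule K_lin v)+
    also have "\<dots> = sw A (\<lambda>s q. sw A (\<lambda>p r. ?G p q r v) s) t"
      by (rule sw_assoc_A[OF U, symmetric]) (assumption | rule K_lin v t)+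
    also have "\<dots> = sw A (\<lambda>s q. K s q v) t"
      by (rule sw_cong_A[OF t], rule \<kappa>_mult_apply[OF U]) (assumption | rule K_lin v)+
    finally show ?thesis .
  qed
  have "sw A (\<lambda>u v. sw3 A (\<lambda>p q z. ?F p q z v) u) a =
      sw A (\<lambda>w y. sw A (\<lambda>z v. sw A (\<lambda>p q. ?F p q z v) w) y) a"
    unfolding sw3_def by (rule sw_assoc_A[OF U]) (assumption | rule K_lin a)+
  also have "\<dots> = sw A (\<lambda>w y. sw A (\<lambda>p q. sw A (\<lambda>z v. ?F p q z v) y) w) a"
    by (rule sw_cong_A[OF a], rule sw_swap)
  also have "\<dots> = sw A (\<lambda>w y. sw A (\<lambda>p q. sw A (\<lambda>r v. ?G p q r v) y) w) a"
    by (rule sw_cong_A[OF a], rule sw_cong_A, assumption, rule inner)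
  also have "\<dots> = sw A (\<lambda>w y. sw A (\<lambda>r v. sw A (\<lambda>p q. ?G p q r v) w) y) a"
    by (rule sw_cong_A[OF a], rule sw_swap)
  also have "\<dots> = sw A (\<lambda>t v. sw A (\<lambda>w r. sw A (\<lambda>p q. ?G p q r v) w) t) a"
    by (rule sw_assoc_A[OF U, symmetric]) (assumption | rule K_lin a)+
  also have "\<dots> = sw3 A K a"
    unfolding sw3_def by (rule sw_cong_A[OF a], rule outer)
  finally show ?thesis .
qed

text \<open>Tested through the pairing, the two sides of the exchange condition become the left
  sides of this lemma and of \<open>sw3_ad_right\<close>, whose right sides agree. Here
  \<open>ad c v\<close> contributes a component \<open>v1\<close> next to \<open>Sb z\<close>, and
  \<open>q\<close> separates their product from the absorbing component \<open>p\<close>; this is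
  the situation of \<open>\<kappa>_absorb\<close>.\<close>

lemma sw3_ad_left:
  assumes U: "vec_space U" and f: "bilinear_on A A U f" and a: "a \<in> carrier A" and c: "c \<in> carrier A"
  shows "sw A (\<lambda>u v. sw3 A (\<lambda>p q z. f (ad c v \<cdot> (Sb z \<cdot> p)) q) u) a =
    sw3 A (\<lambda>p q z. f (Sb z \<cdot> (c \<cdot> p)) q) a"
proof -
  note f_lin = lin U bilinearD[OF f] c
  have "sw A (\<lambda>u v. sw3 A (\<lambda>p q z. f (ad c v \<cdot> (Sb z \<cdot> p)) q) u) a =
      sw A (\<lambda>u v. sw3 A (\<lambda>p q z. sw A (\<lambda>v1 v2. f (Sb v2 \<cdot> (c \<cdot> (v1 \<cdot> (Sb z \<cdot> p)))) q) v) u) a"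
  proof (rule sw_cong_A[OF a], rule sw3_cong_A, assumption)
    fix v p q z assume A: "v \<in> carrier A" "p \<in> carrier A" "q \<in> carrier A" "z \<in> carrier A"
    have "f (ad c v \<cdot> (Sb z \<cdot> p)) q = sw A (\<lambda>v1 v2. f (Sb v2 \<cdot> (c \<cdot> v1) \<cdot> (Sb z \<cdot> p)) q) v"
      unfolding ad_def
      by (rule linear_on_sw_A[where U = A and W = U and g = "\<lambda>w. f (w \<cdot> (Sb z \<cdot> p)) q"])
        (assumption | rule f_lin A)+
    also have "\<dots> = sw A (\<lambda>v1 v2. f (Sb v2 \<cdot> (c \<cdot> (v1 \<cdot> (Sb z \<cdot> p)))) q) v"
      by (rule sw_cong_A) (simp_all add: A c assoc_A)
    finally show "f (ad c v \<cdot> (Sb z \<cdot> p)) q = sw A (\<lambda>v1 v2. f (Sb v2 \<cdot> (c \<cdot> (v1 \<cdot> (Sb z \<cdot> p)))) q) v" .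
  qed
  also have "\<dots> = sw3 A (\<lambda>p q z. f (Sb z \<cdot> (c \<cdot> p)) q) a"
    by (rule \<kappa>_absorb[OF U _ a, of "\<lambda>p q z. f (Sb z \<cdot> (c \<cdot> p)) q"]) (assumption | rule f_lin)+
  finally show ?thesis .
qed

text \<open>Here \<open>u\<close> is immediately followed by \<open>p\<close> in the Sweedler order,
  so after regrouping \<open>mult_ad\<close> gives the result. Read from right to left, it creates
  the factor \<open>ad c u\<close> by which an action \<open>u \<rhd> _\<close> is
  recognised.\<close>

lemma sw3_ad_right:
  assumes U: "vec_space U" and f: "bilinear_on A A U f" and a: "a \<in> carrier A" and c: "c \<in> carrier A"
  shows "sw A (\<lambda>u v. sw3 A (\<lambda>p q z. f (Sb z \<cdot> p \<cdot> ad c u) q) v) a =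
    sw3 A (\<lambda>p q z. f (Sb z \<cdot> (c \<cdot> p)) q) a"
proof -
  note f_lin = lin U bilinearD[OF f] c
  let ?F = "\<lambda>u p q z. f (Sb z \<cdot> p \<cdot> ad c u) q"
  have "sw A (\<lambda>u v. sw3 A (?F u) v) a = sw A (\<lambda>w z. sw A (\<lambda>u u'. sw A (\<lambda>p q. ?F u p q z) u') w) a"
    unfolding sw3_def by (rule sw_assoc_A[OF U, symmetric]) (assumption | rule f_lin a)+
  also have "\<dots> = sw A (\<lambda>w z. sw A (\<lambda>w' q. sw A (\<lambda>u p. ?F u p q z) w') w) a"
    by (rule sw_cong_A[OF a], rule sw_assoc_A[OF U, symmetric]) (assumption | rule f_lin)+
  also have "\<dots> = sw A (\<lambda>w z. sw A (\<lambda>w' q. f (Sb z \<cdot> (c \<cdot> w')) q) w) a"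
  proof (rule sw_cong_A[OF a], rule sw_cong_A, assumption)
    fix z w' q assume A: "z \<in> carrier A" "w' \<in> carrier A" "q \<in> carrier A"
    have "sw A (\<lambda>u p. ?F u p q z) w' = sw A (\<lambda>u p. f (Sb z \<cdot> (p \<cdot> ad c u)) q) w'"
      by (rule sw_cong_A) (simp_all add: A c assoc_A)
    also have "\<dots> = f (Sb z \<cdot> sw A (\<lambda>u p. p \<cdot> ad c u) w') q"
      by (rule linear_on_sw_A[where U = A and W = U, symmetric]) (assumption | rule f_lin A)+
    finally show "sw A (\<lambda>u p. ?F u p q z) w' = f (Sb z \<cdot> (c \<cdot> w')) q" by (simp add: mult_ad A c)
  qed
  finally show ?thesis by (simp add: sw3_def)
qed

text \<open>The comultiplication law of \<open>\<lhd>\<close> in terms of \<open>A\<close>. Of the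
  six components \<open>p\<close>, \<open>q\<close>, \<open>z\<close>, \<open>p'\<close>,
  \<open>q'\<close>, \<open>z'\<close> on the left, the products \<open>p' \<cdot> Sb z\<close> of
  the middle ones form a \<open>\<kappa>\<close> that is absorbed by \<open>p\<close> across
  \<open>q\<close>; the remaining four components are those on the right.\<close>

lemma sw3_sw3:
  assumes U: "vec_space U" and g: "trilinear_on A U g" and a: "a \<in> carrier A"
  shows "sw A (\<lambda>u v. sw3 A (\<lambda>p q z. sw3 A (\<lambda>p' q' z'. g (Sb z' \<cdot> p' \<cdot> (Sb z \<cdot> p)) q q') v) u) a =
    sw3 A (\<lambda>p w z. sw A (\<lambda>q q'. g (Sb z \<cdot> p) q q') w) a"
proof -
  note g_lin = lin U trilinear_onD[OF g]
  \<comment> \<open>The last two components stay together in \<open>s\<close>, which gives the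
    three-argument shape required by \<open>\<kappa>_absorb\<close>.\<close>
  let ?K = "\<lambda>p q s. sw A (\<lambda>q' z'. g (Sb z' \<cdot> p) q q') s"
  have "sw A (\<lambda>u v. sw3 A (\<lambda>p q z. sw3 A (\<lambda>p' q' z'. g (Sb z' \<cdot> p' \<cdot> (Sb z \<cdot> p)) q q') v) u) a =
      sw A (\<lambda>u v. sw3 A (\<lambda>p q z. sw A (\<lambda>p' s. ?K (p' \<cdot> (Sb z \<cdot> p)) q s) v) u) a"
  proof (rule sw_cong_A[OF a], rule sw3_cong_A, assumption)
    fix v p q z assume A: "v \<in> carrier A" "p \<in> carrier A" "q \<in> carrier A" "z \<in> carrier A"
    have "sw3 A (\<lambda>p' q' z'. g (Sb z' \<cdot> p' \<cdot> (Sb z \<cdot> p)) q q') v =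
        sw A (\<lambda>p' s. sw A (\<lambda>q' z'. g (Sb z' \<cdot> p' \<cdot> (Sb z \<cdot> p)) q q') s) v"
      unfolding sw3_def by (rule sw_assoc_A[OF U]) (assumption | rule g_lin A)+
    also have "\<dots> = sw A (\<lambda>p' s. ?K (p' \<cdot> (Sb z \<cdot> p)) q s) v"
      by (rule sw_cong_A, rule A, rule sw_cong_A) (simp_all add: A assoc_A)
    finally show "sw3 A (\<lambda>p' q' z'. g (Sb z' \<cdot> p' \<cdot> (Sb z \<cdot> p)) q q') v =
        sw A (\<lambda>p' s. ?K (p' \<cdot> (Sb z \<cdot> p)) q s) v" .
  qed
  also have "\<dots> = sw3 A ?K a"
    by (rule \<kappa>_absorb[OF U _ a, of ?K]) (assumption | rule g_lin)+
  also have "\<dots> = sw A (\<lambda>p r. sw A (\<lambda>q s. ?K p q s) r) a"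
    unfolding sw3_def by (rule sw_assoc_A[OF U]) (assumption | rule g_lin a)+
  also have "\<dots> = sw A (\<lambda>p r. sw A (\<lambda>w z. sw A (\<lambda>q q'. g (Sb z \<cdot> p) q q') w) r) a"
    by (rule sw_cong_A[OF a], rule sw_assoc_A[OF U, symmetric]) (assumption | rule g_lin)+
  also have "\<dots> = sw3 A (\<lambda>p w z. sw A (\<lambda>q q'. g (Sb z \<cdot> p) q q') w) a"
    unfolding sw3_def by (rule sw_assoc_A[OF U, symmetric]) (assumption | rule g_lin a)+
  finally show ?thesis .
qed

subsection \<open>The two actions\<close>

abbreviation left_act (infixr \<open>\<rhd>\<close> 75) where "a \<rhd> x \<equiv> skew_left_action X SX B a x"
abbreviation right_act (infixl \<open>\<lhd>\<close> 75) where "a \<lhd> x \<equiv> skew_right_action A SA B a x"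

lemma bil_left: "bilinear_on A X X (skew_left_action X SX B)"
  unfolding skew_left_action_def by (assumption | rule lin)+

lemma bil_right: "bilinear_on A X A (skew_right_action A SA B)"
  unfolding skew_right_action_def by (assumption | rule lin)+

lemmas [lin] = bilinear_left[OF bil_left] bilinear_right[OF bil_left]
  bilinear_left[OF bil_right] bilinear_right[OF bil_right]
lemmas [simp, lin] = bilinear_carrier[OF bil_left] bilinear_carrier[OF bil_right]

lemma smult_scalars [simp]: "smult scalars = (*)"
  by (simp add: scalars_def)

lemma pair_smult: "x \<in> carrier X \<Longrightarrow> a \<in> carrier A \<Longrightarrow> B (smult X c x) a = c * B x a"
  "x \<in> carrier X \<Longrightarrow> a \<in> carrier A \<Longrightarrow> B x (smult A c a) = c * B x a"
  using linear_onD(3)[OF pair_lin(1)] linear_onD(3)[OF pair_lin(2)] by simp_all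

text \<open>\<open>pair_star\<close> distributes \<open>a\<close> over \<open>p\<close> and
  \<open>SX z\<close>, and \<open>pair_SX\<close> replaces the antipode of \<open>X\<close> by
  \<open>Sb\<close>. The components \<open>p\<close>, \<open>q\<close>, \<open>z\<close> of
  \<open>x\<close> are then paired with \<open>u\<close>, \<open>b\<close>, \<open>Sb v\<close>,
  which the skew rule multiplies in reverse order.\<close>

lemma pair_left:
  assumes a: "a \<in> carrier A" and x: "x \<in> carrier X" and b: "b \<in> carrier A"
  shows "B (a \<rhd> x) b = B x (ad b a)"
proof -
  have "B (a \<rhd> x) b = sw3 X (\<lambda>p q z. B (smult X (B (p \<star> SX z) a) q) b) x"
    unfolding skew_left_action_def
    by (rule linear_on_sw3[OF pair_lin(1)[OF b]]) (assumption | rule lin x)+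
  also have "\<dots> = sw3 X (\<lambda>p q z. sw A (\<lambda>u v. B p u * B z (Sb v) * B q b) a) x"
  proof (rule sw3_cong[OF _ x])
    fix p q z assume X: "p \<in> carrier X" "q \<in> carrier X" "z \<in> carrier X"
    have "B (smult X (B (p \<star> SX z) a) q) b = sw A (\<lambda>u v. B p u * B (SX z) v) a * B q b"
      by (simp add: pair_smult pair_star X a b)
    also have "\<dots> = sw A (\<lambda>u v. B p u * B (SX z) v * B q b) a"
      by (rule linear_on_sw_A[where U = scalars and W = scalars]) (assumption | rule lin a)+
    also have "\<dots> = sw A (\<lambda>u v. B p u * B z (Sb v) * B q b) a"
      by (rule sw_cong_A[OF a]) (simp add: pair_SX X)
    finally show "B (smult X (B (p \<star> SX z) a) q) b = sw A (\<lambda>u v. B p u * B z (Sb v) * B q b) a" .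
  qed simp
  also have "\<dots> = sw A (\<lambda>u v. sw3 X (\<lambda>p q z. B p u * B z (Sb v) * B q b) x) a"
    by (rule sw3_swap)
  also have "\<dots> = sw A (\<lambda>u v. B x (Sb v \<cdot> (b \<cdot> u))) a"
  proof (rule sw_cong_A[OF a])
    fix u v assume A: "u \<in> carrier A" "v \<in> carrier A"
    have "sw3 X (\<lambda>p q z. B p u * B z (Sb v) * B q b) x = sw X (\<lambda>y z. B y (b \<cdot> u) * B z (Sb v)) x"
      unfolding sw3_def
    proof (rule sw_cong_X[OF x])
      fix y z assume y: "y \<in> carrier X" and z: "z \<in> carrier X"
      have "sw X (\<lambda>p q. B p u * B z (Sb v) * B q b) y = sw X (\<lambda>p q. B p u * B q b * B z (Sb v)) y"
        by (simp add: mult_ac)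
      also have "\<dots> = sw X (\<lambda>p q. B p u * B q b) y * B z (Sb v)"
        by (rule linear_on_sw_X[where U = scalars and W = scalars, symmetric]) (assumption | rule lin y)+
      also have "\<dots> = B y (b \<cdot> u) * B z (Sb v)" by (simp add: pair_mult' y A b)
      finally show "sw X (\<lambda>p q. B p u * B z (Sb v) * B q b) y = B y (b \<cdot> u) * B z (Sb v)" .
    qed
    also have "\<dots> = B x (Sb v \<cdot> (b \<cdot> u))" by (rule pair_mult') (simp_all add: x A b)
    finally show "sw3 X (\<lambda>p q z. B p u * B z (Sb v) * B q b) x = B x (Sb v \<cdot> (b \<cdot> u))" .
  qed
  also have "\<dots> = B x (ad b a)"
    unfolding ad_def by (rule linear_on_sw_A[OF pair_lin(2)[OF x], symmetric]) (assumption | rule lin a b)+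
  finally show ?thesis .
qed

text \<open>\<open>a \<lhd> x\<close> is an explicit finite combination of elements of
  \<open>A\<close>, so a linear map can be pulled inside. For \<open>\<lhd>\<close> this often
  replaces testing through the pairing.\<close>

lemma linear_right:
  assumes U: "vec_space U" and g: "linear_on A U g" and a: "a \<in> carrier A" and x: "x \<in> carrier X"
  shows "g (a \<lhd> x) = sw3 A (\<lambda>p q z. smult U (B x (Sb z \<cdot> p)) (g q)) a"
proof -
  have "g (a \<lhd> x) = sw3 A (\<lambda>p q z. g (smult A (B x (Sb z \<cdot> p)) q)) a"
    unfolding skew_right_action_def by (rule linear_on_sw3_A[OF g]) (assumption | rule lin a x)+
  also have "\<dots> = sw3 A (\<lambda>p q z. smult U (B x (Sb z \<cdot> p)) (g q)) a"
    by (rule sw3_cong_A[OF a]) (simp add: linear_onD(3)[OF g])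
  finally show ?thesis .
qed

lemma linear_right_smult:
  assumes U: "vec_space U" and g: "linear_on A U g" and a: "a \<in> carrier A" and x: "x \<in> carrier X"
  shows "smult U c (g (a \<lhd> x)) = sw3 A (\<lambda>p q z. smult U (c * B x (Sb z \<cdot> p)) (g q)) a"
proof -
  interpret vector_space "smult U" using U by (simp add: vec_space_def)
  have "smult U c (g (a \<lhd> x)) = sw3 A (\<lambda>p q z. smult U (B x (Sb z \<cdot> p)) (smult U c (g q))) a"
    by (rule linear_right[OF U _ a x, of "\<lambda>w. smult U c (g w)"]) (rule lin U g)+
  then show ?thesis by (simp add: mult.commute)
qed

lemma pair_sum_smult:
  assumes U: "vec_space U" and w: "w \<in> carrier U" and x: "x \<in> carrier X"
    and s: "s \<in> carrier A" and t: "t \<in> carrier A"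
  shows "sw X (\<lambda>u v. smult U (B u s * B v t) w) x = smult U (B x (t \<cdot> s)) w"
proof -
  have "smult U (sw X (\<lambda>u v. B u s * B v t) x) w = sw X (\<lambda>u v. smult U (B u s * B v t) w) x"
    by (rule linear_on_sw_X[where U = scalars and W = U]) (assumption | rule lin U w x)+
  then show ?thesis by (simp add: pair_mult' x s t)
qed

text \<open>One component of \<open>x\<close> is paired with \<open>t\<close>, the other acts on
  \<open>a\<close> and contributes a pairing with \<open>Sb z \<cdot> p\<close>; the skew rule
  merges the two. Which component acts decides on which side of the product \<open>t\<close> ends
  up.\<close>

lemma sum_pair_right:
  assumes U: "vec_space U" and g: "linear_on A U g" and a: "a \<in> carrier A" and x: "x \<in> carrier X"
    and t: "t \<in> carrier A"
  shows "sw X (\<lambda>x' x''. smult U (B x' t) (g (a \<lhd> x''))) x =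
      sw3 A (\<lambda>p q z. smult U (B x (Sb z \<cdot> p \<cdot> t)) (g q)) a" (is ?A)
    and "sw X (\<lambda>x' x''. smult U (B x'' t) (g (a \<lhd> x'))) x =
      sw3 A (\<lambda>p q z. smult U (B x (t \<cdot> (Sb z \<cdot> p))) (g q)) a" (is ?B)
proof -
  have "sw X (\<lambda>x' x''. smult U (B x' t) (g (a \<lhd> x''))) x =
      sw X (\<lambda>x' x''. sw3 A (\<lambda>p q z. smult U (B x' t * B x'' (Sb z \<cdot> p)) (g q)) a) x"
    by (rule sw_cong_X[OF x], rule linear_right_smult[OF U g a])
  also have "\<dots> = sw3 A (\<lambda>p q z. sw X (\<lambda>x' x''. smult U (B x' t * B x'' (Sb z \<cdot> p)) (g q)) x) a"
    by (rule sw3_swap[symmetric])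
  also have "\<dots> = sw3 A (\<lambda>p q z. smult U (B x (Sb z \<cdot> p \<cdot> t)) (g q)) a"
    by (rule sw3_cong_A[OF a], rule pair_sum_smult[OF U _ x t]) (simp_all add: linear_onD(1)[OF g])
  finally show ?A .
  have "sw X (\<lambda>x' x''. smult U (B x'' t) (g (a \<lhd> x'))) x =
      sw X (\<lambda>x' x''. sw3 A (\<lambda>p q z. smult U (B x'' t * B x' (Sb z \<cdot> p)) (g q)) a) x"
    by (rule sw_cong_X[OF x], rule linear_right_smult[OF U g a])
  also have "\<dots> = sw3 A (\<lambda>p q z. sw X (\<lambda>x' x''. smult U (B x'' t * B x' (Sb z \<cdot> p)) (g q)) x) a"
    by (rule sw3_swap[symmetric])
  also have "\<dots> = sw3 A (\<lambda>p q z. sw X (\<lambda>x' x''. smult U (B x' (Sb z \<cdot> p) * B x'' t) (g q)) x) a"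
    by (simp only: mult.commute)
  also have "\<dots> = sw3 A (\<lambda>p q z. smult U (B x (t \<cdot> (Sb z \<cdot> p))) (g q)) a"
    by (rule sw3_cong_A[OF a], rule pair_sum_smult[OF U _ x _ t]) (simp_all add: linear_onD(1)[OF g])
  finally show ?B .
qed

section \<open>The quasi-matched pair conditions\<close>

lemma ad_unit: "b \<in> carrier A \<Longrightarrow> ad b (unit_elt A) = b"
  unfolding ad_def by (subst sw_unit[OF bialg(2), where U = A]) (assumption | rule lin | simp add: Sb_unit)+

lemma counit_lin: "linear_on A scalars (counit A)" "linear_on X scalars (counit X)"
  by (simp_all add: coalgebraD(3))

lemmas [lin] = linear_on_compose[OF _ counit_lin(1)] linear_on_compose[OF _ counit_lin(2)]

lemma counit_ad:
  assumes a: "a \<in> carrier A" and b: "b \<in> carrier A"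
  shows "counit A (ad b a) = counit A a * counit A b"
proof -
  have "counit A (ad b a) = sw A (\<lambda>u v. counit A (Sb v \<cdot> (b \<cdot> u))) a"
    unfolding ad_def by (rule linear_on_sw_A[OF counit_lin(1)]) (assumption | rule lin a b)+
  also have "\<dots> = sw A (\<lambda>u v. smult scalars (counit A v) (counit A u * counit A b)) a"
    by (rule sw_cong_A[OF a]) (simp add: b bialgebraD(8)[OF bialg(2)] counit_Sb)
  also have "\<dots> = counit A a * counit A b"
    by (rule sw_counit(2)) (assumption | rule lin a)+
  finally show ?thesis .
qed

lemma left_module: "left_module A X (skew_left_action X SX B)"
  unfolding left_module_def
proof (intro conjI ballI)
  fix x assume x: "x \<in> carrier X"
  show "unit_elt A \<rhd> x = x"
    by (rule X_eqI) (simp_all add: x pair_left ad_unit)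
next
  fix a c x assume "a \<in> carrier A" "c \<in> carrier A" "x \<in> carrier X"
  then show "(a \<cdot> c) \<rhd> x = a \<rhd> c \<rhd> x"
    by (intro X_eqI) (simp_all add: pair_left ad_ad)
qed (simp_all add: bil_left)

text \<open>Testing with \<open>c\<close> on the first and \<open>b\<close> on the second tensor
  factor turns the left side into \<open>B x (ad (b \<cdot> c) a)\<close>, since the skew rule
  reverses \<open>c\<close> and \<open>b\<close>; the rest is \<open>ad_mult\<close>.\<close>

lemma comult_left:
  assumes a: "a \<in> carrier A" and x: "x \<in> carrier X"
  shows "comult X (a \<rhd> x) = sw A (\<lambda>u v. sw X (\<lambda>p q. tens X X (u \<rhd> p) (v \<rhd> q)) x) a" (is "?s = ?t")
proof (rule tensor_eqI[of X X "carrier A" "\<lambda>b x. B x b" "carrier A" "\<lambda>b x. B x b"])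
  show "?s \<in> carrier (tensor X X)" by (simp add: coalgebraD(4) a x)
  show "?t \<in> carrier (tensor X X)" by (assumption | rule lin a x)+
  fix c b assume c: "c \<in> carrier A" and b: "b \<in> carrier A"
  let ?f = "\<lambda>p q. B p c * B q b"
  have f: "bilinear_on X X scalars ?f" by (assumption | rule lin b c)+
  have "tsum X X ?f ?s = B x (ad (b \<cdot> c) a)"
    unfolding sw_def[symmetric] by (simp add: pair_mult' pair_left a x b c)
  also have "\<dots> = sw A (\<lambda>u v. B x (ad b v \<cdot> ad c u)) a"
    unfolding ad_mult[OF b c a, symmetric]
    by (rule linear_on_sw_A[OF pair_lin(2)[OF x]]) (assumption | rule lin a b c)+
  also have "\<dots> = sw A (\<lambda>u v. sw X (\<lambda>p q. B (u \<rhd> p) c * B (v \<rhd> q) b) x) a"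
  proof (rule sw_cong_A[OF a])
    fix u v assume u: "u \<in> carrier A" and v: "v \<in> carrier A"
    have "sw X (\<lambda>p q. B (u \<rhd> p) c * B (v \<rhd> q) b) x = sw X (\<lambda>p q. B p (ad c u) * B q (ad b v)) x"
      by (rule sw_cong_X[OF x]) (simp add: pair_left u v b c)
    then show "B x (ad b v \<cdot> ad c u) = sw X (\<lambda>p q. B (u \<rhd> p) c * B (v \<rhd> q) b) x"
      by (simp add: pair_mult' x u v b c)
  qed
  also have "\<dots> = tsum X X ?f ?t"
    by (rule tsum_sw_sw_tens[OF _ vec_space_scalars f, symmetric]) (simp_all add: a x)
  finally show "tsum X X ?f ?s = tsum X X ?f ?t" .
qed (auto intro: pair_lin nondeg)

lemma left_unit:
  assumes a: "a \<in> carrier A"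
  shows "a \<rhd> unit_elt X = smult X (counit A a) (unit_elt X)"
proof (rule X_eqI)
  show "smult X (counit A a) (unit_elt X) \<in> carrier X" by (rule lin)+
qed (simp_all add: a pair_left pair_smult pair_unit counit_ad)

lemma right_unit:
  assumes x: "x \<in> carrier X"
  shows "unit_elt A \<lhd> x = smult A (counit X x) (unit_elt A)"
  unfolding skew_right_action_def
  by (subst sw3_unit[OF bialg(2), where U = A]) (assumption | rule lin x | simp add: x Sb_unit pair_unit)+

lemma right_one:
  assumes a: "a \<in> carrier A"
  shows "a \<lhd> unit_elt X = a"
proof -
  interpret vector_space "smult A" using bialgebraD(2)[OF bialg(2)] by (simp add: vec_space_def)
  have "a \<lhd> unit_elt X = sw3 A (\<lambda>p q z. smult A (counit A p) (smult A (counit A z) q)) a"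
    unfolding skew_right_action_def
    by (rule sw3_cong_A[OF a]) (simp add: pair_unit bialgebraD(8)[OF bialg(2)] counit_Sb mult.commute)
  also have "\<dots> = sw A (\<lambda>u z. smult A (counit A z) u) a"
    unfolding sw3_def by (rule sw_cong_A[OF a], rule sw_counit(1)) (assumption | rule lin)+
  also have "\<dots> = a"
    by (rule sw_counit(2)[of A A _ "\<lambda>u. u"]) (simp_all add: a linear_on_id)
  finally show ?thesis .
qed

text \<open>Splitting \<open>Sb z \<cdot> p\<close> reverses the components of \<open>z\<close> but
  not those of \<open>p\<close>, so the five components \<open>p1\<close>, \<open>p2\<close>,
  \<open>q\<close>, \<open>z1\<close>, \<open>z2\<close> pair up in nested fashion: the outer pair
  meets \<open>x\<close>, the inner one \<open>y\<close>. Hence \<open>p2\<close>, \<open>q\<close>,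
  \<open>z1\<close> can be gathered into one element \<open>Q\<close>, on which \<open>y\<close>
  acts.\<close>

lemma right_right:
  assumes x: "x \<in> carrier X" and y: "y \<in> carrier X" and a: "a \<in> carrier A"
  shows "a \<lhd> (x \<star> y) = a \<lhd> x \<lhd> y"
proof -
  let ?H = "\<lambda>p1 p2 q z1 z2. smult A (B x (Sb z2 \<cdot> p1) * B y (Sb z1 \<cdot> p2)) q"
  have "a \<lhd> (x \<star> y) = sw3 A (\<lambda>p q z. sw A (\<lambda>z1 z2. sw A (\<lambda>p1 p2. ?H p1 p2 q z1 z2) p) z) a"
    unfolding skew_right_action_def
  proof (rule sw3_cong_A[OF a])
    fix p q z assume A: "p \<in> carrier A" "q \<in> carrier A" "z \<in> carrier A"
    let ?f = "\<lambda>s t. smult A (B x s * B y t) q"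
    have f: "bilinear_on A A A ?f" by (assumption | rule lin A x y)+
    have "smult A (B (x \<star> y) (Sb z \<cdot> p)) q = smult A (sw A (\<lambda>s t. B x s * B y t) (Sb z \<cdot> p)) q"
      by (simp add: pair_star A x y)
    also have "\<dots> = sw A ?f (Sb z \<cdot> p)"
      by (rule linear_on_sw_A[where U = scalars and W = A]) (assumption | rule lin A)+
    also have "\<dots> = sw A (\<lambda>s1 s2. sw A (\<lambda>p1 p2. ?f (s1 \<cdot> p1) (s2 \<cdot> p2)) p) (Sb z)"
      by (rule sw_mult[OF bialg(2) _ f]) (simp_all add: A)
    also have "\<dots> = sw A (\<lambda>z1 z2. sw A (\<lambda>p1 p2. ?H p1 p2 q z1 z2) p) z"
      by (rule sw_Sb) (assumption | rule lin A x y)+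
    finally show "smult A (B (x \<star> y) (Sb z \<cdot> p)) q =
        sw A (\<lambda>z1 z2. sw A (\<lambda>p1 p2. ?H p1 p2 q z1 z2) p) z" .
  qed
  also have "\<dots> = sw A (\<lambda>u z. sw A (\<lambda>z1 z2. sw A (\<lambda>p q. sw A (\<lambda>p1 p2. ?H p1 p2 q z1 z2) p) u) z) a"
    unfolding sw3_def by (rule sw_cong_A[OF a], rule sw_swap)
  also have "\<dots> = sw A (\<lambda>t z2. sw A (\<lambda>u z1. sw A (\<lambda>p q. sw A (\<lambda>p1 p2. ?H p1 p2 q z1 z2) p) u) t) a"
    by (rule sw_assoc_A[where U = A, symmetric]) (assumption | rule lin a x y)+
  also have "\<dots> = sw A (\<lambda>t z2. sw A (\<lambda>u z1. sw A (\<lambda>p1 s. sw A (\<lambda>p2 q. ?H p1 p2 q z1 z2) s) u) t) a"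
    by (rule sw_cong_A[OF a], rule sw_cong_A, assumption, rule sw_assoc_A[where U = A])
      (assumption | rule lin x y)+
  also have "\<dots> = sw A (\<lambda>t z2. sw A (\<lambda>p1 Q. sw A (\<lambda>s z1. sw A (\<lambda>p2 q. ?H p1 p2 q z1 z2) s) Q) t) a"
    by (rule sw_cong_A[OF a], rule sw_assoc_A[where U = A]) (assumption | rule lin x y)+
  also have "\<dots> = sw3 A (\<lambda>p Q z. smult A (B x (Sb z \<cdot> p)) (Q \<lhd> y)) a"
    unfolding sw3_def[of A "\<lambda>p Q z. smult A (B x (Sb z \<cdot> p)) (Q \<lhd> y)"]
  proof (rule sw_cong_A[OF a], rule sw_cong_A, assumption)
    fix t z2 p1 Q assume A: "z2 \<in> carrier A" "p1 \<in> carrier A" "Q \<in> carrier A"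
    have "smult A (B x (Sb z2 \<cdot> p1)) (Q \<lhd> y) = sw3 A (\<lambda>p2 q z1. ?H p1 p2 q z1 z2) Q"
      by (rule linear_right_smult[of A "\<lambda>u. u"]) (simp_all add: A y linear_on_id)
    then show "sw A (\<lambda>s z1. sw A (\<lambda>p2 q. ?H p1 p2 q z1 z2) s) Q = smult A (B x (Sb z2 \<cdot> p1)) (Q \<lhd> y)"
      by (simp add: sw3_def)
  qed
  also have "\<dots> = a \<lhd> x \<lhd> y"
    by (rule linear_right[symmetric]) (assumption | rule lin x y a)+
  finally show ?thesis .
qed

lemma right_module: "right_module X A (skew_right_action A SA B)"
  unfolding right_module_def using bil_right right_one right_right by simp

lemma comult_right:
  assumes a: "a \<in> carrier A" and x: "x \<in> carrier X"
  shows "comult A (a \<lhd> x) = sw A (\<lambda>u v. sw X (\<lambda>p q. tens A A (u \<lhd> p) (v \<lhd> q)) x) a"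
proof -
  let ?T = "tensor A A"
  let ?g = "\<lambda>s q q'. smult ?T (B x s) (tens A A q q')"
  have g: "trilinear_on A ?T ?g" by (assumption | rule lin x)+
  have com: "linear_on A ?T (comult A)" by (simp add: coalgebraD(2))
  have "comult A (a \<lhd> x) = sw3 A (\<lambda>p w z. smult ?T (B x (Sb z \<cdot> p)) (comult A w)) a"
    by (rule linear_right[OF vec_space_tensor com a x])
  also have "\<dots> = sw3 A (\<lambda>p w z. sw A (\<lambda>q q'. ?g (Sb z \<cdot> p) q q') w) a"
  proof (rule sw3_cong_A[OF a])
    fix p w z assume A: "w \<in> carrier A"
    have "comult A w = sw A (tens A A) w"
      unfolding sw_def by (rule tsum_tens_self[symmetric]) (simp_all add: A coalgebraD(4))
    then show "smult ?T (B x (Sb z \<cdot> p)) (comult A w) = sw A (\<lambda>q q'. ?g (Sb z \<cdot> p) q q') w"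
      by (simp only:) (rule linear_on_sw_A[where U = ?T and W = ?T], (assumption | rule lin A)+)
  qed
  also have "\<dots> = sw A (\<lambda>u v. sw3 A (\<lambda>p q z. sw3 A (\<lambda>p' q' z'. ?g (Sb z' \<cdot> p' \<cdot> (Sb z \<cdot> p)) q q') v) u) a"
    by (rule sw3_sw3[OF vec_space_tensor g a, symmetric])
  also have "\<dots> = sw A (\<lambda>u v. sw X (\<lambda>p q. tens A A (u \<lhd> p) (v \<lhd> q)) x) a"
  proof (rule sw_cong_A[OF a])
    fix u v assume u: "u \<in> carrier A" and v: "v \<in> carrier A"
    have "sw X (\<lambda>h h'. tens A A (u \<lhd> h) (v \<lhd> h')) x =
        sw X (\<lambda>h h'. sw3 A (\<lambda>p q z. smult ?T (B h (Sb z \<cdot> p)) (tens A A q (v \<lhd> h'))) u) x"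
      by (rule sw_cong_X[OF x], rule linear_right) (assumption | rule lin u v)+
    also have "\<dots> = sw3 A (\<lambda>p q z. sw X (\<lambda>h h'. smult ?T (B h (Sb z \<cdot> p)) (tens A A q (v \<lhd> h'))) x) u"
      by (rule sw3_swap[symmetric])
    also have "\<dots> = sw3 A (\<lambda>p q z. sw3 A (\<lambda>p' q' z'. ?g (Sb z' \<cdot> p' \<cdot> (Sb z \<cdot> p)) q q') v) u"
      by (rule sw3_cong_A[OF u], rule sum_pair_right(1)) (assumption | rule lin v x)+
    finally show "sw3 A (\<lambda>p q z. sw3 A (\<lambda>p' q' z'. ?g (Sb z' \<cdot> p' \<cdot> (Sb z \<cdot> p)) q q') v) u =
        sw X (\<lambda>h h'. tens A A (u \<lhd> h) (v \<lhd> h')) x" by simp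
  qed
  finally show ?thesis .
qed

text \<open>Since \<open>Sb\<close> reverses products, the coefficient is
  \<open>B x (Sb z' \<cdot> (Sb z \<cdot> p \<cdot> p'))\<close>. For
  \<open>c = Sb z \<cdot> p\<close> it is the right side of \<open>sw3_ad_right\<close>; reading
  that lemma backwards produces \<open>ad (Sb z \<cdot> p) u\<close>, which is the pairing of
  \<open>Sb z \<cdot> p\<close> with an element acted on by \<open>u\<close>.\<close>

lemma right_mult:
  assumes a: "a \<in> carrier A" and b: "b \<in> carrier A" and x: "x \<in> carrier X"
  shows "(a \<cdot> b) \<lhd> x = sw A (\<lambda>u v. sw X (\<lambda>p q. (a \<lhd> (u \<rhd> p)) \<cdot> (v \<lhd> q)) x) b"
proof -
  let ?f = "\<lambda>q P Q. smult A (B x P) (q \<cdot> Q)"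
  have "(a \<cdot> b) \<lhd> x = sw3 A (\<lambda>p q z. sw3 A (\<lambda>p' q' z'.
      smult A (B x (Sb (z \<cdot> z') \<cdot> (p \<cdot> p'))) (q \<cdot> q')) b) a"
    unfolding skew_right_action_def
    by (rule sw3_mult[OF bialg(2), where U = A]) (assumption | rule lin a b x)+
  also have "\<dots> = sw3 A (\<lambda>p q z. sw3 A (\<lambda>p' q' z'. ?f q (Sb z' \<cdot> (Sb z \<cdot> p \<cdot> p')) q') b) a"
    by (rule sw3_cong_A[OF a], rule sw3_cong_A[OF b]) (simp add: Sb_mult assoc_A)
  also have "\<dots> = sw3 A (\<lambda>p q z. sw A (\<lambda>u v. sw3 A (\<lambda>p' q' z'.
      ?f q (Sb z' \<cdot> p' \<cdot> ad (Sb z \<cdot> p) u) q') v) b) a"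
    by (rule sw3_cong_A[OF a], rule sw3_ad_right[symmetric, where U = A and c = "Sb z \<cdot> p" for z p])
      (assumption | rule lin b x)+
  also have "\<dots> = sw A (\<lambda>u v. sw3 A (\<lambda>p q z. sw3 A (\<lambda>p' q' z'.
      ?f q (Sb z' \<cdot> p' \<cdot> ad (Sb z \<cdot> p) u) q') v) a) b"
    by (rule sw3_swap)
  also have "\<dots> = sw A (\<lambda>u v. sw X (\<lambda>p q. (a \<lhd> (u \<rhd> p)) \<cdot> (v \<lhd> q)) x) b"
  proof (rule sw_cong_A[OF b])
    fix u v assume u: "u \<in> carrier A" and v: "v \<in> carrier A"
    have "sw X (\<lambda>h h'. (a \<lhd> (u \<rhd> h)) \<cdot> (v \<lhd> h')) x =
        sw X (\<lambda>h h'. sw3 A (\<lambda>p q z. smult A (B h (ad (Sb z \<cdot> p) u)) (q \<cdot> (v \<lhd> h'))) a) x"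
    proof (rule sw_cong_X[OF x])
      fix h h' assume h: "h \<in> carrier X" "h' \<in> carrier X"
      have "(a \<lhd> (u \<rhd> h)) \<cdot> (v \<lhd> h') =
          sw3 A (\<lambda>p q z. smult A (B (u \<rhd> h) (Sb z \<cdot> p)) (q \<cdot> (v \<lhd> h'))) a"
        by (rule linear_right) (assumption | rule lin a u v h)+
      also have "\<dots> = sw3 A (\<lambda>p q z. smult A (B h (ad (Sb z \<cdot> p) u)) (q \<cdot> (v \<lhd> h'))) a"
        by (rule sw3_cong_A[OF a]) (simp add: pair_left u h)
      finally show "(a \<lhd> (u \<rhd> h)) \<cdot> (v \<lhd> h') =
          sw3 A (\<lambda>p q z. smult A (B h (ad (Sb z \<cdot> p) u)) (q \<cdot> (v \<lhd> h'))) a" .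
    qed
    also have "\<dots> = sw3 A (\<lambda>p q z. sw X (\<lambda>h h'. smult A (B h (ad (Sb z \<cdot> p) u)) (q \<cdot> (v \<lhd> h'))) x) a"
      by (rule sw3_swap[symmetric])
    also have "\<dots> = sw3 A (\<lambda>p q z. sw3 A (\<lambda>p' q' z'. ?f q (Sb z' \<cdot> p' \<cdot> ad (Sb z \<cdot> p) u) q') v) a"
      by (rule sw3_cong_A[OF a], rule sum_pair_right(1)) (assumption | rule lin u v x)+
    finally show "sw3 A (\<lambda>p q z. sw3 A (\<lambda>p' q' z'. ?f q (Sb z' \<cdot> p' \<cdot> ad (Sb z \<cdot> p) u) q') v) a =
        sw X (\<lambda>h h'. (a \<lhd> (u \<rhd> h)) \<cdot> (v \<lhd> h')) x" by simp
  qed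
  finally show ?thesis .
qed

lemma matched_swap:
  assumes a: "a \<in> carrier A" and x: "x \<in> carrier X"
  shows "sw A (\<lambda>u v. sw X (\<lambda>p q. tens A X (u \<lhd> p) (v \<rhd> q)) x) a =
    sw A (\<lambda>u v. sw X (\<lambda>p q. tens A X (v \<lhd> q) (u \<rhd> p)) x) a" (is "?s = ?t")
proof (rule tensor_eqI[of A X "carrier X" B "carrier A" "\<lambda>b x. B x b"])
  show "?s \<in> carrier (tensor A X)" "?t \<in> carrier (tensor A X)"
    by (assumption | rule lin a x)+
  fix y b assume y: "y \<in> carrier X" and b: "b \<in> carrier A"
  let ?f = "\<lambda>p q. B y p * B q b"
  let ?g = "\<lambda>P q. B x P * B y q"
  have f: "bilinear_on A X scalars ?f" by (assumption | rule lin b y)+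
  have g: "bilinear_on A A scalars ?g" by (assumption | rule lin x y)+
  have "tsum A X ?f ?s = sw A (\<lambda>u v. sw X (\<lambda>p q. B y (u \<lhd> p) * B (v \<rhd> q) b) x) a"
    by (rule tsum_sw_sw_tens[OF _ vec_space_scalars f]) (simp_all add: a x)
  also have "\<dots> = sw A (\<lambda>u v. sw3 A (\<lambda>p q z. ?g (ad b v \<cdot> (Sb z \<cdot> p)) q) u) a"
  proof (rule sw_cong_A[OF a])
    fix u v assume u: "u \<in> carrier A" and v: "v \<in> carrier A"
    have "sw X (\<lambda>p q. B y (u \<lhd> p) * B (v \<rhd> q) b) x =
        sw X (\<lambda>p q. smult scalars (B q (ad b v)) (B y (u \<lhd> p))) x"
      by (rule sw_cong_X[OF x]) (simp add: pair_left u v b)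
    also have "\<dots> = sw3 A (\<lambda>p q z. smult scalars (B x (ad b v \<cdot> (Sb z \<cdot> p))) (B y q)) u"
      by (rule sum_pair_right(2)) (assumption | rule lin u v b x y)+
    finally show "sw X (\<lambda>p q. B y (u \<lhd> p) * B (v \<rhd> q) b) x =
        sw3 A (\<lambda>p q z. ?g (ad b v \<cdot> (Sb z \<cdot> p)) q) u" by simp
  qed
  also have "\<dots> = sw3 A (\<lambda>p q z. ?g (Sb z \<cdot> (b \<cdot> p)) q) a"
    by (rule sw3_ad_left[OF vec_space_scalars g a b])
  also have "\<dots> = sw A (\<lambda>u v. sw3 A (\<lambda>p q z. ?g (Sb z \<cdot> p \<cdot> ad b u) q) v) a"
    by (rule sw3_ad_right[OF vec_space_scalars g a b, symmetric])
  also have "\<dots> = sw A (\<lambda>u v. sw X (\<lambda>p q. B y (v \<lhd> q) * B (u \<rhd> p) b) x) a"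
  proof (rule sw_cong_A[OF a])
    fix u v assume u: "u \<in> carrier A" and v: "v \<in> carrier A"
    have "sw X (\<lambda>p q. B y (v \<lhd> q) * B (u \<rhd> p) b) x =
        sw X (\<lambda>p q. smult scalars (B p (ad b u)) (B y (v \<lhd> q))) x"
      by (rule sw_cong_X[OF x]) (simp add: pair_left u v b)
    also have "\<dots> = sw3 A (\<lambda>p q z. smult scalars (B x (Sb z \<cdot> p \<cdot> ad b u)) (B y q)) v"
      by (rule sum_pair_right(1)) (assumption | rule lin u v b x y)+
    finally show "sw3 A (\<lambda>p q z. ?g (Sb z \<cdot> p \<cdot> ad b u) q) v =
        sw X (\<lambda>p q. B y (v \<lhd> q) * B (u \<rhd> p) b) x" by simp
  qed
  also have "\<dots> = tsum A X ?f ?t"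
    by (rule tsum_sw_sw_tens[OF _ vec_space_scalars f, symmetric]) (simp_all add: a x)
  finally show "tsum A X ?f ?s = tsum A X ?f ?t" .
qed (auto intro: pair_lin nondeg)

text \<open>Testing with \<open>b\<close> evaluates \<open>x\<close> and \<open>y\<close> on the
  coproduct of \<open>ad b a\<close>. In the Sweedler order \<open>u1\<close>, \<open>u2\<close>,
  \<open>v1\<close>, \<open>v2\<close> the inner pair belongs to \<open>y\<close> and forms
  \<open>ad b2 q\<close>, the outer pair belongs to \<open>x\<close>. Reading
  \<open>sw3_ad_right\<close> backwards then splits the factor at \<open>x\<close> into one with
  \<open>ad b1 u\<close>, which is the action \<open>u \<rhd> p\<close>, and one with
  \<open>Sb z \<cdot> p\<close>, which is the coefficient of \<open>v \<lhd> q\<close>.\<close>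

lemma left_star:
  assumes a: "a \<in> carrier A" and x: "x \<in> carrier X" and y: "y \<in> carrier X"
  shows "a \<rhd> (x \<star> y) = sw A (\<lambda>u v. sw X (\<lambda>p q. (u \<rhd> p) \<star> ((v \<lhd> q) \<rhd> y)) x) a" (is "?s = ?t")
proof (rule X_eqI)
  show "?s \<in> carrier X" "?t \<in> carrier X" by (assumption | rule lin a x y)+
  fix b assume b: "b \<in> carrier A"
  let ?f = "\<lambda>s t. B x s * B y t"
  have f: "bilinear_on A A scalars ?f" by (assumption | rule lin x y)+
  let ?h = "\<lambda>b1 b2 u1 u2 v1 v2. ?f (Sb v2 \<cdot> (b1 \<cdot> u1)) (Sb v1 \<cdot> (b2 \<cdot> u2))"
  let ?R = "sw A (\<lambda>b1 b2. sw A (\<lambda>u v. sw A (\<lambda>v1 v2. sw A (\<lambda>u1 u2. ?h b1 b2 u1 u2 v1 v2) u) v) a) b"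
  have "B ?s b = sw A ?f (ad b a)" by (simp add: pair_left pair_star a b x y)
  also have "\<dots> = sw A (\<lambda>u v. sw A ?f (Sb v \<cdot> (b \<cdot> u))) a"
    unfolding ad_def by (rule linear_on_sw_A[where U = A and W = scalars]) (assumption | rule lin f a b)+
  also have "\<dots> = sw A (\<lambda>u v. sw A (\<lambda>b1 b2. sw A (\<lambda>v1 v2. sw A (\<lambda>u1 u2. ?h b1 b2 u1 u2 v1 v2) u) v) b) a"
  proof (rule sw_cong_A[OF a])
    fix u v assume u: "u \<in> carrier A" and v: "v \<in> carrier A"
    have "sw A ?f (Sb v \<cdot> (b \<cdot> u)) = sw A (\<lambda>s t. sw A (\<lambda>w w'. ?f (s \<cdot> w) (t \<cdot> w')) (b \<cdot> u)) (Sb v)"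
      by (rule sw_mult[OF bialg(2) vec_space_scalars f]) (simp_all add: u v b)
    also have "\<dots> = sw A (\<lambda>v1 v2. sw A (\<lambda>w w'. ?f (Sb v2 \<cdot> w) (Sb v1 \<cdot> w')) (b \<cdot> u)) v"
      by (rule sw_Sb[where U = scalars]) (assumption | rule lin u v b x y)+
    also have "\<dots> = sw A (\<lambda>v1 v2. sw A (\<lambda>b1 b2. sw A (\<lambda>u1 u2. ?h b1 b2 u1 u2 v1 v2) u) b) v"
      by (rule sw_cong_A[OF v], rule sw_mult[OF bialg(2) vec_space_scalars])
        (assumption | rule lin u b x y)+
    also have "\<dots> = sw A (\<lambda>b1 b2. sw A (\<lambda>v1 v2. sw A (\<lambda>u1 u2. ?h b1 b2 u1 u2 v1 v2) u) v) b"
      by (rule sw_swap)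
    finally show "sw A ?f (Sb v \<cdot> (b \<cdot> u)) =
        sw A (\<lambda>b1 b2. sw A (\<lambda>v1 v2. sw A (\<lambda>u1 u2. ?h b1 b2 u1 u2 v1 v2) u) v) b" .
  qed
  also have "\<dots> = ?R" by (rule sw_swap)
  also have "\<dots> = sw A (\<lambda>b1 b2. sw3 A (\<lambda>p q z. B x (Sb z \<cdot> (b1 \<cdot> p)) * B y (ad b2 q)) a) b"
  proof (rule sw_cong_A[OF b])
    fix b1 b2 assume b12: "b1 \<in> carrier A" "b2 \<in> carrier A"
    let ?k = "?h b1 b2"
    have "sw A (\<lambda>u v. sw A (\<lambda>v1 v2. sw A (\<lambda>u1 u2. ?k u1 u2 v1 v2) u) v) a =
        sw A (\<lambda>t v2. sw A (\<lambda>u v1. sw A (\<lambda>u1 u2. ?k u1 u2 v1 v2) u) t) a"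
      by (rule sw_assoc_A[OF vec_space_scalars, symmetric]) (assumption | rule lin a b12 x y)+
    also have "\<dots> = sw A (\<lambda>t v2. sw A (\<lambda>u1 q. sw A (\<lambda>u2 v1. ?k u1 u2 v1 v2) q) t) a"
      by (rule sw_cong_A[OF a], rule sw_assoc_A[OF vec_space_scalars]) (assumption | rule lin b12 x y)+
    also have "\<dots> = sw A (\<lambda>t v2. sw A (\<lambda>u1 q. B x (Sb v2 \<cdot> (b1 \<cdot> u1)) * B y (ad b2 q)) t) a"
      unfolding ad_def
      by (rule sw_cong_A[OF a], rule sw_cong_A, assumption,
          rule linear_on_sw_A[where U = A and W = scalars, symmetric,
            of "\<lambda>w. B x (Sb v2 \<cdot> (b1 \<cdot> u1)) * B y w" for v2 u1])
        (assumption | rule lin b12 x y)+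
    finally show "sw A (\<lambda>u v. sw A (\<lambda>v1 v2. sw A (\<lambda>u1 u2. ?k u1 u2 v1 v2) u) v) a =
        sw3 A (\<lambda>p q z. B x (Sb z \<cdot> (b1 \<cdot> p)) * B y (ad b2 q)) a" by (simp add: sw3_def)
  qed
  also have "\<dots> = sw A (\<lambda>b1 b2. sw A (\<lambda>u v. sw3 A (\<lambda>p q z. B x (Sb z \<cdot> p \<cdot> ad b1 u) * B y (ad b2 q)) v) a) b"
    by (rule sw_cong_A[OF b], rule sw3_ad_right[OF vec_space_scalars, symmetric, of "\<lambda>P q. B x P * B y (ad b2 q)" for b2])
      (assumption | rule lin a x y)+
  also have "\<dots> = sw A (\<lambda>b1 b2. sw A (\<lambda>u v. sw X (\<lambda>p q. B (u \<rhd> p) b1 * B ((v \<lhd> q) \<rhd> y) b2) x) a) b"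
  proof (rule sw_cong_A[OF b], rule sw_cong_A[OF a])
    fix b1 b2 u v assume A: "b1 \<in> carrier A" "b2 \<in> carrier A" "u \<in> carrier A" "v \<in> carrier A"
    have "sw X (\<lambda>p q. B (u \<rhd> p) b1 * B ((v \<lhd> q) \<rhd> y) b2) x =
        sw X (\<lambda>p q. smult scalars (B p (ad b1 u)) (B y (ad b2 (v \<lhd> q)))) x"
      by (rule sw_cong_X[OF x]) (simp add: pair_left A y)
    also have "\<dots> = sw3 A (\<lambda>p q z. smult scalars (B x (Sb z \<cdot> p \<cdot> ad b1 u)) (B y (ad b2 q))) v"
      by (rule sum_pair_right(1)) (assumption | rule lin A x y)+
    finally show "sw3 A (\<lambda>p q z. B x (Sb z \<cdot> p \<cdot> ad b1 u) * B y (ad b2 q)) v =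
        sw X (\<lambda>p q. B (u \<rhd> p) b1 * B ((v \<lhd> q) \<rhd> y) b2) x" by simp
  qed
  also have "\<dots> = sw A (\<lambda>u v. sw A (\<lambda>b1 b2. sw X (\<lambda>p q. B (u \<rhd> p) b1 * B ((v \<lhd> q) \<rhd> y) b2) x) b) a"
    by (rule sw_swap)
  also have "\<dots> = sw A (\<lambda>u v. B (sw X (\<lambda>p q. (u \<rhd> p) \<star> ((v \<lhd> q) \<rhd> y)) x) b) a"
  proof (rule sw_cong_A[OF a])
    fix u v assume A: "u \<in> carrier A" "v \<in> carrier A"
    have "B (sw X (\<lambda>p q. (u \<rhd> p) \<star> ((v \<lhd> q) \<rhd> y)) x) b =
        sw X (\<lambda>p q. B ((u \<rhd> p) \<star> ((v \<lhd> q) \<rhd> y)) b) x"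
      by (rule linear_on_sw_X[OF pair_lin(1)[OF b]]) (assumption | rule lin A x y)+
    also have "\<dots> = sw X (\<lambda>p q. sw A (\<lambda>b1 b2. B (u \<rhd> p) b1 * B ((v \<lhd> q) \<rhd> y) b2) b) x"
      by (rule sw_cong_X[OF x]) (simp add: pair_star A b y)
    also have "\<dots> = sw A (\<lambda>b1 b2. sw X (\<lambda>p q. B (u \<rhd> p) b1 * B ((v \<lhd> q) \<rhd> y) b2) x) b"
      by (rule sw_swap)
    finally show "sw A (\<lambda>b1 b2. sw X (\<lambda>p q. B (u \<rhd> p) b1 * B ((v \<lhd> q) \<rhd> y) b2) x) b =
        B (sw X (\<lambda>p q. (u \<rhd> p) \<star> ((v \<lhd> q) \<rhd> y)) x) b" by simp
  qed
  also have "\<dots> = B ?t b"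
    by (rule linear_on_sw_A[OF pair_lin(1)[OF b], symmetric]) (assumption | rule lin a x y)+
  finally show "B ?s b = B ?t b" .
qed

lemma quasi_matched:
  "quasi_matched_pair X A (skew_left_action X SX B) (skew_right_action A SA B)"
  unfolding quasi_matched_pair_def left_quasi_module_coalgebra_def right_quasi_module_coalgebra_def
  using bialg left_module right_module
  by (simp add: comult_left comult_right left_star left_unit right_mult right_unit matched_swap)

end

section \<open>The quasi-bicrossed product\<close>

locale matched_pair =
  fixes X :: "('k::field, 'x::ab_group_add) bialg" and A :: "('k, 'a::ab_group_add) bialg"
    and l :: "'a \<Rightarrow> 'x \<Rightarrow> 'x" and r :: "'a \<Rightarrow> 'x \<Rightarrow> 'a"
  assumes matched: "quasi_matched_pair X A l r"
begin

abbreviation mult_A (infixl \<open>\<cdot>\<close> 70) where "a \<cdot> b \<equiv> mult A a b"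
abbreviation mult_X (infixl \<open>\<star>\<close> 70) where "x \<star> y \<equiv> mult X x y"
abbreviation "Q \<equiv> quasi_bicrossed_product X A l r"
abbreviation "T \<equiv> tensor X A"
abbreviation tensor_elt (infix \<open>\<otimes>\<close> 65) where "x \<otimes> a \<equiv> tens X A x a"

section \<open>The matched pair axioms as identities of joint Sweedler sums\<close>

lemma bialg: "bialgebra X" "bialgebra A"
  using matched by (simp_all add: quasi_matched_pair_def)

lemmas [simp, lin] = bialgebraD(1,2,4)[OF bialg(1)] bialgebraD(1,2,4)[OF bialg(2)]
lemmas [simp] = bialgebraD(6,7)[OF bialg(1)] bialgebraD(6,7)[OF bialg(2)]

lemmas coalg_X = bialgebraD(1)[OF bialg(1)]
lemmas coalg_A = bialgebraD(1)[OF bialg(2)]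
lemmas assoc_A = bialgebraD(5)[OF bialg(2)]
lemmas assoc_X = bialgebraD(5)[OF bialg(1)]
lemmas bil_A [lin] = bialgebraD(3)[OF bialg(2)]
lemmas bil_X [lin] = bialgebraD(3)[OF bialg(1)]

lemma bil_l [lin]: "bilinear_on A X X l" and bil_r [lin]: "bilinear_on A X A r"
  using matched
  by (auto simp: quasi_matched_pair_def left_quasi_module_coalgebra_def left_module_def
      right_quasi_module_coalgebra_def right_module_def)

lemmas [lin] = bilinear_left[OF bil_A] bilinear_right[OF bil_A]
  bilinear_left[OF bil_X] bilinear_right[OF bil_X] bilinear_left[OF bil_l] bilinear_right[OF bil_l]
  bilinear_left[OF bil_r] bilinear_right[OF bil_r]
lemmas [simp, lin] = bilinear_carrier[OF bil_A] bilinear_carrier[OF bil_X]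
  bilinear_carrier[OF bil_l] bilinear_carrier[OF bil_r]

abbreviation "S \<equiv> dsw A X"

lemmas S_assoc = dsw_assoc[of A X, OF coalg_A coalg_X]
lemmas S_cong = dsw_cong[of A X, OF coalg_A coalg_X]
lemmas linear_on_S = linear_on_dsw[where C = A and D = X, OF _ coalg_A coalg_X]

lemma l_unit: "x \<in> carrier X \<Longrightarrow> l (unit_elt A) x = x"
  and l_mult: "a \<in> carrier A \<Longrightarrow> b \<in> carrier A \<Longrightarrow> x \<in> carrier X \<Longrightarrow> l (a \<cdot> b) x = l a (l b x)"
  and r_unit: "a \<in> carrier A \<Longrightarrow> r a (unit_elt X) = a"
  and r_mult: "a \<in> carrier A \<Longrightarrow> x \<in> carrier X \<Longrightarrow> y \<in> carrier X \<Longrightarrow> r a (x \<star> y) = r (r a x) y"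
  and l_one: "a \<in> carrier A \<Longrightarrow> l a (unit_elt X) = smult X (counit A a) (unit_elt X)"
  and r_one: "x \<in> carrier X \<Longrightarrow> r (unit_elt A) x = smult A (counit X x) (unit_elt A)"
  using matched
  by (auto simp: quasi_matched_pair_def left_quasi_module_coalgebra_def left_module_def
      right_quasi_module_coalgebra_def right_module_def)

lemma l_star: "a \<in> carrier A \<Longrightarrow> x \<in> carrier X \<Longrightarrow> y \<in> carrier X \<Longrightarrow>
    l a (x \<star> y) = S (\<lambda>u p v q. l u p \<star> l (r v q) y) a x"
  and r_cdot: "a \<in> carrier A \<Longrightarrow> b \<in> carrier A \<Longrightarrow> x \<in> carrier X \<Longrightarrow>
    r (a \<cdot> b) x = S (\<lambda>u p v q. r a (l u p) \<cdot> r v q) b x"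
  and tens_swap: "a \<in> carrier A \<Longrightarrow> x \<in> carrier X \<Longrightarrow>
    S (\<lambda>u p v q. tens A X (r u p) (l v q)) a x = S (\<lambda>u p v q. tens A X (r v q) (l u p)) a x"
  and comult_l: "a \<in> carrier A \<Longrightarrow> x \<in> carrier X \<Longrightarrow>
    comult X (l a x) = sw A (\<lambda>u v. sw X (\<lambda>p q. tens X X (l u p) (l v q)) x) a"
  and comult_r: "a \<in> carrier A \<Longrightarrow> x \<in> carrier X \<Longrightarrow>
    comult A (r a x) = sw A (\<lambda>u v. sw X (\<lambda>p q. tens A A (r u p) (r v q)) x) a"
  using matched
  by (simp_all add: quasi_matched_pair_def left_quasi_module_coalgebra_def
      right_quasi_module_coalgebra_def dsw_def)

lemma sw_l:
  assumes U: "vec_space U" and f: "bilinear_on X X U f" and a: "a \<in> carrier A" and x: "x \<in> carrier X"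
  shows "sw X f (l a x) = S (\<lambda>u p v q. f (l u p) (l v q)) a x"
  unfolding sw_def[of X f "l a x"] comult_l[OF a x] dsw_def
  by (rule tsum_sw_sw_tens[OF _ U f]) (simp_all add: a x)

lemma sw_r:
  assumes U: "vec_space U" and f: "bilinear_on A A U f" and a: "a \<in> carrier A" and x: "x \<in> carrier X"
  shows "sw A f (r a x) = S (\<lambda>u p v q. f (r u p) (r v q)) a x"
  unfolding sw_def[of A f "r a x"] comult_r[OF a x] dsw_def
  by (rule tsum_sw_sw_tens[OF _ U f]) (simp_all add: a x)

lemma S_swap_rl:
  assumes U: "vec_space U" and f: "bilinear_on A X U f" and a: "a \<in> carrier A" and x: "x \<in> carrier X"
  shows "S (\<lambda>u p v q. f (r u p) (l v q)) a x = S (\<lambda>u p v q. f (r v q) (l u p)) a x"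
proof -
  have "S (\<lambda>u p v q. f (r u p) (l v q)) a x = tsum A X f (S (\<lambda>u p v q. tens A X (r u p) (l v q)) a x)"
    unfolding dsw_def by (rule tsum_sw_sw_tens[OF _ U f, symmetric]) (simp_all add: a x)
  also have "\<dots> = S (\<lambda>u p v q. f (r v q) (l u p)) a x"
    unfolding tens_swap[OF a x] unfolding dsw_def
    by (rule tsum_sw_sw_tens[OF _ U f]) (simp_all add: a x)
  finally show ?thesis .
qed

text \<open>A product in \<open>Q\<close> has factors of the forms \<open>r a x \<cdot> b\<close> in
  \<open>A\<close> and \<open>y \<star> l b z\<close> in \<open>X\<close>. A further product or
  coproduct takes Sweedler sums over these, which are resolved by this lemma and by
  \<open>S_mult_left\<close>.\<close>

lemma S_right_mult:
  assumes U: "vec_space U"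
    and F1: "\<And>p q. p \<in> carrier X \<Longrightarrow> q \<in> carrier X \<Longrightarrow> bilinear_on A A U (\<lambda>u v. F u p v q)"
    and a: "a \<in> carrier A" and x: "x \<in> carrier X" and b: "b \<in> carrier A" and z: "z \<in> carrier X"
  shows "S F (r a x \<cdot> b) z = S (\<lambda>u p v q. S (\<lambda>u' p' v' q'. F (r u p \<cdot> u') p' (r v q \<cdot> v') q') b z) a x"
proof -
  note F_lin = lin U bilinearD[OF F1]
  have "S F (r a x \<cdot> b) z =
      sw A (\<lambda>u v. sw A (\<lambda>u' v'. sw X (\<lambda>p q. F (u \<cdot> u') p (v \<cdot> v') q) z) b) (r a x)"
    unfolding dsw_def by (rule sw_mult[OF bialg(2) U]) (assumption | rule F_lin a x b z)+
  also have "\<dots> = S (\<lambda>u p v q. S (\<lambda>u' p' v' q'. F (r u p \<cdot> u') p' (r v q \<cdot> v') q') b z) a x"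
    by (subst sw_r[OF U]) (assumption | rule F_lin a x b z | simp add: dsw_def)+
  finally show ?thesis .
qed

lemma S_mult_left:
  assumes U: "vec_space U"
    and F2: "\<And>u v. u \<in> carrier A \<Longrightarrow> v \<in> carrier A \<Longrightarrow> bilinear_on X X U (\<lambda>p q. F u p v q)"
    and a: "a \<in> carrier A" and y: "y \<in> carrier X" and b: "b \<in> carrier A" and z: "z \<in> carrier X"
  shows "S F a (y \<star> l b z) = S (\<lambda>u p v q. S (\<lambda>u' p' v' q'. F u (p \<star> l u' p') v (q \<star> l v' q')) b z) a y"
proof -
  have "S F a (y \<star> l b z) = sw A (\<lambda>u v. sw X (\<lambda>p q. F u p v q) (y \<star> l b z)) a"
    by (simp add: dsw_def)
  also have "\<dots> =
    sw A (\<lambda>u v. sw X (\<lambda>p q. S (\<lambda>u' p' v' q'. F u (p \<star> l u' p') v (q \<star> l v' q')) b z) y) a"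
  proof (rule sw_cong[OF coalg_A a])
    fix u v assume u: "u \<in> carrier A" and v: "v \<in> carrier A"
    note F_lin = lin U bilinearD[OF F2] u v
    have "sw X (\<lambda>p q. F u p v q) (y \<star> l b z) =
        sw X (\<lambda>p q. sw X (\<lambda>p' q'. F u (p \<star> p') v (q \<star> q')) (l b z)) y"
      by (rule sw_mult[OF bialg(1) U]) (assumption | rule F_lin y b z)+
    also have "\<dots> = sw X (\<lambda>p q. S (\<lambda>u' p' v' q'. F u (p \<star> l u' p') v (q \<star> l v' q')) b z) y"
      by (rule sw_cong[OF coalg_X y], rule sw_l[OF U]) (assumption | rule F_lin b z)+
    finally show "sw X (\<lambda>p q. F u p v q) (y \<star> l b z) =
        sw X (\<lambda>p q. S (\<lambda>u' p' v' q'. F u (p \<star> l u' p') v (q \<star> l v' q')) b z) y" .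
  qed
  finally show ?thesis by (simp only: dsw_def)
qed

section \<open>The coalgebra structure of the quasi-bicrossed product\<close>

lemma Q_sel [simp]:
  "carrier Q = carrier T" "smult Q = smult T" "unit_elt Q = unit_elt X \<otimes> unit_elt A"
  by (simp_all add: quasi_bicrossed_product_def)

lemmas linear_on_Q = linear_on_carrier_cong[of Q T, OF Q_sel(1,2)]

lemma vec_space_Q [simp, lin]: "vec_space Q"
  using vec_space_tensor[of X A] by (simp add: vec_space_def)

lemma bilinear_tens_Q: "bilinear_on X A Q (tens X A)"
  using bilinear_tens[of X A] by (simp add: bilinear_on_def linear_on_Q)

lemma tens_closed_Q: "x \<in> carrier X \<Longrightarrow> a \<in> carrier A \<Longrightarrow> x \<otimes> a \<in> carrier Q"
  by (simp add: tens_carrier)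

lemmas [lin] = bilinear_left[OF bilinear_tens_Q] bilinear_right[OF bilinear_tens_Q] tens_closed_Q

lemma Q_ext:
  assumes "linear_on Q U g" "linear_on Q U h"
    and "\<And>x a. x \<in> carrier X \<Longrightarrow> a \<in> carrier A \<Longrightarrow> g (x \<otimes> a) = h (x \<otimes> a)" "t \<in> carrier Q"
  shows "g t = h t"
  by (rule tensor_linear_ext[of X A U g h]) (use assms in \<open>simp_all add: linear_on_Q\<close>)

lemma linear_tsum_Q [lin]:
  assumes "vec_space U" "bilinear_on X A U f" "linear_on P Q g"
  shows "linear_on P U (\<lambda>t. tsum X A f (g t))"
  by (rule linear_on_tsum_arg) (use assms in \<open>simp_all add: linear_on_Q\<close>)

lemma linear_tsum_param_Q [lin]:
  assumes "vec_space U" "t \<in> carrier Q"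
    and "\<And>x a. x \<in> carrier X \<Longrightarrow> a \<in> carrier A \<Longrightarrow> linear_on P U (\<lambda>p. F p x a)"
  shows "linear_on P U (\<lambda>p. tsum X A (F p) t)"
  by (rule linear_tsum_param) (use assms in simp_all)

lemma mult_tens:
  "x \<in> carrier X \<Longrightarrow> y \<in> carrier X \<Longrightarrow> a \<in> carrier A \<Longrightarrow> b \<in> carrier A \<Longrightarrow>
    mult Q (x \<otimes> a) (y \<otimes> b) = S (\<lambda>u p v q. (x \<star> l u p) \<otimes> (r v q \<cdot> b)) a y"
  using quasi_bicrossed_product_tens(1)[OF matched] by (simp add: dsw_def)

lemma mult_Q: "mult Q s t = tsum X A (\<lambda>x a. tsum X A (\<lambda>y b.
    sw A (\<lambda>u v. sw X (\<lambda>p q. (x \<star> l u p) \<otimes> (r v q \<cdot> b)) y) a) t) s"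
  by (simp add: quasi_bicrossed_product_def)

lemma bil_Q: "bilinear_on Q Q Q (mult Q)"
  unfolding mult_Q by (assumption | rule lin)+

lemmas [lin] = bilinear_left[OF bil_Q] bilinear_right[OF bil_Q] bilinear_carrier[OF bil_Q]

text \<open>The coproduct is built with \<open>tens T T\<close>, whereas \<open>coalgebra Q\<close>
  speaks of \<open>tens Q Q\<close>. They agree because bilinearity only sees carrier and scalar
  multiplication.\<close>

lemma tens_QQ: "tens Q Q = tens T T"
  by (intro ext) (simp add: tens_def bilinear_on_def linear_on_Q)

lemma comult_tens:
  "x \<in> carrier X \<Longrightarrow> a \<in> carrier A \<Longrightarrow>
    comult Q (x \<otimes> a) = S (\<lambda>u p v q. tens Q Q (p \<otimes> u) (q \<otimes> v)) a x"
  using quasi_bicrossed_product_tens(2)[OF matched] by (simp add: dsw_def tens_QQ)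

lemma counit_tens:
  "x \<in> carrier X \<Longrightarrow> a \<in> carrier A \<Longrightarrow> counit Q (x \<otimes> a) = counit X x * counit A a"
  using quasi_bicrossed_product_tens(3)[OF matched] by simp

lemma comult_Q: "comult Q t = tsum X A (\<lambda>x a. sw A (\<lambda>u v. sw X (\<lambda>p q.
    tens Q Q (p \<otimes> u) (q \<otimes> v)) x) a) t"
  unfolding tens_QQ by (simp add: quasi_bicrossed_product_def)

lemma linear_comult_Q: "linear_on Q (tensor Q Q) (comult Q)"
  unfolding comult_Q by (assumption | rule lin)+

lemmas comult_Q_closed = linear_onD(1)[OF linear_comult_Q]

lemma linear_counits: "linear_on A scalars (counit A)" "linear_on X scalars (counit X)"
  by (simp_all add: coalgebraD(3))

lemmas [lin] = linear_on_compose[OF _ linear_counits(1)] linear_on_compose[OF _ linear_counits(2)]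

lemma linear_counit_Q: "linear_on Q scalars (counit Q)"
proof -
  have "linear_on Q scalars (\<lambda>t. tsum X A (\<lambda>x a. counit X x * counit A a) t)"
    by (assumption | rule lin)+
  then show ?thesis by (simp add: quasi_bicrossed_product_def)
qed

lemmas [lin] = linear_on_compose[OF _ linear_counit_Q]

lemma sw_Q:
  assumes U: "vec_space U" and f: "bilinear_on Q Q U f" and x: "x \<in> carrier X" and a: "a \<in> carrier A"
  shows "sw Q f (x \<otimes> a) = S (\<lambda>u p v q. f (p \<otimes> u) (q \<otimes> v)) a x"
  unfolding sw_def[of Q] comult_tens[OF x a] dsw_def
  by (rule tsum_sw_sw_tens[OF vec_space_Q U f]) (assumption | rule lin a x)+

lemma linear_sw_Q [lin]:
  assumes "vec_space U" "bilinear_on Q Q U f" "linear_on P Q g"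
  shows "linear_on P U (\<lambda>p. sw Q f (g p))"
  unfolding sw_def by (rule lin assms linear_on_compose[OF _ linear_comult_Q])+

lemma linear_sw_param_Q [lin]:
  assumes "vec_space U" "t \<in> carrier Q"
    and "\<And>u v. u \<in> carrier Q \<Longrightarrow> v \<in> carrier Q \<Longrightarrow> linear_on P U (\<lambda>p. F p u v)"
  shows "linear_on P U (\<lambda>p. sw Q (F p) t)"
  unfolding sw_def by (rule linear_tsum_param[OF vec_space_Q assms(1) comult_Q_closed[OF assms(2)] assms(3)])

lemma coassoc_Q:
  assumes U: "vec_space U" and f: "trilinear_on Q U f" and t: "t \<in> carrier Q"
  shows "sw Q (\<lambda>y z. sw Q (\<lambda>u v. f u v z) y) t = sw Q (\<lambda>u y. sw Q (\<lambda>v z. f u v z) y) t"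
proof (rule Q_ext[OF _ _ _ t])
  note f_lin = lin U trilinear_onD[OF f]
  show "linear_on Q U (sw Q (\<lambda>y z. sw Q (\<lambda>u v. f u v z) y))"
    "linear_on Q U (sw Q (\<lambda>u y. sw Q (\<lambda>v z. f u v z) y))"
    by (assumption | rule f_lin)+
  fix x a assume x: "x \<in> carrier X" and a: "a \<in> carrier A"
  have "sw Q (\<lambda>y z. sw Q (\<lambda>u v. f u v z) y) (x \<otimes> a) =
      S (\<lambda>u p w s. sw Q (\<lambda>u v. f u v (s \<otimes> w)) (p \<otimes> u)) a x"
    by (rule sw_Q[OF U]) (assumption | rule f_lin x a)+
  also have "\<dots> = S (\<lambda>u p w s. S (\<lambda>u p v q. f (p \<otimes> u) (q \<otimes> v) (s \<otimes> w)) u p) a x"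
    by (rule S_cong[OF a x], rule sw_Q[OF U]) (assumption | rule f_lin)+
  also have "\<dots> = S (\<lambda>u p w s. S (\<lambda>v q w s. f (p \<otimes> u) (q \<otimes> v) (s \<otimes> w)) w s) a x"
    by (rule S_assoc[OF U a x]) (assumption | rule f_lin)+
  also have "\<dots> = S (\<lambda>u p w s. sw Q (\<lambda>v z. f (p \<otimes> u) v z) (s \<otimes> w)) a x"
    by (rule S_cong[OF a x], rule sw_Q[OF U, symmetric]) (assumption | rule f_lin)+
  also have "\<dots> = sw Q (\<lambda>u y. sw Q (\<lambda>v z. f u v z) y) (x \<otimes> a)"
    by (rule sw_Q[OF U, symmetric]) (assumption | rule f_lin x a)+
  finally show "sw Q (\<lambda>y z. sw Q (\<lambda>u v. f u v z) y) (x \<otimes> a) =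
      sw Q (\<lambda>u y. sw Q (\<lambda>v z. f u v z) y) (x \<otimes> a)" .
qed

lemma S_counit:
  assumes U: "vec_space U" and f: "bilinear_on A X U f" and a: "a \<in> carrier A" and x: "x \<in> carrier X"
  shows "S (\<lambda>u p v q. smult U (counit X p * counit A u) (f v q)) a x = f a x"
    and "S (\<lambda>u p v q. smult U (counit X q * counit A v) (f u p)) a x = f a x"
proof -
  interpret vector_space "smult U" using U by (simp add: vec_space_def)
  note f_lin = lin U bilinearD[OF f]
  have "S (\<lambda>u p v q. smult U (counit X p * counit A u) (f v q)) a x =
      sw A (\<lambda>u v. sw X (\<lambda>p q. smult U (counit X p) (smult U (counit A u) (f v q))) x) a"
    by (simp add: dsw_def)
  also have "\<dots> = sw A (\<lambda>u v. smult U (counit A u) (f v x)) a"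
    by (rule sw_cong[OF coalg_A a], rule sw_counit(1)[OF coalg_X U x]) (assumption | rule f_lin x)+
  also have "\<dots> = f a x"
    by (rule sw_counit(1)[OF coalg_A U a]) (assumption | rule f_lin x)+
  finally show "S (\<lambda>u p v q. smult U (counit X p * counit A u) (f v q)) a x = f a x" .
  have "S (\<lambda>u p v q. smult U (counit X q * counit A v) (f u p)) a x =
      sw A (\<lambda>u v. sw X (\<lambda>p q. smult U (counit X q) (smult U (counit A v) (f u p))) x) a"
    by (simp add: dsw_def)
  also have "\<dots> = sw A (\<lambda>u v. smult U (counit A v) (f u x)) a"
    by (rule sw_cong[OF coalg_A a], rule sw_counit(2)[OF coalg_X U x]) (assumption | rule f_lin x)+
  also have "\<dots> = f a x"
    by (rule sw_counit(2)[OF coalg_A U a]) (assumption | rule f_lin x)+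
  finally show "S (\<lambda>u p v q. smult U (counit X q * counit A v) (f u p)) a x = f a x" .
qed

lemma bilinear_tens_flip: "bilinear_on A X Q (\<lambda>a x. x \<otimes> a)"
  by (assumption | rule lin)+

lemma counit_Q:
  assumes t: "t \<in> carrier Q"
  shows "sw Q (\<lambda>u v. smult Q (counit Q u) v) t = t" "sw Q (\<lambda>u v. smult Q (counit Q v) u) t = t"
proof -
  show "sw Q (\<lambda>u v. smult Q (counit Q u) v) t = t"
  proof (rule Q_ext[OF _ linear_on_id _ t])
    fix x a assume x: "x \<in> carrier X" and a: "a \<in> carrier A"
    have "sw Q (\<lambda>u v. smult Q (counit Q u) v) (x \<otimes> a) =
        S (\<lambda>u p v q. smult Q (counit Q (p \<otimes> u)) (q \<otimes> v)) a x"
      by (rule sw_Q[OF vec_space_Q _ x a]) (assumption | rule lin)+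
    also have "\<dots> = S (\<lambda>u p v q. smult Q (counit X p * counit A u) (q \<otimes> v)) a x"
      by (rule S_cong[OF a x]) (simp add: counit_tens)
    also have "\<dots> = x \<otimes> a" by (rule S_counit(1)[OF vec_space_Q bilinear_tens_flip a x])
    finally show "sw Q (\<lambda>u v. smult Q (counit Q u) v) (x \<otimes> a) = x \<otimes> a" .
  qed (assumption | rule lin)+
  show "sw Q (\<lambda>u v. smult Q (counit Q v) u) t = t"
  proof (rule Q_ext[OF _ linear_on_id _ t])
    fix x a assume x: "x \<in> carrier X" and a: "a \<in> carrier A"
    have "sw Q (\<lambda>u v. smult Q (counit Q v) u) (x \<otimes> a) =
        S (\<lambda>u p v q. smult Q (counit Q (q \<otimes> v)) (p \<otimes> u)) a x"
      by (rule sw_Q[OF vec_space_Q _ x a]) (assumption | rule lin)+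
    also have "\<dots> = S (\<lambda>u p v q. smult Q (counit X q * counit A v) (p \<otimes> u)) a x"
      by (rule S_cong[OF a x]) (simp add: counit_tens)
    also have "\<dots> = x \<otimes> a" by (rule S_counit(2)[OF vec_space_Q bilinear_tens_flip a x])
    finally show "sw Q (\<lambda>u v. smult Q (counit Q v) u) (x \<otimes> a) = x \<otimes> a" .
  qed (assumption | rule lin)+
qed

lemma coalgebra_Q: "coalgebra Q"
proof -
  have "sw Q (\<lambda>y z. sw Q (\<lambda>u v. tens Q (tensor Q Q) u (tens Q Q v z)) y) t =
      sw Q (\<lambda>u y. sw Q (\<lambda>v z. tens Q (tensor Q Q) u (tens Q Q v z)) y) t" if "t \<in> carrier Q" for t
    by (rule coassoc_Q[OF vec_space_tensor _ that]) (assumption | rule lin)+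
  then show ?thesis
    unfolding coalgebra_def
    using vec_space_Q linear_comult_Q linear_counit_Q counit_Q by blast
qed

section \<open>Unit and associativity of the quasi-bicrossed product\<close>

lemma unit_Q:
  assumes t: "t \<in> carrier Q"
  shows "mult Q (unit_elt Q) t = t" "mult Q t (unit_elt Q) = t"
proof -
  have u: "unit_elt Q \<in> carrier Q" by (simp add: tens_carrier)
  show "mult Q (unit_elt Q) t = t"
  proof (rule Q_ext[OF _ linear_on_id _ t])
    fix y b assume y: "y \<in> carrier X" and b: "b \<in> carrier A"
    let ?F = "\<lambda>u p v q. (unit_elt X \<star> l u p) \<otimes> (r v q \<cdot> b)"
    have "mult Q (unit_elt Q) (y \<otimes> b) = sw A (\<lambda>u v. sw X (\<lambda>p q. ?F u p v q) y) (unit_elt A)"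
      by (simp add: mult_tens y b dsw_def)
    also have "\<dots> = sw X (\<lambda>p q. ?F (unit_elt A) p (unit_elt A) q) y"
      by (rule sw_unit[OF bialg(2) vec_space_Q]) (assumption | rule lin y b)+
    \<comment> \<open>\<open>r_one\<close> reduces the action on the unit of \<open>A\<close> to a
      counit, which then removes the component \<open>q\<close>.\<close>
    also have "\<dots> = sw X (\<lambda>p q. smult Q (counit X q) (p \<otimes> b)) y"
    proof (rule sw_cong[OF coalg_X y])
      fix p q assume p: "p \<in> carrier X" and q: "q \<in> carrier X"
      have "r (unit_elt A) q \<cdot> b = smult A (counit X q) b"
        using linear_onD(3)[OF bilinear_left[OF bil_A b linear_on_id], of "unit_elt A" "counit X q"]
        by (simp add: r_one q b)
      then show "?F (unit_elt A) p (unit_elt A) q = smult Q (counit X q) (p \<otimes> b)"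
        by (simp add: p b l_unit tens_smult smult_tensor)
    qed
    also have "\<dots> = y \<otimes> b"
      by (rule sw_counit(2)[OF coalg_X vec_space_Q y]) (rule lin b)+
    finally show "mult Q (unit_elt Q) (y \<otimes> b) = y \<otimes> b" .
  qed (assumption | rule lin u)+
  show "mult Q t (unit_elt Q) = t"
  proof (rule Q_ext[OF _ linear_on_id _ t])
    fix x a assume x: "x \<in> carrier X" and a: "a \<in> carrier A"
    let ?F = "\<lambda>u p v q. (x \<star> l u p) \<otimes> (r v q \<cdot> unit_elt A)"
    have "mult Q (x \<otimes> a) (unit_elt Q) = sw A (\<lambda>u v. sw X (\<lambda>p q. ?F u p v q) (unit_elt X)) a"
      by (simp add: mult_tens x a dsw_def)
    also have "\<dots> = sw A (\<lambda>u v. ?F u (unit_elt X) v (unit_elt X)) a"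
      by (rule sw_cong[OF coalg_A a], rule sw_unit[OF bialg(1) vec_space_Q]) (assumption | rule lin x)+
    \<comment> \<open>Symmetrically, \<open>l_one\<close> leaves the counit of
      \<open>u\<close>.\<close>
    also have "\<dots> = sw A (\<lambda>u v. smult Q (counit A u) (x \<otimes> v)) a"
    proof (rule sw_cong[OF coalg_A a])
      fix u v assume u: "u \<in> carrier A" and v: "v \<in> carrier A"
      have "x \<star> l u (unit_elt X) = smult X (counit A u) x"
        using linear_onD(3)[OF bilinear_right[OF bil_X x linear_on_id], of "unit_elt X" "counit A u"]
        by (simp add: l_one u x)
      then show "?F u (unit_elt X) v (unit_elt X) = smult Q (counit A u) (x \<otimes> v)"
        by (simp add: x v r_unit tens_smult smult_tensor)
    qed
    also have "\<dots> = x \<otimes> a"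
      by (rule sw_counit(1)[OF coalg_A vec_space_Q a]) (rule lin x)+
    finally show "mult Q (x \<otimes> a) (unit_elt Q) = x \<otimes> a" .
  qed (assumption | rule lin u)+
qed

text \<open>Both bracketings reach the normal form \<open>?J\<close>, in which the pair of
  \<open>a\<close> and \<open>y\<close> and the pair of \<open>b\<close> and \<open>z\<close> are
  each split into three joint components. On the left \<open>r_cdot\<close> and
  \<open>l_mult\<close> produce it, on the right \<open>l_star\<close> and
  \<open>r_mult\<close>.\<close>

lemma assoc_tens:
  assumes x: "x \<in> carrier X" and a: "a \<in> carrier A" and y: "y \<in> carrier X" and b: "b \<in> carrier A"
    and z: "z \<in> carrier X" and c: "c \<in> carrier A"
  shows "mult Q (mult Q (x \<otimes> a) (y \<otimes> b)) (z \<otimes> c) = mult Q (x \<otimes> a) (mult Q (y \<otimes> b) (z \<otimes> c))"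
proof -
  note xs = x a y b z c
  \<comment> \<open>The summand of the normal form: \<open>u p\<close>, \<open>v q\<close>,
    \<open>v' q'\<close> come from \<open>a\<close> and \<open>y\<close>, while \<open>d e\<close>,
    \<open>d' e'\<close>, \<open>d'' e''\<close> come from \<open>b\<close> and
    \<open>z\<close>.\<close>
  let ?T = "\<lambda>u p v q v' q' d e d' e' d'' e''.
    (x \<star> (l u p \<star> l (r v q) (l d e))) \<otimes> (r (r v' q') (l d' e') \<cdot> (r d'' e'' \<cdot> c))"
  have "mult Q (mult Q (x \<otimes> a) (y \<otimes> b)) (z \<otimes> c) =
      mult Q (S (\<lambda>u p v q. (x \<star> l u p) \<otimes> (r v q \<cdot> b)) a y) (z \<otimes> c)"
    by (simp add: mult_tens xs)
  also have "\<dots> = S (\<lambda>u p v q. mult Q ((x \<star> l u p) \<otimes> (r v q \<cdot> b)) (z \<otimes> c)) a y"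
    by (rule linear_on_S[where U = Q and W = Q]) (assumption | rule lin xs)+
  also have "\<dots> = S (\<lambda>u p v q. S (\<lambda>d e d' e'.
      ((x \<star> l u p) \<star> l d e) \<otimes> (r d' e' \<cdot> c)) (r v q \<cdot> b) z) a y"
    by (rule S_cong[OF a y]) (simp add: mult_tens xs)
  also have "\<dots> = S (\<lambda>u p v q. S (\<lambda>v q v' q'. S (\<lambda>d e w s.
      ((x \<star> l u p) \<star> l (r v q \<cdot> d) e) \<otimes> (r (r v' q' \<cdot> w) s \<cdot> c)) b z) v q) a y"
    by (rule S_cong[OF a y], rule S_right_mult[OF vec_space_Q]) (assumption | rule lin xs)+
  also have "\<dots> = S (\<lambda>u p v q. S (\<lambda>v q v' q'. S (\<lambda>d e w s. S (\<lambda>d' e' d'' e''.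
      ?T u p v q v' q' d e d' e' d'' e'') w s) b z) v q) a y"
  proof (rule S_cong[OF a y], rule S_cong, assumption, assumption, rule S_cong[OF b z])
    fix u p v q v' q' d e w s
    assume A: "u \<in> carrier A" "v \<in> carrier A" "v' \<in> carrier A" "d \<in> carrier A" "w \<in> carrier A"
      and X: "p \<in> carrier X" "q \<in> carrier X" "q' \<in> carrier X" "e \<in> carrier X" "s \<in> carrier X"
    let ?L = "x \<star> (l u p \<star> l (r v q) (l d e))"
    have "((x \<star> l u p) \<star> l (r v q \<cdot> d) e) \<otimes> (r (r v' q' \<cdot> w) s \<cdot> c) =
        ?L \<otimes> (S (\<lambda>d' e' d'' e''. r (r v' q') (l d' e') \<cdot> r d'' e'') w s \<cdot> c)"
      by (simp add: A X xs l_mult assoc_X r_cdot)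
    also have "\<dots> = S (\<lambda>d' e' d'' e''. ?L \<otimes> (r (r v' q') (l d' e') \<cdot> r d'' e'' \<cdot> c)) w s"
      by (rule linear_on_S[where U = A and W = Q]) (assumption | rule lin xs A X)+
    also have "\<dots> = S (\<lambda>d' e' d'' e''. ?T u p v q v' q' d e d' e' d'' e'') w s"
      by (rule S_cong) (simp_all add: A X xs assoc_A)
    finally show "((x \<star> l u p) \<star> l (r v q \<cdot> d) e) \<otimes> (r (r v' q' \<cdot> w) s \<cdot> c) =
        S (\<lambda>d' e' d'' e''. ?T u p v q v' q' d e d' e' d'' e'') w s" .
  qed
  also have "\<dots> = S (\<lambda>u p v q. S (\<lambda>v q v' q'. S (\<lambda>w s d'' e''. S (\<lambda>d e d' e'.
      ?T u p v q v' q' d e d' e' d'' e'') w s) b z) v q) a y"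
    by (rule S_cong[OF a y], rule S_cong, assumption, assumption,
        rule S_assoc[OF vec_space_Q b z, symmetric]) (assumption | rule lin xs)+
  also have "\<dots> = S (\<lambda>t f v' q'. S (\<lambda>u p v q. S (\<lambda>w s d'' e''. S (\<lambda>d e d' e'.
      ?T u p v q v' q' d e d' e' d'' e'') w s) b z) t f) a y" (is "_ = ?J")
    by (rule S_assoc[OF vec_space_Q a y, symmetric]) (assumption | rule lin xs)+
  finally have left: "mult Q (mult Q (x \<otimes> a) (y \<otimes> b)) (z \<otimes> c) = ?J" .
  have "mult Q (x \<otimes> a) (mult Q (y \<otimes> b) (z \<otimes> c)) =
      mult Q (x \<otimes> a) (S (\<lambda>w s d'' e''. (y \<star> l w s) \<otimes> (r d'' e'' \<cdot> c)) b z)"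
    by (simp add: mult_tens xs)
  also have "\<dots> = S (\<lambda>w s d'' e''. mult Q (x \<otimes> a) ((y \<star> l w s) \<otimes> (r d'' e'' \<cdot> c))) b z"
    by (rule linear_on_S[where U = Q and W = Q]) (assumption | rule lin xs)+
  also have "\<dots> = S (\<lambda>w s d'' e''. S (\<lambda>u p v q.
      (x \<star> l u p) \<otimes> (r v q \<cdot> (r d'' e'' \<cdot> c))) a (y \<star> l w s)) b z"
    by (rule S_cong[OF b z]) (simp add: mult_tens xs)
  also have "\<dots> = S (\<lambda>w s d'' e''. S (\<lambda>t f v q. S (\<lambda>d e d' e'.
      (x \<star> l t (f \<star> l d e)) \<otimes> (r v (q \<star> l d' e') \<cdot> (r d'' e'' \<cdot> c))) w s) a y) b z"
    by (rule S_cong[OF b z], rule S_mult_left[OF vec_space_Q]) (assumption | rule lin xs)+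
  also have "\<dots> = S (\<lambda>w s d'' e''. S (\<lambda>t f v' q'. S (\<lambda>d e d' e'. S (\<lambda>u p v q.
      ?T u p v q v' q' d e d' e' d'' e'') t f) w s) a y) b z"
  proof (rule S_cong[OF b z], rule S_cong[OF a y], rule S_cong, assumption, assumption)
    fix d'' e'' t f v' q' d e d' e'
    assume A: "d'' \<in> carrier A" "t \<in> carrier A" "v' \<in> carrier A" "d \<in> carrier A" "d' \<in> carrier A"
      and X: "e'' \<in> carrier X" "f \<in> carrier X" "q' \<in> carrier X" "e \<in> carrier X" "e' \<in> carrier X"
    let ?R = "r (r v' q') (l d' e') \<cdot> (r d'' e'' \<cdot> c)"
    have "(x \<star> l t (f \<star> l d e)) \<otimes> (r v' (q' \<star> l d' e') \<cdot> (r d'' e'' \<cdot> c)) =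
        (x \<star> S (\<lambda>u p v q. l u p \<star> l (r v q) (l d e)) t f) \<otimes> ?R"
      by (simp add: A X r_mult l_star)
    also have "\<dots> = S (\<lambda>u p v q. ?T u p v q v' q' d e d' e' d'' e'') t f"
      by (rule linear_on_S[where U = X and W = Q]) (assumption | rule lin xs A X)+
    finally show "(x \<star> l t (f \<star> l d e)) \<otimes> (r v' (q' \<star> l d' e') \<cdot> (r d'' e'' \<cdot> c)) =
        S (\<lambda>u p v q. ?T u p v q v' q' d e d' e' d'' e'') t f" .
  qed
  \<comment> \<open>The splittings are now those of \<open>?J\<close>; only the nesting of
    independent sums remains to be exchanged.\<close>
  also have "\<dots> = S (\<lambda>w s d'' e''. S (\<lambda>t f v' q'. S (\<lambda>u p v q. S (\<lambda>d e d' e'.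
      ?T u p v q v' q' d e d' e' d'' e'') w s) t f) a y) b z"
    by (rule S_cong[OF b z], rule S_cong[OF a y], rule dsw_swap)
  also have "\<dots> = S (\<lambda>t f v' q'. S (\<lambda>w s d'' e''. S (\<lambda>u p v q. S (\<lambda>d e d' e'.
      ?T u p v q v' q' d e d' e' d'' e'') w s) t f) b z) a y"
    by (rule dsw_swap)
  also have "\<dots> = ?J"
    by (rule S_cong[OF a y], rule dsw_swap)
  finally show ?thesis using left by simp
qed

lemma assoc_Q:
  assumes s: "s \<in> carrier Q" and t: "t \<in> carrier Q" and w: "w \<in> carrier Q"
  shows "mult Q (mult Q s t) w = mult Q s (mult Q t w)"
proof (rule Q_ext[where U = Q, OF _ _ _ s])
  fix x a assume xa: "x \<in> carrier X" "a \<in> carrier A"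
  show "mult Q (mult Q (x \<otimes> a) t) w = mult Q (x \<otimes> a) (mult Q t w)"
  proof (rule Q_ext[where U = Q, OF _ _ _ t])
    fix y b assume yb: "y \<in> carrier X" "b \<in> carrier A"
    show "mult Q (mult Q (x \<otimes> a) (y \<otimes> b)) w = mult Q (x \<otimes> a) (mult Q (y \<otimes> b) w)"
      by (rule Q_ext[where U = Q, OF _ _ _ w])
        (rule assoc_tens[OF xa yb] | assumption | rule lin xa yb)+
  qed (assumption | rule lin xa w)+
qed (assumption | rule lin t w)+

lemma unital_Q: "unital_algebra Q"
  unfolding unital_algebra_def
proof (intro conjI)
  show "unit_elt Q \<in> carrier Q" by (simp add: tens_carrier)
qed (use bil_Q assoc_Q unit_Q in \<open>blast intro: vec_space_Q\<close>)+

section \<open>Compatibility of product and coproduct\<close>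

lemma S_exchange:
  "S (\<lambda>a x a' x'. S (\<lambda>b y b' y'. K a x a' x' b y b' y') b y) a x =
    S (\<lambda>b x b' x'. S (\<lambda>a y a' y'. K a x a' x' b y b' y') a y) b x"
  unfolding dsw_def sw_swap[of X A] by (rule sw_swap)

text \<open>Number the four joint components of \<open>a\<close> and \<open>y\<close>. The left side
  is the sum of \<open>g\<close> at \<open>l\<close> of 1, \<open>r\<close> of 3, \<open>l\<close>
  of 2, \<open>r\<close> of 4; the right side has \<open>r\<close> of 2 and \<open>l\<close> of 3
  instead. Coassociativity isolates the middle components, and the exchange condition
  \<open>S_swap_rl\<close> swaps their roles.\<close>

lemma S_middle_swap:
  assumes U: "vec_space U" and a: "a \<in> carrier A" and y: "y \<in> carrier X"
    and g1: "\<And>s x' s'. s \<in> carrier A \<Longrightarrow> x' \<in> carrier X \<Longrightarrow> s' \<in> carrier A \<Longrightarrow> linear_on X U (\<lambda>x. g x s x' s')"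
    and g2: "\<And>x x' s'. x \<in> carrier X \<Longrightarrow> x' \<in> carrier X \<Longrightarrow> s' \<in> carrier A \<Longrightarrow> linear_on A U (\<lambda>s. g x s x' s')"
    and g3: "\<And>x s s'. x \<in> carrier X \<Longrightarrow> s \<in> carrier A \<Longrightarrow> s' \<in> carrier A \<Longrightarrow> linear_on X U (\<lambda>x'. g x s x' s')"
    and g4: "\<And>x s x'. x \<in> carrier X \<Longrightarrow> s \<in> carrier A \<Longrightarrow> x' \<in> carrier X \<Longrightarrow> linear_on A U (\<lambda>s'. g x s x' s')"
  shows "S (\<lambda>u p v q. S (\<lambda>v q v' q'. S (\<lambda>u p u' p'. g (l u p) (r v q) (l u' p') (r v' q')) u p) v q) a y =
    S (\<lambda>u p v q. S (\<lambda>u p u' p'. S (\<lambda>v q v' q'. g (l u p) (r u' p') (l v q) (r v' q')) v q) u p) a y"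
proof -
  note g_lin = lin U linear_on_compose[OF _ g1] linear_on_compose[OF _ g2] linear_on_compose[OF _ g3]
    linear_on_compose[OF _ g4] linear_onD(1)[OF g1]
  let ?G = "\<lambda>u p v q u' p' v' q'. g (l u p) (r v q) (l u' p') (r v' q')"
  have "S (\<lambda>u p v q. S (\<lambda>v q v' q'. S (\<lambda>u p u' p'. ?G u p v q u' p' v' q') u p) v q) a y =
      S (\<lambda>u p v q. S (\<lambda>u p u' p'. S (\<lambda>v q v' q'. ?G u p v q u' p' v' q') v q) u p) a y"
    by (rule S_cong[OF a y], rule dsw_swap)
  also have "\<dots> = S (\<lambda>u p w s. S (\<lambda>u' p' v q. S (\<lambda>v q v' q'. ?G u p v q u' p' v' q') v q) w s) a y"
    by (rule S_assoc[OF U a y]) (assumption | rule g_lin)+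
  also have "\<dots> = S (\<lambda>u p w s. S (\<lambda>t e v' q'. S (\<lambda>u' p' v q. ?G u p v q u' p' v' q') t e) w s) a y"
    by (rule S_cong[OF a y], rule S_assoc[OF U, symmetric]) (assumption | rule g_lin)+
  also have "\<dots> = S (\<lambda>u p w s. S (\<lambda>t e v' q'. S (\<lambda>v q u' p'. ?G u p v q u' p' v' q') t e) w s) a y"
    by (rule S_cong[OF a y], rule S_cong, assumption, assumption, rule S_swap_rl[OF U, symmetric])
      (assumption | rule g_lin)+
  also have "\<dots> = S (\<lambda>u p w s. S (\<lambda>v q t e. S (\<lambda>u' p' v' q'. ?G u p v q u' p' v' q') t e) w s) a y"
    by (rule S_cong[OF a y], rule S_assoc[OF U]) (assumption | rule g_lin)+
  also have "\<dots> = S (\<lambda>u p w s. S (\<lambda>u p v q. S (\<lambda>u' p' v' q'. ?G u p v q u' p' v' q') w s) u p) a y"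
    by (rule S_assoc[OF U a y, symmetric]) (assumption | rule g_lin)+
  finally show ?thesis .
qed

text \<open>The coproduct of a product splits the factors \<open>l u p\<close> and
  \<open>r v q\<close> afterwards, giving components in the order \<open>l\<close>,
  \<open>l\<close>, \<open>r\<close>, \<open>r\<close>; the product of coproducts gives
  \<open>l\<close>, \<open>r\<close>, \<open>l\<close>, \<open>r\<close>.
  \<open>S_middle_swap\<close> bridges the difference.\<close>

lemma comult_mult_tens:
  assumes x: "x \<in> carrier X" and a: "a \<in> carrier A" and y: "y \<in> carrier X" and b: "b \<in> carrier A"
  shows "comult Q (mult Q (x \<otimes> a) (y \<otimes> b)) =
    sw Q (\<lambda>s s'. sw Q (\<lambda>t t'. tens Q Q (mult Q s t) (mult Q s' t')) (y \<otimes> b)) (x \<otimes> a)"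
proof -
  note xs = x a y b
  let ?U = "tensor Q Q"
  let ?H = "\<lambda>d e d' e' m n m' n'. tens Q Q ((e \<star> m) \<otimes> (n \<cdot> d)) ((e' \<star> m') \<otimes> (n' \<cdot> d'))"
  have "comult Q (mult Q (x \<otimes> a) (y \<otimes> b)) = comult Q (S (\<lambda>u p v q. (x \<star> l u p) \<otimes> (r v q \<cdot> b)) a y)"
    by (simp add: mult_tens xs)
  also have "\<dots> = S (\<lambda>u p v q. comult Q ((x \<star> l u p) \<otimes> (r v q \<cdot> b))) a y"
    by (rule linear_on_S[OF linear_comult_Q]) (assumption | rule lin xs)+
  also have "\<dots> = S (\<lambda>u p v q. S (\<lambda>d e d' e'. tens Q Q (e \<otimes> d) (e' \<otimes> d')) (r v q \<cdot> b) (x \<star> l u p)) a y"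
    by (rule S_cong[OF a y]) (simp add: comult_tens xs)
  also have "\<dots> = S (\<lambda>u p v q. S (\<lambda>v q v' q'. S (\<lambda>d e d' e'.
      tens Q Q (e \<otimes> (r v q \<cdot> d)) (e' \<otimes> (r v' q' \<cdot> d'))) b (x \<star> l u p)) v q) a y"
    by (rule S_cong[OF a y], rule S_right_mult[OF vec_space_tensor[of Q Q]]) (assumption | rule lin xs)+
  also have "\<dots> = S (\<lambda>u p v q. S (\<lambda>v q v' q'. S (\<lambda>d e d' e'. S (\<lambda>u p u' p'.
      ?H d e d' e' (l u p) (r v q) (l u' p') (r v' q')) u p) b x) v q) a y"
    by (rule S_cong[OF a y], rule S_cong, assumption, assumption, rule S_mult_left[OF vec_space_tensor[of Q Q]])
      (assumption | rule lin xs)+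
  also have "\<dots> = S (\<lambda>u p v q. S (\<lambda>d e d' e'. S (\<lambda>v q v' q'. S (\<lambda>u p u' p'.
      ?H d e d' e' (l u p) (r v q) (l u' p') (r v' q')) u p) v q) b x) a y"
    by (rule S_cong[OF a y], rule dsw_swap)
  also have "\<dots> = S (\<lambda>d e d' e'. S (\<lambda>u p v q. S (\<lambda>v q v' q'. S (\<lambda>u p u' p'.
      ?H d e d' e' (l u p) (r v q) (l u' p') (r v' q')) u p) v q) a y) b x"
    by (rule dsw_swap)
  also have "\<dots> = S (\<lambda>d e d' e'. S (\<lambda>u p v q. S (\<lambda>u p u' p'. S (\<lambda>v q v' q'.
      ?H d e d' e' (l u p) (r u' p') (l v q) (r v' q')) v q) u p) a y) b x"
    by (rule S_cong[OF b x], rule S_middle_swap[OF vec_space_tensor[of Q Q] a y])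
      (assumption | rule lin)+
  \<comment> \<open>The product formula sums jointly over \<open>a\<close> with \<open>y\<close>,
    whereas the coproduct of \<open>x \<otimes> a\<close> sums over \<open>a\<close> with
    \<open>x\<close>. The sums are regrouped accordingly, \<open>b\<close> now going with
    \<open>y\<close>.\<close>
  also have "\<dots> = S (\<lambda>u e v e'. S (\<lambda>d p d' q. S (\<lambda>u p u' p'. S (\<lambda>v q v' q'.
      ?H d e d' e' (l u p) (r u' p') (l v q) (r v' q')) v q) u p) b y) a x"
    by (rule S_exchange[symmetric])
  also have "\<dots> = S (\<lambda>u e v e'. S (\<lambda>d p d' q.
      tens Q Q (mult Q (e \<otimes> u) (p \<otimes> d)) (mult Q (e' \<otimes> v) (q \<otimes> d'))) b y) a x"
  proof (rule S_cong[OF a x], rule S_cong[OF b y])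
    fix u e v e' d p d' q
    assume A: "u \<in> carrier A" "v \<in> carrier A" "d \<in> carrier A" "d' \<in> carrier A"
      and X: "e \<in> carrier X" "e' \<in> carrier X" "p \<in> carrier X" "q \<in> carrier X"
    let ?m = "\<lambda>u p u' p'. (e \<star> l u p) \<otimes> (r u' p' \<cdot> d)"
    let ?n = "\<lambda>v q v' q'. (e' \<star> l v q) \<otimes> (r v' q' \<cdot> d')"
    have "tens Q Q (mult Q (e \<otimes> u) (p \<otimes> d)) (mult Q (e' \<otimes> v) (q \<otimes> d')) =
        tens Q Q (S ?m u p) (S ?n v q)"
      by (simp add: mult_tens A X)
    also have "\<dots> = S (\<lambda>u p u' p'. tens Q Q (?m u p u' p') (S ?n v q)) u p"
      by (rule linear_on_S[where U = Q and W = ?U]) (assumption | rule lin A X)+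
    also have "\<dots> = S (\<lambda>u p u' p'. S (\<lambda>v q v' q'. tens Q Q (?m u p u' p') (?n v q v' q')) v q) u p"
      by (rule S_cong[OF A(1) X(3)], rule linear_on_S[where U = Q and W = ?U]) (assumption | rule lin A X)+
    finally show "S (\<lambda>u p u' p'. S (\<lambda>v q v' q'.
        ?H d e d' e' (l u p) (r u' p') (l v q) (r v' q')) v q) u p =
        tens Q Q (mult Q (e \<otimes> u) (p \<otimes> d)) (mult Q (e' \<otimes> v) (q \<otimes> d'))" ..
  qed
  also have "\<dots> = S (\<lambda>u e v e'. sw Q (\<lambda>t t'.
      tens Q Q (mult Q (e \<otimes> u) t) (mult Q (e' \<otimes> v) t')) (y \<otimes> b)) a x"
    by (rule S_cong[OF a x], rule sw_Q[where U = ?U, symmetric]) (assumption | rule lin xs)+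
  also have "\<dots> = sw Q (\<lambda>s s'. sw Q (\<lambda>t t'. tens Q Q (mult Q s t) (mult Q s' t')) (y \<otimes> b)) (x \<otimes> a)"
    by (rule sw_Q[where U = ?U, symmetric]) (assumption | rule lin xs)+
  finally show ?thesis .
qed

lemma comult_mult_Q:
  assumes s: "s \<in> carrier Q" and t: "t \<in> carrier Q"
  shows "comult Q (mult Q s t) =
    sw Q (\<lambda>s s'. sw Q (\<lambda>t t'. tens Q Q (mult Q s t) (mult Q s' t')) t) s"
proof (rule Q_ext[where U = "tensor Q Q" and g = "\<lambda>s. comult Q (mult Q s t)"
      and h = "sw Q (\<lambda>s s'. sw Q (\<lambda>t t'. tens Q Q (mult Q s t) (mult Q s' t')) t)", OF _ _ _ s])
  note com = linear_on_compose[OF _ linear_comult_Q]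
  show "linear_on Q (tensor Q Q) (\<lambda>s. comult Q (mult Q s t))" by (rule lin com t)+
  show "linear_on Q (tensor Q Q) (sw Q (\<lambda>s s'. sw Q (\<lambda>t t'. tens Q Q (mult Q s t) (mult Q s' t')) t))"
    by (assumption | rule lin t)+
  fix x a assume x: "x \<in> carrier X" and a: "a \<in> carrier A"
  show "comult Q (mult Q (x \<otimes> a) t) =
      sw Q (\<lambda>s s'. sw Q (\<lambda>t t'. tens Q Q (mult Q s t) (mult Q s' t')) t) (x \<otimes> a)"
  proof (rule Q_ext[where U = "tensor Q Q" and g = "\<lambda>t. comult Q (mult Q (x \<otimes> a) t)"
        and h = "\<lambda>t. sw Q (\<lambda>s s'. sw Q (\<lambda>t t'. tens Q Q (mult Q s t) (mult Q s' t')) t) (x \<otimes> a)",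
        OF _ _ _ t])
    show "linear_on Q (tensor Q Q) (\<lambda>t. comult Q (mult Q (x \<otimes> a) t))" by (rule lin com x a)+
    show "linear_on Q (tensor Q Q)
        (\<lambda>t. sw Q (\<lambda>s s'. sw Q (\<lambda>t t'. tens Q Q (mult Q s t) (mult Q s' t')) t) (x \<otimes> a))"
      by (assumption | rule lin x a)+
  qed (rule comult_mult_tens[OF x a])
qed

lemma almost_bialgebra_Q: "almost_bialgebra Q"
  unfolding almost_bialgebra_def using unital_Q coalgebra_Q comult_mult_Q by blast

end

theorem mainTheorem1:
  fixes X :: "('k::field, 'x::ab_group_add) bialg" and S\<^sub>X :: "'x \<Rightarrow> 'x"
    and A :: "('k, 'a::ab_group_add) bialg" and S\<^sub>A :: "'a \<Rightarrow> 'a"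
    and B :: "'x \<Rightarrow> 'a \<Rightarrow> 'k"
  assumes "perfect_weak_hopf_algebra A S\<^sub>A"
    and "perfect_weak_hopf_algebra X S\<^sub>X"
    and "bij_betw S\<^sub>A (carrier A) (carrier A)"
    and "weak_hopf_skew_pair X S\<^sub>X A S\<^sub>A B"
  shows "quasi_matched_pair X A (skew_left_action X S\<^sub>X B) (skew_right_action A S\<^sub>A B)
    \<and> almost_bialgebra
        (quasi_bicrossed_product X A (skew_left_action X S\<^sub>X B) (skew_right_action A S\<^sub>A B))"
proof -
  interpret skew_pairing X S\<^sub>X A S\<^sub>A B by unfold_locales (rule assms)+
  interpret matched_pair X A "skew_left_action X S\<^sub>X B" "skew_right_action A S\<^sub>A B"
    by unfold_locales (rule quasi_matched)
  show ?thesis using quasi_matched almost_bialgebra_Q by blast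
qed

end
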